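(* The normalized rank of odd unimodal sequences is asymptotically distributed according to the hyperbolic secant distribution with mean $0$ and scale $1$. In particular, for all $x\in\mathbb R$, $$\lim_{n\to\infty}\frac{1}{\mathrm{ou}(n)}\left|\left\{\sigma\in\mathcal{OU}(n):\frac{\mathrm{rank}(\sigma)}{\sqrt{3n/2}}\le x\right\}\right|=\frac2\pi\arctan\left(e^{\pi x/2}\right).$$
   Context: An odd unimodal sequence of size $n$ is a sequence of odd positive integers $a_1\le\dots\le a_r\le\bar c\ge b_1\ge\dots\ge b_s$ ($r,s\ge0$) with a distinguished peak $\bar c$ and $n=\bar c+\sum_{j=1}^r a_j+\sum_{j=1}^s b_j$. Its rank is $r-s$. $\mathcal{OU}(n)$ is the set of odd unimodal sequences of size $n$ and $\mathrm{ou}(n)=|\mathcal{OU}(n)|$. The normalized rank is $\mathrm{rank}(\sigma)/\sqrt{3n/2}$ for $\sigma$ uniformly distributed in $\mathcal{OU}(n)$. The hyperbolic secant distribution with mean $0$ and scale $1$ has cumulative distribution function $\frac2\pi\arctan(e^{\pi x/2})$. *)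

theory Defs
  imports "HOL-Probability.Probability" "HOL-Real_Asymp.Real_Asymp"
begin

text \<open>
  A triple \<open>(as, c, bs)\<close> stands for the sequence
  \<open>a\<^sub>1 \<le> \<dots> \<le> a\<^sub>r \<le> c \<ge> b\<^sub>1 \<ge> \<dots> \<ge> b\<^sub>s\<close> with distinguished peak \<open>c\<close>; keeping \<open>c\<close> as
  a separate component means that two sequences that differ only in which of several maximal
  entries is marked as the peak are counted as different. Odd natural numbers are positive.
\<close>

type_synonym marked_seq = "nat list \<times> nat \<times> nat list"

fun odd_unimodal :: "marked_seq \<Rightarrow> bool" where
  "odd_unimodal (as, c, bs) \<longleftrightarrow>
     (\<forall>x \<in> set (as @ c # bs). odd x) \<and> sorted_wrt (\<le>) (as @ [c]) \<and> sorted_wrt (\<ge>) (c # bs)"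

fun seq_size :: "marked_seq \<Rightarrow> nat" where
  "seq_size (as, c, bs) = c + sum_list as + sum_list bs"

fun seq_rank :: "marked_seq \<Rightarrow> int" where
  "seq_rank (as, c, bs) = int (length as) - int (length bs)"

definition OU :: "nat \<Rightarrow> marked_seq set" where
  "OU n = {\<sigma>. odd_unimodal \<sigma> \<and> seq_size \<sigma> = n}"

definition ou :: "nat \<Rightarrow> nat" where
  "ou n = card (OU n)"

definition normalized_rank :: "nat \<Rightarrow> marked_seq \<Rightarrow> real" where
  "normalized_rank n \<sigma> = real_of_int (seq_rank \<sigma>) / sqrt (3 * real n / 2)"

lemma sum_list_ge_length: "(\<forall>x \<in> set xs. 0 < x) \<Longrightarrow> length xs \<le> sum_list xs" for xs :: "nat list"
  by (induction xs) auto

lemma finite_OU: "finite (OU n)"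
proof (rule finite_subset)
  let ?L = "{xs :: nat list. set xs \<subseteq> {..n} \<and> length xs \<le> n}"
  show "OU n \<subseteq> ?L \<times> {..n} \<times> ?L"
  proof
    fix \<sigma> assume \<sigma>: "\<sigma> \<in> OU n"
    obtain as c bs where [simp]: "\<sigma> = (as, c, bs)" by (cases \<sigma>)
    from \<sigma> have o: "\<forall>x \<in> set as. 0 < x" "\<forall>x \<in> set bs. 0 < x" and s: "c + sum_list as + sum_list bs = n"
      by (auto simp: OU_def intro: odd_pos)
    have "length as \<le> sum_list as" "length bs \<le> sum_list bs"
      using o by (simp_all add: sum_list_ge_length)
    moreover have "x \<le> sum_list as" if "x \<in> set as" for x using that by (simp add: member_le_sum_list)
    moreover have "x \<le> sum_list bs" if "x \<in> set bs" for x using that by (simp add: member_le_sum_list)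
    ultimately show "\<sigma> \<in> ?L \<times> {..n} \<times> ?L" using s by fastforce
  qed
  have "finite ?L" by (intro finite_lists_length_le) simp
  then show "finite (?L \<times> {..n} \<times> ?L)" by simp
qed

lemma OU_nonempty: "0 < n \<Longrightarrow> OU n \<noteq> {}"
proof -
  assume "0 < n"
  then have "(replicate (n - 1) 1, 1, []) \<in> OU n"
    by (auto simp: OU_def sorted_wrt_append sum_list_replicate sorted_replicate)
  then show ?thesis by blast
qed

text \<open>
  The law of the normalized rank of a uniformly random element of \<open>OU n\<close>. It is meaningful for
  \<open>n \<ge> 1\<close> only, as \<open>OU 0\<close> is empty and \<open>pmf_of_set {}\<close> is an unspecified distribution.
\<close>

definition normalized_rank_distr :: "nat \<Rightarrow> real measure" where
  "normalized_rank_distr n = distr (measure_pmf (pmf_of_set (OU n))) borel (normalized_rank n)"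

text \<open>The hyperbolic secant distribution with mean \<open>0\<close> and scale \<open>1\<close>, given by its CDF.\<close>

definition hyp_secant_cdf :: "real \<Rightarrow> real" where
  "hyp_secant_cdf x = 2 / pi * arctan (exp (pi * x / 2))"

definition hyp_secant_distr :: "real measure" where
  "hyp_secant_distr = interval_measure hyp_secant_cdf"

lemma hyp_secant_cdf_props:
  shows hyp_secant_cdf_mono: "x \<le> y \<Longrightarrow> hyp_secant_cdf x \<le> hyp_secant_cdf y"
    and hyp_secant_cdf_right_cont: "continuous (at_right a) hyp_secant_cdf"
    and hyp_secant_cdf_at_bot: "(hyp_secant_cdf \<longlongrightarrow> 0) at_bot"
    and hyp_secant_cdf_at_top: "(hyp_secant_cdf \<longlongrightarrow> 1) at_top"
proof -
  show "x \<le> y \<Longrightarrow> hyp_secant_cdf x \<le> hyp_secant_cdf y"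
    by (auto simp: hyp_secant_cdf_def intro!: mult_left_mono divide_right_mono arctan_monotone')
  show "continuous (at_right a) hyp_secant_cdf"
    unfolding hyp_secant_cdf_def by (intro continuous_intros) simp
  have "((\<lambda>x. exp (pi * x / 2)) \<longlongrightarrow> 0) at_bot" by real_asymp
  then have "((\<lambda>x. 2 / pi * arctan (exp (pi * x / 2))) \<longlongrightarrow> 2 / pi * arctan 0) at_bot"
    by (intro tendsto_intros)
  then show "(hyp_secant_cdf \<longlongrightarrow> 0) at_bot" unfolding hyp_secant_cdf_def by simp
  have "filterlim (\<lambda>x. exp (pi * x / 2)) at_top at_top" by real_asymp
  then have "((\<lambda>x. 2 / pi * arctan (exp (pi * x / 2))) \<longlongrightarrow> 2 / pi * (pi / 2)) at_top"
    by (intro tendsto_intros filterlim_compose[OF tendsto_arctan_at_top])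
  then show "(hyp_secant_cdf \<longlongrightarrow> 1) at_top" unfolding hyp_secant_cdf_def by simp
qed

lemma real_distribution_hyp_secant: "real_distribution hyp_secant_distr"
  unfolding hyp_secant_distr_def
  by (intro real_distribution_interval_measure hyp_secant_cdf_props)

lemma cdf_hyp_secant: "cdf hyp_secant_distr = hyp_secant_cdf"
  unfolding hyp_secant_distr_def
  by (intro cdf_interval_measure hyp_secant_cdf_props)

end

theory Submission
  imports Defs
begin

text \<open>
  For a fixed peak \<open>2k+1\<close> the two sides of the sequence form a pair of partitions into odd parts
  \<open>\<le> 2k+1\<close>. Write \<open>g(m)\<close> for the number of such pairs of total size \<open>m\<close>, and \<open>P\<close>, \<open>Q\<close> for the first and
  second partial sums of \<open>g\<close>. The logarithmic derivative of the generating function, the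
  average order of the sum of the odd divisors of an integer, and a summation by parts give
  \<open>N g(N) \<exp_profile> (\<pi>\<^sup>2/6) Q(N)\<close>. So \<open>\<rho> = P/Q\<close> satisfies a discrete Riccati equation
  \<open>\<rho>' = \<lambda>\<^sup>2/N + \<rho>/(1+\<rho>)\<close> with \<open>\<lambda> = \<pi>/\<surd>6\<close>, whose solutions are all attracted to \<open>\<lambda>/\<surd>N\<close>. Hence
  \<open>g(m-s)/g(m) \<rightarrow> exp(-\<lambda>s/\<surd>m)\<close> uniformly in \<open>s\<close> as soon as \<open>k/\<surd>m \<rightarrow> \<infinity>\<close>; no circle method and no
  asymptotic formula for \<open>ou(n)\<close> is needed.

  The number of copies of the part \<open>2j+1\<close> on one side exceeds \<open>a\<close> with probability about
  \<open>g(m-(2j+1)a)/g(m)\<close>, so in the scale \<open>\<surd>m\<close> it becomes exponential with rate \<open>\<lambda>(2j+1)\<close>, independently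
  for different \<open>j\<close> and for the two sides. The characteristic function of the rank is thus
  asymptotically \<open>\<Prod>\<^sub>j 1/(1+(\<theta>/\<lambda>)\<^sup>2/(2j+1)\<^sup>2) = 1/cosh(\<pi>\<theta>/(2\<lambda>))\<close>. Peaks
  \<open>\<le> K\<surd>n\<close> and peaks \<open>\<ge> \<epsilon>n\<close> have negligible probability, and Levy's continuity theorem finishes the proof.
\<close>

section \<open>The hyperbolic secant distribution\<close>

text \<open>The divisor sums in the recurrence for \<open>pairs\<close> are too irregular to be used
  directly; only their summatory function has a smooth leading term. Summation by parts moves the
  recurrence onto the backward differences of g, which are nonnegative, and the weight s(s+1)/2 on
  these differences is what produces Q. Hence Q, not g or P, is the quantity compared with N g(N).

  Parts are cut off at the peak, so the divisor sums are complete only up to 2k. The range beyond is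
  harmless once g(m-s)/g(m) is known to decay on the scale sqrt m; this crude decay follows from the
  recurrence alone and serves as majorant throughout. The peak moves with n, so every limit must be
  uniform in k.

  The scale sqrt (3n/2) comes from lambda = pi / sqrt 6: with argument tau for the normalized rank,
  theta = tau / sqrt (3/2) and pi theta / (2 lambda) = tau. Each peak in the admissible range yields
  the same limiting characteristic function, so averaging over the peaks preserves it.\<close>

lemma sin_pi_mult_nonzero:
  fixes z :: complex
  assumes "z \<notin> \<int>"
  shows "sin (of_real pi * z) \<noteq> 0"
  using assms by (metis Ints_of_int mult_cancel_left nonzero_mult_div_cancel_left of_real_eq_0_iff of_real_mult
      of_real_of_int_eq pi_neq_zero sin_eq_0 mult.commute)

text \<open>Near z the product \<open>Gamma w * Gamma (1 - w) * sin (of_real pi * w)\<close> is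
  constant, so its derivative computed by the product rule vanishes; dividing by the nonzero Gamma
  values leaves the cotangent.\<close>

lemma Digamma_reflection:
  fixes z :: complex
  assumes "z \<notin> \<int>"
  shows "Digamma (1 - z) - Digamma z = of_real pi * cos (of_real pi * z) / sin (of_real pi * z)"
proof -
  have nz: "z \<notin> \<int>\<^sub>\<le>\<^sub>0" using assms by (meson nonpos_Ints_Int)
  have "1 - z \<notin> \<int>"
    using assms Ints_diff[of 1 "1 - z"] by auto
  then have nz': "1 - z \<notin> \<int>\<^sub>\<le>\<^sub>0" by (meson nonpos_Ints_Int)
  have eq: "(\<lambda>w::complex. Gamma w * Gamma (1 - w) * sin (of_real pi * w)) = (\<lambda>w. if sin (of_real pi * w)
      = 0 then 0 else of_real pi)"
    by (auto simp: Gamma_reflection_complex)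
  have s0: "sin (of_real pi * z) \<noteq> 0"
    by (rule sin_pi_mult_nonzero[OF assms])
  have "((\<lambda>w::complex. Gamma w * Gamma (1 - w) * sin (of_real pi * w)) has_field_derivative
      (Gamma z * Digamma z * Gamma (1 - z) - Gamma z * (Gamma (1 - z) * Digamma (1 - z))) * sin (of_real pi * z)
      + Gamma z * Gamma (1 - z) * (of_real pi * cos (of_real pi * z))) (at z)"
    using nz nz' by (auto intro!: derivative_eq_intros simp: algebra_simps)
  moreover have "((\<lambda>w::complex. Gamma w * Gamma (1 - w) * sin (of_real pi * w)) has_field_derivative 0) (at z)"
  proof -
    have "open {w::complex. sin (of_real pi * w) \<noteq> 0}"
      by (intro open_Collect_neq continuous_intros)
    then have "eventually (\<lambda>w::complex. sin (of_real pi * w) \<noteq> 0) (nhds z)"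
      using s0 by (auto simp: eventually_nhds)
    then have "eventually (\<lambda>w::complex. Gamma w * Gamma (1 - w) * sin (of_real pi * w) = of_real pi) (nhds z)"
      by eventually_elim (simp add: Gamma_reflection_complex)
    then show ?thesis
      by (subst DERIV_cong_ev[OF refl _ refl]) (auto intro: DERIV_const)
  qed
  ultimately have "(Gamma z * Digamma z * Gamma (1 - z) - Gamma z * (Gamma (1 - z) * Digamma (1 - z)))
      * sin (of_real pi * z)
      + Gamma z * Gamma (1 - z) * (of_real pi * cos (of_real pi * z)) = 0"
    using DERIV_unique by blast
  then have "Gamma z * Gamma (1 - z) * ((Digamma (1 - z) - Digamma z) * sin (of_real pi * z) - of_real pi
      * cos (of_real pi * z)) = 0"
    by (simp add: algebra_simps)
  moreover have "Gamma z \<noteq> 0" "Gamma (1 - z) \<noteq> 0"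
    using nz nz' by (auto simp: Gamma_eq_zero_iff)
  ultimately have "(Digamma (1 - z) - Digamma z) * sin (of_real pi * z) = of_real pi * cos (of_real pi * z)"
    by simp
  then show ?thesis using s0 by (simp only: nonzero_eq_divide_eq not_False_eq_True)
qed

text \<open>Each of the two Digamma limits carries a divergent term ln J; it cancels in the
  difference.\<close>

lemma Digamma_diff_LIMSEQ:
  fixes a b :: complex
  assumes "a \<noteq> 0" "b \<noteq> 0"
  shows "(\<lambda>J. \<Sum>j<J. 1 / (of_nat j + a) - 1 / (of_nat j + b)) \<longlonglongrightarrow> Digamma b - Digamma a"
proof -
  have "(\<lambda>J. (of_real (ln (real J)) - (\<Sum>n<J. inverse (b + of_nat n)))
           - (of_real (ln (real J)) - (\<Sum>n<J. inverse (a + of_nat n)))) \<longlonglongrightarrow> Digamma b - Digamma a"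
    by (intro tendsto_diff Digamma_LIMSEQ assms)
  then show ?thesis by (simp add: sum_subtractf add.commute inverse_eq_divide)
qed

text \<open>Terms of even and odd index pair up into two Digamma differences; an even number of
  terms keeps the pairs intact. The four Digamma values regroup into two reflections, at z/2 and
  (1-z)/2, and cot u + tan u = 2 / sin (2u) at u = pi z / 2.\<close>

lemma csc_partial_fractions:
  fixes z :: complex
  assumes "z \<notin> \<int>"
  shows "(\<lambda>J. \<Sum>k<2*J. (-1)^k * (1 / (of_nat k + z) + 1 / (of_nat k + 1 - z)))
           \<longlonglongrightarrow> of_real pi / sin (of_real pi * z)"
proof -
  have i1: "z/2 \<notin> \<int>"
    using assms by (metis Ints_mult Ints_numeral divide_eq_eq zero_neq_numeral)
  have i2: "(1+z)/2 \<notin> \<int>"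
  proof
    assume "(1+z)/2 \<in> \<int>"
    then have "2 * ((1+z)/2) - 1 \<in> \<int>" by (intro Ints_diff Ints_mult) auto
    moreover have e: "2 * ((1+z)/2) - 1 = z" by (simp add: add_divide_distrib)
    ultimately show False using assms by (simp only: e)
  qed
  have i3: "(1-z)/2 \<notin> \<int>"
  proof
    assume "(1-z)/2 \<in> \<int>"
    then have "1 - 2 * ((1-z)/2) \<in> \<int>" by (intro Ints_diff Ints_mult) auto
    moreover have e: "1 - 2 * ((1-z)/2) = z" by (simp add: diff_divide_distrib)
    ultimately show False using assms by (simp only: e)
  qed
  have i4: "1 - z/2 \<notin> \<int>"
    using i1 Ints_diff[of 1 "1 - z/2"] by auto
  have n: "z/2 \<noteq> 0" "(1+z)/2 \<noteq> 0" "(1-z)/2 \<noteq> 0" "1-z/2 \<noteq> 0"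
    using i1 i2 i3 i4 by (metis Ints_0)+
  have eq: "(\<Sum>k<2*J. (-1)^k * (1 / (of_nat k + z) + 1 / (of_nat k + 1 - z)))
     = 1/2 * ((\<Sum>j<J. 1 / (of_nat j + z/2) - 1 / (of_nat j + (1+z)/2))
            + (\<Sum>j<J. 1 / (of_nat j + (1-z)/2) - 1 / (of_nat j + (1 - z/2))))" for J
  proof (induction J)
    case (Suc J)
    have gen: "1 / x = 2 / (2 * x)" for x :: complex by simp
    have h: "1 / (of_nat J + w/2) = 2 / (2 * of_nat J + w)" for w :: complex
    proof -
      have e: "2 * (of_nat J + w/2) = 2 * of_nat J + w" by (simp add: algebra_simps)
      show ?thesis by (subst gen) (simp only: e)
    qed
    have h': "1 / (of_nat J + (1 - z/2)) = 2 / (2 * of_nat J + 2 - z)"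
      using h[of "2 - z"] by (simp add: diff_divide_distrib algebra_simps)
    have lin: "1/2 * (X + Y) + (1/p + 1/r) - (1/q + 1/s) = 1/2 * ((X + (2/p - 2/q)) + (Y + (2/r - 2/s)))"
      for X Y p q r s :: complex
      by (simp add: add_divide_distrib diff_divide_distrib algebra_simps)
    let ?F = "\<lambda>k. (-1)^k * (1 / (of_nat k + z) + 1 / (of_nat k + 1 - z))"
    have "(\<Sum>k<2*Suc J. ?F k) = (\<Sum>k<2*J. ?F k) + ?F (2*J) + ?F (2*J+1)"
      by simp
    also have "?F (2*J) = 1 / (2 * of_nat J + z) + 1 / (2 * of_nat J + (1 - z))"
      by (simp add: algebra_simps)
    also have "?F (2*J+1) = - (1 / (2 * of_nat J + (1 + z)) + 1 / (2 * of_nat J + 2 - z))"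
      by (simp add: algebra_simps)
    finally show ?case
      unfolding Suc.IH sum.lessThan_Suc h h' lin[symmetric] by (simp only: add_uminus_conv_diff)
  qed simp
  have "(\<lambda>J. 1/2 * ((\<Sum>j<J. 1 / (of_nat j + z/2) - 1 / (of_nat j + (1+z)/2))
            + (\<Sum>j<J. 1 / (of_nat j + (1-z)/2) - 1 / (of_nat j + (1 - z/2)))))
     \<longlonglongrightarrow> 1/2 * ((Digamma ((1+z)/2) - Digamma (z/2)) + (Digamma (1 - z/2) - Digamma ((1-z)/2)))"
    by (intro tendsto_intros Digamma_diff_LIMSEQ n)
  also have "1/2 * ((Digamma ((1+z)/2) - Digamma (z/2)) + (Digamma (1 - z/2) - Digamma ((1-z)/2)))
     = 1/2 * ((Digamma (1 - z/2) - Digamma (z/2)) + (Digamma (1 - (1-z)/2) - Digamma ((1-z)/2)))"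
    by (simp add: field_simps)
  also have "\<dots> = of_real pi / sin (of_real pi * z)"
  proof -
    let ?u = "of_real pi * (z/2)"
    have e: "of_real pi * ((1-z)/2) = of_real pi / 2 - ?u" by (simp add: diff_divide_distrib right_diff_distrib)
    have s: "sin (of_real pi / 2 - ?u) = cos ?u" "cos (of_real pi / 2 - ?u) = sin ?u"
      by (rule cos_sin_eq[symmetric] sin_cos_eq[symmetric])+
    have d: "sin (of_real pi * z) = 2 * sin ?u * cos ?u"
      using sin_double[of ?u] by simp
    have "2 * sin ?u * cos ?u \<noteq> 0"
      using sin_pi_mult_nonzero[OF assms] by (simp only: d not_False_eq_True)
    then have nz: "sin ?u \<noteq> 0" "cos ?u \<noteq> 0" by auto
    have gen: "1/2 * (p * C / S + p * S / C) = p / (2 * S * C)"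
      if "S \<noteq> 0" "C \<noteq> 0" "S\<^sup>2 + C\<^sup>2 = 1" for p S C :: complex
    proof -
      have "p * C / S + p * S / C = p * (S\<^sup>2 + C\<^sup>2) / (S * C)"
        using that(1,2) by (simp add: field_simps power2_eq_square)
      then show ?thesis by (simp add: that(3))
    qed
    show ?thesis
      unfolding Digamma_reflection[OF i1] Digamma_reflection[OF i3] e s d
      by (rule gen[OF nz sin_cos_squared_add])
  qed
  finally show ?thesis unfolding eq .
qed

section \<open>Density and characteristic function of the limit law\<close>

lemma has_bochner_integral_exp_half_line:
  fixes c :: complex
  assumes c: "Re c > 0"
  shows "has_bochner_integral lborel (\<lambda>x. indicator {0..} x *\<^sub>R exp (- c * of_real x)) (1 / c)"
proof -
  define w where "w = (\<lambda>x::real. indicator {0..} x * exp (- Re c * x))"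
  have c0: "c \<noteq> 0" using c by auto
  have w: "integrable lborel w"
  proof -
    have "(\<integral>\<^sup>+x. ennreal (exp (- Re c * x)) * indicator {0..} x \<partial>lborel)
        = ennreal (0 - (- exp (- Re c * 0) / Re c))"
    proof (rule nn_integral_FTC_atLeast)
      show "((\<lambda>x. - exp (- Re c * x) / Re c) has_real_derivative exp (- Re c * x)) (at x)" for x
        using c by (auto intro!: derivative_eq_intros)
      show "((\<lambda>x. - exp (- Re c * x) / Re c) \<longlongrightarrow> 0) at_top" using c by real_asymp
    qed auto
    moreover have "(\<integral>\<^sup>+x. norm (w x) \<partial>lborel) = (\<integral>\<^sup>+x. ennreal (exp (- Re c * x)) * indicator {0..} x \<partial>lborel)"
      by (intro nn_integral_cong) (auto simp: w_def indicator_def)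
    ultimately have "(\<integral>\<^sup>+x. norm (w x) \<partial>lborel) < \<infinity>" by simp
    then show ?thesis unfolding integrable_iff_bounded w_def by auto
  qed
  define s where "s = (\<lambda>n x. indicator {0..real n} x *\<^sub>R exp (- c * of_real x))"
  have s: "has_bochner_integral lborel (s n) ((- exp (- c * of_real (real n)) / c) - (- exp (- c * of_real 0)
      / c))" for n
    unfolding s_def
  proof (rule has_bochner_integral_FTC_Icc)
    show "((\<lambda>x. - exp (- c * of_real x) / c) has_vector_derivative exp (- c
        * of_real x)) (at x within {0..real n})" for x
      using c0 by (auto intro!: derivative_eq_intros has_vector_derivative_real_field)
    show "continuous_on {0..real n} (\<lambda>x. exp (- c * complex_of_real x))"
      by (intro continuous_intros)
  qed simp
  have lim: "(\<lambda>n. s n x) \<longlonglongrightarrow> indicator {0..} x *\<^sub>R exp (- c * of_real x)" for x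
  proof -
    have "eventually (\<lambda>n. s n x = indicator {0..} x *\<^sub>R exp (- c * of_real x)) sequentially"
      using eventually_ge_at_top[of "nat \<lceil>x\<rceil>"]
      by eventually_elim (auto simp: s_def indicator_def)
    then show ?thesis by (rule tendsto_eventually)
  qed
  have bd: "norm (s n x) \<le> w x" for n x
    by (auto simp: s_def w_def indicator_def)
  have m: "(\<lambda>x. indicator {0..} x *\<^sub>R exp (- c * of_real x)) \<in> borel_measurable lborel"
    by measurable
  have ms: "s n \<in> borel_measurable lborel" for n unfolding s_def by measurable
  have int: "integrable lborel (\<lambda>x. indicator {0..} x *\<^sub>R exp (- c * of_real x))"
    by (rule integrable_dominated_convergence[where s = s, OF m ms w]) (use lim bd in auto)
  have il: "(\<lambda>n. integral\<^sup>L lborel (s n)) \<longlonglongrightarrow> integral\<^sup>L lborel (\<lambda>x. indicator {0..} x *\<^sub>R exp (- c * of_real x))"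
    by (rule integral_dominated_convergence[where s = s, OF m ms w]) (use lim bd in auto)
  have "integral\<^sup>L lborel (s n) = (1 - exp (- c * of_real (real n))) / c" for n
    using has_bochner_integral_integral_eq[OF s[of n]] by (simp add: diff_divide_distrib)
  with il have "(\<lambda>n. (1 - exp (- c * of_real (real n))) / c)
      \<longlonglongrightarrow> integral\<^sup>L lborel (\<lambda>x. indicator {0..} x *\<^sub>R exp (- c * of_real x))"
    by simp
  moreover have "(\<lambda>n. (1 - exp (- c * of_real (real n))) / c) \<longlonglongrightarrow> (1 - 0) / c"
  proof (intro tendsto_intros c0)
    have "(\<lambda>n. exp (- Re c * real n)) \<longlonglongrightarrow> 0" using c by real_asymp
    then show "(\<lambda>n. exp (- c * of_real (real n))) \<longlonglongrightarrow> 0"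
      by (subst tendsto_norm_zero_iff[symmetric]) simp
  qed
  ultimately have "integral\<^sup>L lborel (\<lambda>x. indicator {0..} x *\<^sub>R exp (- c * of_real x)) = 1 / c"
    using LIMSEQ_unique by force
  with int show ?thesis by (simp add: has_bochner_integral_iff)
qed

text \<open>The hyperbolic secant density is the derivative of the cdf, so both measures agree on
  half-open intervals, an intersection-stable generator of the Borel sets.\<close>

lemma hyp_secant_distr_density:
  "hyp_secant_distr = density lborel (\<lambda>x. ennreal (1 / (2 * cosh (pi * x / 2))))"
proof (rule measure_eqI_generator_eq[where \<Omega>=UNIV])
  let ?M = "density lborel (\<lambda>x. ennreal (1 / (2 * cosh (pi * x / 2))))"
  have [measurable]: "(\<lambda>x::real. 1 / (2 * cosh (pi * x / 2))) \<in> borel_measurable borel"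
    by (intro borel_measurable_continuous_onI continuous_intros) auto
  have D: "DERIV hyp_secant_cdf x :> 1 / (2 * cosh (pi * x / 2))" for x
  proof -
    let ?e = "exp (pi * x / 2)"
    have "DERIV hyp_secant_cdf x :> 2 / pi * (inverse (1 + ?e^2) * (?e * (pi / 2)))"
      unfolding hyp_secant_cdf_def by (auto intro!: derivative_eq_intros)
    also have "2 / pi * (inverse (1 + ?e^2) * (?e * (pi / 2))) = 1 / (2 * cosh (pi * x / 2))"
      by (simp add: cosh_field_def exp_minus field_simps power2_eq_square add_pos_pos)
    finally show ?thesis .
  qed
  have Ioc: "emeasure ?M {a<..b} = ennreal (hyp_secant_cdf b - hyp_secant_cdf a)" if "a \<le> b" for a b
  proof -
    have "emeasure ?M {a<..b} = (\<integral>\<^sup>+x. ennreal (1 / (2 * cosh (pi * x / 2))) * indicator {a<..b} x \<partial>lborel)"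
      by (rule emeasure_density) auto
    also have "\<dots> = (\<integral>\<^sup>+x. ennreal (1 / (2 * cosh (pi * x / 2))) * indicator {a..b} x \<partial>lborel)"
      using AE_lborel_singleton[of a]
          by (intro nn_integral_cong_AE) (auto elim!: eventually_mono split: split_indicator)
    also have "\<dots> = ennreal (hyp_secant_cdf b - hyp_secant_cdf a)"
      using that D by (intro nn_integral_FTC_Icc) auto
    finally show ?thesis .
  qed
  have Ioc': "emeasure hyp_secant_distr {a<..b} = ennreal (hyp_secant_cdf b - hyp_secant_cdf a)" if "a
      \<le> b" for a b
    unfolding hyp_secant_distr_def using that
    by (intro emeasure_interval_measure_Ioc hyp_secant_cdf_props)
  show "emeasure hyp_secant_distr X = emeasure ?M X" if XX: "X \<in> range (\<lambda>(a, b). {a<..b::real})" for X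
  proof -
    obtain a b where X: "X = {a<..b}" using XX by auto
    then show ?thesis by (cases "a \<le> b") (simp_all add: Ioc Ioc')
  qed
  show "emeasure hyp_secant_distr {- real i<..real i} \<noteq> \<infinity>" for i
    by (simp add: Ioc')
  show "(\<Union>i. {- real (i::nat)<..real i}) = UNIV"
    by (rule UN_Ioc_eq_UNIV)
  show "range (\<lambda>i. {- real (i::nat)<..real i}) \<subseteq> range (\<lambda>(a, b). {a<..b::real})" by auto
qed (auto simp: hyp_secant_distr_def borel_sigma_sets_Ioc Int_stable_def)

text \<open>For x > 0 the density expands into an alternating geometric series of exponentials.
  Integrated term by term against e^(itx) + e^(-itx) over the half line, it becomes a partial
  fraction series for the cosecant at z = 1/2 + it/pi, and sin (pi/2 + it) = cosh t.\<close>

lemma char_hyp_secant: "char hyp_secant_distr t = of_real (1 / cosh t)"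
proof -
  define f where "f = (\<lambda>x. 1 / (2 * cosh (pi * x / 2)))"
  define h where "h = (\<lambda>x. f x *\<^sub>R iexp (t * x))"
  define a where "a = (\<lambda>k. (2 * real k + 1) * pi / 2)"
  define G where "G = (\<lambda>x. h x + h (- x))"
  have f0: "f x \<ge> 0" for x by (simp add: f_def)
  have fm: "f \<in> borel_measurable borel" unfolding f_def
    by (intro borel_measurable_continuous_onI continuous_intros) auto
  interpret real_distribution hyp_secant_distr by (rule real_distribution_hyp_secant)
  have distr: "hyp_secant_distr = density lborel (\<lambda>x. ennreal (f x))"
    by (simp add: hyp_secant_distr_density f_def)
  have hm: "h \<in> borel_measurable lborel" unfolding h_def using fm by measurable
  have hI: "integrable lborel h"
  proof -
    have "integrable hyp_secant_distr (\<lambda>x. iexp (t * x))"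
      by (rule integrable_iexp) auto
    then show ?thesis unfolding distr h_def using fm f0 by (subst (asm) integrable_density) auto
  qed
  have char: "char hyp_secant_distr t = integral\<^sup>L lborel h"
    unfolding char_def distr h_def using fm f0 by (subst integral_density) auto
  have hI': "integrable lborel (\<lambda>x. h (- x))"
    using lborel_integrable_real_affine_iff[of "-1" h 0] hI by simp
  have "integral\<^sup>L lborel (\<lambda>x. h (- x)) = integral\<^sup>L lborel h"
    using lborel_integral_real_affine[of "-1" h 0] by simp
  then have G2: "integral\<^sup>L lborel G = 2 * char hyp_secant_distr t"
    unfolding G_def char using hI hI' by simp
  have GI: "integrable lborel (\<lambda>x. indicator {0..} x *\<^sub>R G x)"
    unfolding G_def using hI hI' by (intro integrable_mult_indicator) auto
  have "has_bochner_integral lborel G (2 *\<^sub>R (integral\<^sup>L lborel (\<lambda>x. indicator {0..} x *\<^sub>R G x)))"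
    by (rule has_bochner_integral_even_function) (use GI in \<open>auto simp: has_bochner_integral_iff G_def
        add.commute\<close>)
  with G2 have cG: "char hyp_secant_distr t = integral\<^sup>L lborel (\<lambda>x. indicator {0..} x *\<^sub>R G x)"
    by (simp add: has_bochner_integral_iff scaleR_conv_of_real)
  define u where "u = (\<lambda>x. iexp (t * x) + iexp (- t * x))"
  define s where "s = (\<lambda>J x. indicator {0..} x *\<^sub>R (\<Sum>k<2*J. (-1)^k * (exp (- (of_real (a k) - \<i> * of_real t)
      * of_real x) + exp (- (of_real (a k) + \<i> * of_real t) * of_real x))))"
  have a0: "a k > 0" for k by (simp add: a_def add_pos_nonneg)
  have sI: "has_bochner_integral lborel (s J) (\<Sum>k<2*J. (-1)^k * (1 / (of_real (a k) - \<i> * of_real t) + 1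
      / (of_real (a k) + \<i> * of_real t)))" for J
    unfolding s_def scaleR_sum_right scaleR_add_right mult_scaleR_right[symmetric]
    by (intro has_bochner_integral_sum has_bochner_integral_mult_right has_bochner_integral_add
        has_bochner_integral_exp_half_line)
       (simp_all add: a0)
  have geo: "(\<Sum>k<2*J. (-1)^k * (exp (- (of_real (a k) - \<i> * of_real t) * of_real x) + exp (- (of_real (a k) + \<i>
      * of_real t) * of_real x)))
      = of_real (\<Sum>k<2*J. (-1)^k * exp (- a k * x)) * u x" for J x
  proof -
    have "exp (- (of_real (a k) - \<i> * of_real t) * of_real x) = of_real (exp (- a k * x)) * iexp (t * x)"
         "exp (- (of_real (a k) + \<i> * of_real t) * of_real x)
             = of_real (exp (- a k * x)) * iexp (- t * x)" for k
      by (simp_all add: exp_of_real[symmetric] exp_add[symmetric] algebra_simps)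
    then show ?thesis
      unfolding u_def of_real_sum sum_distrib_right by (intro sum.cong) (simp_all add: algebra_simps)
  qed
  \<comment> \<open>An even number of terms leaves the factor 1 - exp(-2 pi x J), which lies in
    [0,1] for x \<ge> 0; this supplies the integrable majorant 2f.\<close>
  have gs: "(\<Sum>k<2*J. (-1)^k * exp (- a k * x)) = (1 - exp (- 2 * pi * x * J)) * f x" for J x
  proof (induction J)
    case (Suc J)
    have e: "exp (- (a (2*J) * x)) = exp (- (pi * x / 2)) * exp (- (2 * pi * x * real J))"
            "exp (- (a (Suc (2*J)) * x)) = exp (- (3 * (pi * x) / 2)) * exp (- (2 * pi * x * real J))"
      by (simp_all add: a_def exp_add[symmetric] field_simps)
    have "exp (- pi * x/2) - exp (- 3 * (pi * x/2)) = (1 - exp (-2 * pi * x)) * f x"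
    proof -
      define r where "r = exp (- (pi * x / 2))"
      have r: "r > 0" by (simp add: r_def)
      have 1: "exp (- pi * x/2) = r" "exp (- 3 * (pi * x/2)) = r^3" "exp (-2 * pi * x) = r^4" "exp (pi * x / 2)
          = 1/r"
        by (simp_all add: r_def exp_of_nat_mult[symmetric] exp_minus field_simps)
      have "f x = 1 / (2 * ((1/r + r) / 2))"
        unfolding f_def cosh_field_def by (simp only: 1 r_def[symmetric])
      also have "2 * ((1/r + r) / 2) = (1 + r^2) / r" using r by (simp add: field_simps power2_eq_square)
      also have "1 / ((1 + r^2) / r) = r / (1 + r^2)" by simp
      finally have f: "f x = r / (1 + r^2)" .
      have p: "1 + r^2 \<noteq> 0" by (smt (verit) zero_le_power2)
      have "(r - r^3) * (1 + r^2) = (1 - r^4) * r" by algebra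
      then show ?thesis unfolding 1 f using p by (simp add: field_simps)
    qed
    moreover have "exp (- 2 * pi * x * (Suc J)) = exp (-2 * pi * x) * exp (- 2 * pi * x * J)"
      by (simp add: exp_add[symmetric] algebra_simps)
    ultimately show ?case using Suc.IH by (simp add: e) algebra
  qed simp
  have Geq: "G x = of_real (f x) * u x" for x
    by (simp add: G_def h_def u_def f_def scaleR_conv_of_real algebra_simps)
  have sG: "s J x = indicator {0..} x *\<^sub>R (of_real ((1 - exp (- 2 * pi * x * real J)) * f x) * u x)" for J x
    by (simp only: s_def geo gs)
  \<comment> \<open>At x = 0 all these partial sums are 0 while \<open>G 0\<close> is 1, so
    convergence holds only almost everywhere.\<close>
  have lim: "(\<lambda>J. s J x) \<longlonglongrightarrow> indicator {0..} x *\<^sub>R G x" if "x \<noteq> 0" for x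
  proof (cases "x > 0")
    case True
    have "(\<lambda>J. exp (- 2 * pi * x * real J)) \<longlonglongrightarrow> 0" using True by real_asymp
    then have "(\<lambda>J. of_real ((1 - exp (- 2 * pi * x * real J)) * f x) * u x) \<longlonglongrightarrow> of_real ((1 - 0) * f x) * u x"
      by (intro tendsto_mult tendsto_of_real tendsto_diff tendsto_const)
    moreover have "indicator {0..} x = (1::real)" using True by simp
    ultimately show ?thesis by (simp only: sG Geq scaleR_one diff_zero mult_1)
  qed (use that in \<open>auto simp: s_def indicator_def\<close>)
  have nu: "norm (u x) \<le> 2" for x
    unfolding u_def using norm_triangle_ineq[of "iexp (t*x)" "iexp (-t*x)"] by simp
  have bd: "norm (s J x) \<le> 2 * f x" for J x
  proof (cases "x \<ge> 0")
    case True
    have "\<bar>(1 - exp (- 2 * pi * x * real J)) * f x\<bar> \<le> f x"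
      using True f0[of x] by (auto simp: abs_mult intro!: mult_left_le_one_le abs_leI)
    then have "\<bar>(1 - exp (- 2 * pi * x * real J)) * f x\<bar> * norm (u x) \<le> f x * 2"
      using nu f0 by (intro mult_mono) auto
    then show ?thesis using True by (simp add: sG norm_mult del: of_real_mult of_real_diff)
  qed (use f0 in \<open>auto simp: s_def\<close>)
  have fI: "integrable lborel (\<lambda>x. 2 * f x)"
  proof -
    have "integrable hyp_secant_distr (\<lambda>x. 1::real)" by simp
    then show ?thesis unfolding distr using fm f0 by (subst (asm) integrable_density) auto
  qed
  have "(\<lambda>J. integral\<^sup>L lborel (s J)) \<longlonglongrightarrow> integral\<^sup>L lborel (\<lambda>x. indicator {0..} x *\<^sub>R G x)"
  proof (rule integral_dominated_convergence[OF _ _ fI])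
    show "AE x in lborel. (\<lambda>J. s J x) \<longlonglongrightarrow> indicator {0..} x *\<^sub>R G x"
      using AE_lborel_singleton[of 0] by eventually_elim (rule lim)
    show "s J \<in> borel_measurable lborel" for J using sI[of J] by (auto simp: has_bochner_integral_iff)
  qed (use bd GI in auto)
  then have L: "(\<lambda>J. \<Sum>k<2*J. (-1)^k * (1 / (of_real (a k) - \<i> * of_real t) + 1 / (of_real (a k) + \<i>
      * of_real t))) \<longlonglongrightarrow> char hyp_secant_distr t"
    using sI by (simp add: cG has_bochner_integral_iff)
  \<comment> \<open>Chosen so that \<open>a k\<close> + it = pi (k + z) and \<open>a k\<close> - it
    = pi (k + 1 - z).\<close>
  define z :: complex where "z = 1/2 + \<i> * of_real (t / pi)"
  have zI: "z \<notin> \<int>"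
  proof
    assume "z \<in> \<int>"
    then obtain m where "z = of_int m" by (auto elim: Ints_cases)
    then have "Re z = of_int m" by simp
    then have "2 * m = 1" unfolding z_def by (simp add: field_simps)
    then show False by presburger
  qed
  have e1: "of_real (a k) - \<i> * of_real t = of_real pi * (of_nat k + 1 - z)" for k
    by (simp add: a_def z_def field_simps)
  have e2: "of_real (a k) + \<i> * of_real t = of_real pi * (of_nat k + z)" for k
    by (simp add: a_def z_def field_simps)
  have "(\<lambda>J. 1 / of_real pi * (\<Sum>k<2*J. (-1)^k * (1 / (of_nat k + z) + 1 / (of_nat k + 1 - z))))
      \<longlonglongrightarrow> 1 / of_real pi * (of_real pi / sin (of_real pi * z))"
    by (intro tendsto_intros csc_partial_fractions zI)
  moreover have "1 / of_real pi * (\<Sum>k<2*J. (-1)^k * (1 / (of_nat k + z) + 1 / (of_nat k + 1 - z)))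
    = (\<Sum>k<2*J. (-1)^k * (1 / (of_real (a k) - \<i> * of_real t) + 1 / (of_real (a k) + \<i> * of_real t)))" for J
  proof -
    have "1 / p * (s * (1 / A + 1 / B)) = s * (1 / (p * B) + 1 / (p * A))" for p s A B :: complex
      by (simp add: distrib_left add_divide_distrib)
    then show ?thesis unfolding e1 e2 sum_distrib_left by (simp only:)
  qed
  ultimately have "char hyp_secant_distr t = 1 / of_real pi * (of_real pi / sin (of_real pi * z))"
    using L LIMSEQ_unique by force
  also have "sin (of_real pi * z) = of_real (cosh t)"
  proof -
    have "of_real pi * z = of_real (pi/2) + \<i> * of_real t" by (simp add: z_def field_simps)
    then have "sin (of_real pi * z) = cos (\<i> * of_real t)"
      by (simp only: sin_add sin_of_real[symmetric] cos_of_real[symmetric]) simp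
    also have "\<dots> = cosh (of_real t)"
      by (simp only: cosh_conv_cos)
    also have "\<dots> = of_real (cosh t)"
      unfolding cosh_field_def by (simp add: exp_of_real flip: of_real_minus)
    finally show ?thesis .
  qed
  finally show ?thesis by simp
qed

text \<open>In the product for sinh (pi x), which is the sine product at an imaginary argument, the
  even factors form the product for sinh (pi x / 2). Dividing them out leaves the odd factors and
  sinh (pi x) / (2 sinh (pi x / 2)) = cosh (pi x / 2).\<close>

lemma cosh_product_formula:
  "(\<lambda>J. \<Prod>j<J. 1 + x\<^sup>2 / (2 * real j + 1)\<^sup>2) \<longlonglongrightarrow> cosh (pi * x / 2)"
proof (cases "x = 0")
  case False
  have S: "(\<lambda>n. pi * y * (\<Prod>k=1..n. 1 + y\<^sup>2 / (real k)\<^sup>2)) \<longlonglongrightarrow> sinh (pi * y)" for y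
  proof -
    have "(\<lambda>n. - \<i> * (of_real pi * (\<i> * of_real y) * (\<Prod>k=1..n. 1 - (\<i> * of_real y)^2 / of_nat k^2)))
            \<longlonglongrightarrow> - \<i> * sin (of_real pi * (\<i> * of_real y))"
      by (intro tendsto_intros sin_product_formula_complex)
    also have "- \<i> * sin (of_real pi * (\<i> * of_real y)) = sinh (of_real (pi * y))"
      by (simp add: sinh_conv_sin mult.left_commute)
    also have "\<dots> = of_real (sinh (pi * y))"
      unfolding sinh_field_def by (simp add: exp_of_real flip: of_real_minus of_real_mult)
    also have "(\<lambda>n. - \<i> * (of_real pi * (\<i> * of_real y) * (\<Prod>k=1..n. 1 - (\<i> * of_real y)^2 / of_nat k^2)))
       = (\<lambda>n. of_real (pi * y * (\<Prod>k=1..n. 1 + y\<^sup>2 / (real k)\<^sup>2)))"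
      by (simp add: power_mult_distrib fun_eq_iff mult_ac)
    finally show ?thesis by (subst (asm) tendsto_of_real_iff)
  qed
  have split: "(\<Prod>k=1..2*J. 1 + x\<^sup>2 / (real k)\<^sup>2)
      = (\<Prod>j<J. 1 + x\<^sup>2 / (2 * real j + 1)\<^sup>2) * (\<Prod>k=1..J. 1 + (x/2)\<^sup>2 / (real k)\<^sup>2)" for J
  proof (induction J)
    case (Suc J)
    have 1: "1 + x\<^sup>2 / (real (2 * J + 2))\<^sup>2 = 1 + (x/2)\<^sup>2 / (real (Suc J))\<^sup>2"
    proof -
      have "real (2 * J + 2) = 2 * real (Suc J)" by simp
      then show ?thesis by (simp only: power_divide power_mult_distrib divide_divide_eq_left)
    qed
    have 2: "1 + x\<^sup>2 / (real (2 * J + 1))\<^sup>2 = 1 + x\<^sup>2 / (2 * real J + 1)\<^sup>2" by simp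
    have "(\<Prod>k=1..2*Suc J. 1 + x\<^sup>2 / (real k)\<^sup>2)
        = (\<Prod>k=1..2*J. 1 + x\<^sup>2 / (real k)\<^sup>2) * (1 + x\<^sup>2 / (real (2 * J + 1))\<^sup>2) * (1 + x\<^sup>2 / (real (2 * J
            + 2))\<^sup>2)"
      by simp
    then show ?case unfolding Suc.IH 1 2 by (simp only: prod.lessThan_Suc prod.nat_ivl_Suc' mult_ac)
  qed simp
  have pos: "(\<Prod>k=1..J. 1 + (x/2)\<^sup>2 / (real k)\<^sup>2) > 0" for J
    by (intro prod_pos) (auto intro!: add_pos_nonneg)
  have "(\<lambda>J. pi * x * (\<Prod>k=1..2*J. 1 + x\<^sup>2 / (real k)\<^sup>2)) \<longlonglongrightarrow> sinh (pi * x)"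
    by (rule filterlim_compose[OF S]) (simp add: filterlim_subseq strict_mono_def)
  moreover have "sinh (pi * (x/2)) \<noteq> 0" using False by simp
  ultimately have "(\<lambda>J. (pi * x * (\<Prod>k=1..2*J. 1 + x\<^sup>2 / (real k)\<^sup>2)) / (2 * (pi * (x/2) * (\<Prod>k=1..J. 1 + (x/2)\<^sup>2
      / (real k)\<^sup>2))))
      \<longlonglongrightarrow> sinh (pi * x) / (2 * sinh (pi * (x/2)))"
    by (intro tendsto_divide tendsto_mult tendsto_const S) auto
  moreover have "(pi * x * (\<Prod>k=1..2*J. 1 + x\<^sup>2 / (real k)\<^sup>2)) / (2 * (pi * (x/2) * (\<Prod>k=1..J. 1 + (x/2)\<^sup>2
      / (real k)\<^sup>2)))
      = (\<Prod>j<J. 1 + x\<^sup>2 / (2 * real j + 1)\<^sup>2)" for J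
  proof -
    have "(pi * x * (a * b)) / (2 * (pi * (x/2) * b)) = a" if "b > 0" for a b
      using that False by simp
    from this[OF pos[of J]] show ?thesis unfolding split .
  qed
  moreover have "sinh (pi * x) / (2 * sinh (pi * (x/2))) = cosh (pi * x / 2)"
    using sinh_double[of "pi * x / 2"] False by simp
  ultimately show ?thesis by simp
qed simp

section \<open>Pairs of partitions into odd parts\<close>

text \<open>The series 1 / (1 - z X^d): partitions into copies of d, with z marking their number.
  Explicit coefficients make nonnegativity and majorants immediate.\<close>

definition geo :: "'a::field \<Rightarrow> nat \<Rightarrow> 'a fps" where
  "geo z d = Abs_fps (\<lambda>n. if d dvd n then z ^ (n div d) else 0)"

text \<open>The parts are the first k odd numbers 1, ..., 2k-1, and z marks the number of parts. A
  peak 2k+1 therefore goes with index k+1.\<close>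

definition odd_gf :: "'a::field \<Rightarrow> nat \<Rightarrow> 'a fps" where
  "odd_gf z k = (\<Prod>j<k. geo z (2 * j + 1))"

text \<open>The number of pairs of partitions of total size \<open>m\<close> into odd parts \<open>< 2k\<close>.\<close>

definition pairs :: "nat \<Rightarrow> nat \<Rightarrow> real" where
  "pairs k m = fps_nth ((odd_gf 1 k)\<^sup>2) m"

lemma fps_const_X_power_mult_nth:
  "fps_nth (fps_const z * fps_X ^ d * f) n = (if n < d then 0 else z * fps_nth f (n - d))"
  by (simp add: mult.assoc fps_X_power_mult_nth)

lemma geo_inverse:
  assumes "0 < d"
  shows "(1 - fps_const z * fps_X ^ d) * geo z d = 1"
proof (rule fps_ext)
  fix n
  have "fps_nth ((1 - fps_const z * fps_X ^ d) * geo z d) n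
      = fps_nth (geo z d) n - (if n < d then 0 else z * fps_nth (geo z d) (n - d))"
    by (simp add: left_diff_distrib fps_const_X_power_mult_nth)
  also have "\<dots> = fps_nth 1 n"
  proof (cases "n < d")
    case True
    then show ?thesis by (auto simp: geo_def dest: dvd_imp_le)
  next
    case False
    then have dv: "d dvd n - d \<longleftrightarrow> d dvd n" by (simp add: dvd_minus_self)
    have "n div d = Suc ((n - d) div d)" using False assms by (simp add: le_div_geq)
    then show ?thesis using False assms dv by (simp add: geo_def)
  qed
  finally show "fps_nth ((1 - fps_const z * fps_X ^ d) * geo z d) n = fps_nth 1 n" .
qed

lemma geo_mult_eq:
  assumes "0 < d"
  shows "geo z d * f = f + fps_const z * fps_X ^ d * (geo z d * f)"
proof -
  have "f = (1 - fps_const z * fps_X ^ d) * geo z d * f" by (simp add: geo_inverse[OF assms])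
  then show ?thesis by (simp add: algebra_simps)
qed

lemma geo_mult_nth:
  assumes "0 < d"
  shows "fps_nth (geo z d * f) n = fps_nth f n + (if n < d then 0 else z * fps_nth (geo z d * f) (n - d))"
  by (subst geo_mult_eq[OF assms]) (simp add: fps_const_X_power_mult_nth)

lemma geo_mult_nth_sum:
  assumes "0 < d"
  shows "fps_nth (geo z d * f) n = (\<Sum>a\<le>n div d. z ^ a * fps_nth f (n - a * d))"
proof (induction n rule: less_induct)
  case (less n)
  show ?case
  proof (cases "n < d")
    case True
    then show ?thesis using assms by (simp add: geo_mult_nth)
  next
    case False
    have "fps_nth (geo z d * f) n = fps_nth f n + z * (\<Sum>a\<le>(n - d) div d. z ^ a * fps_nth f (n - d - a * d))"
      using less.IH[of "n - d"] assms False by (subst geo_mult_nth) auto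
    also have "\<dots> = (\<Sum>a\<le>Suc ((n - d) div d). z ^ a * fps_nth f (n - a * d))"
      by (simp add: sum.atMost_Suc_shift sum_distrib_left algebra_simps del: sum.atMost_Suc)
    also have "Suc ((n - d) div d) = n div d" using False assms by (simp add: le_div_geq)
    finally show ?thesis .
  qed
qed

lemma odd_gf_Suc: "odd_gf z (Suc k) = geo z (2 * k + 1) * odd_gf z k"
  by (simp add: odd_gf_def mult.commute)

lemma odd_gf_0: "odd_gf z 0 = 1"
  by (simp add: odd_gf_def)

lemma fps_mult_nonneg:
  fixes f h :: "real fps"
  assumes "\<And>n. fps_nth f n \<ge> 0" "\<And>n. fps_nth h n \<ge> 0"
  shows "fps_nth (f * h) n \<ge> 0"
  unfolding fps_mult_nth by (intro sum_nonneg mult_nonneg_nonneg assms)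

lemma geo_nonneg: "fps_nth (geo (1::real) d) n \<ge> 0"
  by (simp add: geo_def)

lemma odd_gf_nonneg: "fps_nth (odd_gf (1::real) k) n \<ge> 0"
proof (induction k arbitrary: n)
  case (Suc k)
  then show ?case unfolding odd_gf_Suc by (intro fps_mult_nonneg geo_nonneg)
qed (simp add: odd_gf_0)

lemma pairs_nonneg: "pairs k m \<ge> 0"
  unfolding pairs_def power2_eq_square by (intro fps_mult_nonneg odd_gf_nonneg)

lemma pairs_Suc: "pairs (Suc k) m = fps_nth (geo 1 (2*k+1) * (geo 1 (2*k+1) * (odd_gf 1 k)\<^sup>2)) m"
  by (simp add: pairs_def odd_gf_Suc power2_eq_square algebra_simps)

lemma le_geo_mult:
  fixes f :: "real fps"
  assumes "\<And>n. fps_nth f n \<ge> 0" "0 < d"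
  shows "fps_nth f n \<le> fps_nth (geo 1 d * f) n"
proof -
  have "fps_nth (geo 1 d * f) i \<ge> 0" for i
    by (rule fps_mult_nonneg[OF geo_nonneg assms(1)])
  then show ?thesis using assms(2) by (subst geo_mult_nth) auto
qed

lemma pairs_mono_index_Suc: "pairs k m \<le> pairs (Suc k) m"
proof -
  have n: "fps_nth ((odd_gf 1 k)\<^sup>2) i \<ge> (0::real)" for i
    using pairs_nonneg[of k i] by (simp add: pairs_def)
  have "pairs k m \<le> fps_nth (geo 1 (2*k+1) * (odd_gf 1 k)\<^sup>2) m"
    unfolding pairs_def by (intro le_geo_mult n) simp
  also have "\<dots> \<le> pairs (Suc k) m"
    unfolding pairs_Suc by (intro le_geo_mult fps_mult_nonneg geo_nonneg n) simp
  finally show ?thesis .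
qed

lemma pairs_mono_index: "k \<le> l \<Longrightarrow> pairs k m \<le> pairs l m"
  by (rule lift_Suc_mono_le[of "\<lambda>k. pairs k m"]) (rule pairs_mono_index_Suc)

lemma pairs_stable_Suc:
  assumes "m < 2 * k + 1"
  shows "pairs (Suc k) m = pairs k m"
  unfolding pairs_Suc using assms by (simp add: geo_mult_nth pairs_def)

lemma pairs_stable:
  assumes "m \<le> 2 * k" "k \<le> l"
  shows "pairs l m = pairs k m"
  using assms(2)
proof (induction l rule: dec_induct)
  case (step l)
  then show ?case using pairs_stable_Suc[of m l] assms(1) by simp
qed simp

lemma pairs_1: "pairs 1 m = real m + 1"
proof -
  have g: "fps_nth (geo 1 (Suc 0) :: real fps) n = 1" for n by (simp add: geo_def)
  show ?thesis
    unfolding pairs_def odd_gf_def power2_eq_square by (simp add: fps_mult_nth g)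
qed

lemma pairs_pos: "1 \<le> k \<Longrightarrow> pairs k m > 0"
  using pairs_mono_index[of 1 k m] pairs_1[of m] by simp

text \<open>For k \<ge> 1 the part 1 is available, so a factor \<open>geo 1 1\<close> splits off,
  and multiplying a nonnegative series by it forms partial sums. Combinatorially, a further 1 is
  added to one side.\<close>

lemma pairs_mono_Suc:
  assumes "1 \<le> k"
  shows "pairs k m \<le> pairs k (Suc m)"
proof -
  obtain k' where k': "k = Suc k'" using assms by (cases k) auto
  have eq: "odd_gf (1::real) k = geo 1 1 * (\<Prod>j<k'. geo 1 (2 * Suc j + 1))"
    unfolding odd_gf_def k' prod.lessThan_Suc_shift by simp
  define r where "r = (\<Prod>j<k'. geo (1::real) (2 * Suc j + 1))"
  have r: "fps_nth r n \<ge> 0" for n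
    unfolding r_def
  proof (induction k' arbitrary: n)
    case (Suc k')
    then show ?case unfolding prod.lessThan_Suc by (intro fps_mult_nonneg geo_nonneg) auto
  qed simp
  have A: "(odd_gf 1 k)\<^sup>2 = geo 1 1 * (geo 1 1 * r * r)"
    by (simp add: eq r_def power2_eq_square algebra_simps)
  have B: "fps_nth (geo 1 1 * r * r) (Suc m) \<ge> 0"
    by (intro fps_mult_nonneg geo_nonneg r)
  have C: "fps_nth (geo 1 1 * (geo 1 1 * r * r)) (Suc m)
      = fps_nth (geo 1 1 * r * r) (Suc m) + fps_nth (geo 1 1 * (geo 1 1 * r * r)) m"
    using geo_mult_nth[of 1 1 "geo 1 1 * r * r" "Suc m"] by simp
  show ?thesis unfolding pairs_def A C using B by linarith
qed

lemma pairs_mono: "1 \<le> k \<Longrightarrow> m \<le> n \<Longrightarrow> pairs k m \<le> pairs k n"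
  by (rule lift_Suc_mono_le[of "pairs k"]) (auto intro: pairs_mono_Suc)

text \<open>Coefficients of the logarithmic derivative of the square of \<open>odd_gf 1 k\<close>:
  twice the sum of the odd divisors of s below 2k, the factor 2 standing for the two sides. At s =
  0, where everything divides, the coefficient is 0.\<close>

definition divsum :: "nat \<Rightarrow> nat \<Rightarrow> real" where
  "divsum k s = (if s = 0 then 0 else \<Sum>j<k. if 2 * j + 1 dvd s then 2 * (2 * real j + 1) else 0)"

lemma divsum_nonneg: "divsum k s \<ge> 0"
  by (auto simp: divsum_def intro!: sum_nonneg)

text \<open>Differentiating (1 - y) g = 1 with y = z X^d determines X g', because X y' = d y and y g
  = g - 1.\<close>

lemma geo_deriv:
  assumes "0 < d"
  shows "fps_X * fps_deriv (geo (z::'a::field_char_0) d) = fps_const (of_nat d) * (geo z d - 1) * geo z d"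
proof -
  define g where "g = geo z d"
  define y where "y = fps_const z * fps_X ^ d"
  have i: "(1 - y) * g = 1" unfolding y_def g_def by (rule geo_inverse[OF assms])
  have Xd: "fps_X * fps_deriv y = fps_const (of_nat d) * y"
  proof -
    have "fps_X * fps_X ^ (d - 1) = (fps_X ^ d :: 'a fps)" using assms by (cases d) auto
    then show ?thesis unfolding y_def
      by (simp add: fps_deriv_power mult.left_commute[of fps_X] fps_of_nat)
  qed
  have "fps_X * fps_deriv ((1 - y) * g) = (1 - y) * (fps_X * fps_deriv g) - (fps_X * fps_deriv y) * g"
    by (simp add: algebra_simps)
  then have "(1 - y) * (fps_X * fps_deriv g) = (fps_X * fps_deriv y) * g"
    by (simp add: i)
  then have "g * ((1 - y) * (fps_X * fps_deriv g)) = fps_const (of_nat d) * (y * g) * g"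
    by (simp only: Xd) (simp only: mult_ac)
  moreover have "g * ((1 - y) * (fps_X * fps_deriv g)) = fps_X * fps_deriv g"
  proof -
    have "g * ((1 - y) * (fps_X * fps_deriv g)) = ((1 - y) * g) * (fps_X * fps_deriv g)"
      by (simp only: mult_ac)
    then show ?thesis by (simp add: i)
  qed
  moreover have "y * g = g - 1" using i by (simp add: algebra_simps)
  ultimately show ?thesis unfolding g_def by simp
qed

text \<open>Coefficient comparison in X G' = v G for G the square of \<open>odd_gf 1 k\<close>. The
  logarithmic derivative is additive over factors, so passing from k to k+1 adds 2d (geo 1 d - 1)
  with d = 2k+1 to v.\<close>

lemma pairs_recurrence:
  "real m * pairs k m = (\<Sum>s\<le>m. divsum k s * pairs k (m - s))"
proof -
  define v where "v = (\<lambda>k. \<Sum>j<k. fps_const (2 * real (2*j+1)) * (geo (1::real) (2*j+1) - 1))"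
  have vn: "fps_nth (v k) s = divsum k s" for s
    unfolding v_def divsum_def fps_sum_nth by (auto simp: geo_def intro!: sum.cong)
  have rule: "fps_X * fps_deriv (g\<^sup>2 * h) = 2 * g * (fps_X * fps_deriv g) * h + g\<^sup>2 * (fps_X * fps_deriv h)"
    for g h :: "real fps"
    by (simp add: power2_eq_square algebra_simps)
  have ring: "2 * g * (c * (g - 1) * g) * h + g\<^sup>2 * (V * h) = (V + 2 * c * (g - 1)) * (g\<^sup>2 * h)"
    for g h c V :: "real fps"
    by (simp add: power2_eq_square algebra_simps)
  have "fps_X * fps_deriv ((odd_gf (1::real) k)\<^sup>2) = v k * (odd_gf 1 k)\<^sup>2"
  proof (induction k)
    case 0
    then show ?case by (simp add: odd_gf_0 v_def)
  next
    case (Suc k)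
    have c2: "fps_const (2 * real (2*k+1)) = 2 * fps_const (of_nat (2*k+1))"
      by (simp only: fps_const_mult[symmetric] fps_numeral_fps_const)
    have v: "v (Suc k) = v k + 2 * fps_const (of_nat (2*k+1)) * (geo 1 (2*k+1) - 1)"
      unfolding v_def sum.lessThan_Suc c2 ..
    have d: "0 < 2 * k + 1" by simp
    show ?case
      unfolding odd_gf_Suc power_mult_distrib rule Suc.IH geo_deriv[OF d] ring v ..
  qed
  then have "fps_nth (fps_X * fps_deriv ((odd_gf (1::real) k)\<^sup>2)) m = fps_nth (v k * (odd_gf 1 k)\<^sup>2) m"
    by simp
  moreover have "fps_nth (fps_X * fps_deriv ((odd_gf (1::real) k)\<^sup>2)) m = real m * pairs k m"
    by (cases m) (simp_all add: pairs_def)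
  ultimately show ?thesis
    by (simp add: fps_mult_nth vn pairs_def atLeast0AtMost)
qed

text \<open>Each odd s \<le> 2k divides itself and contributes 2s; all other divisors are dropped.
  The odd numbers up to S sum to the square of (S+1) div 2.\<close>

lemma divsum_sum_lower:
  assumes "S \<le> 2 * k"
  shows "(\<Sum>s\<le>S. divsum k s) \<ge> real S ^ 2 / 2"
proof -
  have odd_term: "divsum k s \<ge> 2 * real s" if "odd s" "s \<le> 2 * k" for s
  proof -
    obtain j where j: "s = 2 * j + 1" using \<open>odd s\<close> by (auto elim: oddE)
    have "j < k" using j that by simp
    have "2 * real s = (if 2 * j + 1 dvd s then 2 * (2 * real j + 1) else 0)" by (simp add: j)
    also have "\<dots> \<le> (\<Sum>j<k. if 2 * j + 1 dvd s then 2 * (2 * real j + 1) else 0)"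
      using \<open>j < k\<close> by (intro member_le_sum) auto
    finally show ?thesis using j by (simp add: divsum_def)
  qed
  have "(\<Sum>s\<le>S. divsum k s) \<ge> 2 * (real ((S + 1) div 2))\<^sup>2"
    using assms
  proof (induction S)
    case (Suc S)
    show ?case
    proof (cases "even S")
      case True
      then obtain c where c: "S = 2 * c" by blast
      have "divsum k (Suc S) \<ge> 2 * real (Suc S)" using Suc.prems True by (intro odd_term) auto
      then show ?thesis using Suc c by (simp add: power2_eq_square algebra_simps)
    next
      case False
      then obtain c where c: "S = 2 * c + 1" by (auto elim: oddE)
      show ?thesis using Suc c divsum_nonneg[of k "Suc S"] by simp
    qed
  qed (simp add: divsum_def)
  moreover have "real ((S + 1) div 2) \<ge> real S / 2" by linarith
  then have "(real ((S + 1) div 2))\<^sup>2 \<ge> (real S / 2)\<^sup>2" by (intro power_mono) auto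
  ultimately show ?thesis by (simp add: power_divide)
qed

text \<open>Only s \<le> S is kept in the recurrence, and monotonicity replaces every g(m-s) by the
  smallest, g(m-S). This gives (S^2/2) g(m-S) \<le> m g(m), and S^2 \<ge> 4m makes the ratio at most
  1/2.\<close>

lemma pairs_halving:
  assumes "1 \<le> k" "S \<le> 2 * k" "S \<le> m" "4 * m \<le> S\<^sup>2" "0 < m"
  shows "pairs k (m - S) \<le> pairs k m / 2"
proof -
  have "real S ^ 2 / 2 * pairs k (m - S) \<le> (\<Sum>s\<le>S. divsum k s) * pairs k (m - S)"
    by (intro mult_right_mono divsum_sum_lower assms pairs_nonneg)
  also have "\<dots> = (\<Sum>s\<le>S. divsum k s * pairs k (m - S))" by (simp add: sum_distrib_right)
  also have "\<dots> \<le> (\<Sum>s\<le>S. divsum k s * pairs k (m - s))"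
    by (intro sum_mono mult_left_mono divsum_nonneg pairs_mono assms) auto
  also have "\<dots> \<le> (\<Sum>s\<le>m. divsum k s * pairs k (m - s))"
    using assms by (intro sum_mono2 mult_nonneg_nonneg divsum_nonneg pairs_nonneg) auto
  also have "\<dots> = real m * pairs k m" by (simp add: pairs_recurrence)
  finally have 1: "real S ^ 2 / 2 * pairs k (m - S) \<le> real m * pairs k m" .
  have "real (4 * m) \<le> real (S\<^sup>2)" using assms(4) by (simp only: of_nat_le_iff)
  then have "4 * real m \<le> real S ^ 2" by simp
  then have "2 * real m * pairs k (m - S) \<le> real S ^ 2 / 2 * pairs k (m - S)"
    by (intro mult_right_mono pairs_nonneg) auto
  with 1 have "real m * (2 * pairs k (m - S)) \<le> real m * pairs k m" by simp
  then show ?thesis using assms(5) by simp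
qed

text \<open>The halving is iterated in steps of length S, about 2 sqrt m; the same S serves all
  smaller arguments. With S \<le> 3 sqrt m the decay rate is at least (ln 2)/3 > 1/5 per sqrt m, and
  the factor 2 pays for the incomplete last step. The rate is not sharp, but the bound is explicit
  and provides the majorants below.\<close>

lemma pairs_decay:
  assumes "1 \<le> m" "3 * sqrt m \<le> 2 * real k" "s \<le> m"
  shows "pairs k (m - s) \<le> 2 * exp (- real s / (5 * sqrt m)) * pairs k m"
proof -
  define S where "S = nat \<lceil>2 * sqrt m\<rceil>"
  have sm: "sqrt m \<ge> 1" using assms by simp
  have Su: "real S \<le> 3 * sqrt m" unfolding S_def using sm by linarith
  have Sl: "2 * sqrt m \<le> real S" unfolding S_def by linarith
  have k: "1 \<le> k" using assms sm by linarith
  have Sk: "S \<le> 2 * k" using Su assms by linarith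
  have S1: "S \<ge> 1" using Sl sm by linarith
  have "(2 * sqrt m)\<^sup>2 \<le> (real S)\<^sup>2" using Sl by (intro power_mono) auto
  then have "4 * real m \<le> (real S)\<^sup>2" by (simp add: power_mult_distrib)
  then have "real (4 * m) \<le> real (S\<^sup>2)" by simp
  then have SS: "4 * m \<le> S\<^sup>2" by (simp only: of_nat_le_iff)
  have it: "pairs k (m - i * S) \<le> pairs k m / 2 ^ i" if "i * S \<le> m" for i
    using that
  proof (induction i)
    case (Suc i)
    have "pairs k (m - i * S - S) \<le> pairs k (m - i * S) / 2"
      using Suc.prems S1 SS by (intro pairs_halving k Sk) auto
    also have "\<dots> \<le> pairs k m / 2 ^ i / 2" using Suc by (intro divide_right_mono) auto
    finally show ?case by (simp add: algebra_simps)
  qed simp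
  define i where "i = s div S"
  have iS: "i * S \<le> s" by (simp add: i_def)
  have "real s < (real i + 1) * real S"
  proof -
    have "s = i * S + s mod S" by (simp add: i_def)
    then have "real s = real i * real S + real (s mod S)" by (metis of_nat_add of_nat_mult)
    moreover have "real (s mod S) < real S" using S1 by simp
    ultimately show ?thesis by (simp add: distrib_right)
  qed
  then have i': "real s / real S < real i + 1" using S1 by (simp add: field_simps)
  have "real s / (5 * sqrt m) \<le> (2/3) * (real s / real S)"
  proof -
    have "(2/3) * (real s / real S) \<ge> (2/3) * (real s / (3 * sqrt m))"
      using Su S1 sm by (intro mult_left_mono divide_left_mono) auto
    moreover have "(2/3) * (real s / (3 * sqrt m)) \<ge> real s / (5 * sqrt m)"
      using sm by (simp add: field_simps)
    ultimately show ?thesis by linarith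
  qed
  also have "\<dots> \<le> ln 2 * (real i + 1)"
    using i' ln2_ge_two_thirds by (intro mult_mono) auto
  finally have "real s / (5 * sqrt m) - ln 2 \<le> real i * ln 2" by (simp add: algebra_simps)
  then have "exp (- (real i * ln 2)) \<le> exp (ln 2 - real s / (5 * sqrt m))" by simp
  also have "\<dots> = 2 * exp (- real s / (5 * sqrt m))" by (simp add: exp_diff exp_minus field_simps)
  also have "exp (- (real i * ln 2)) = 1 / 2 ^ i"
    by (simp add: exp_minus exp_of_nat_mult field_simps)
  finally have e: "1 / 2 ^ i \<le> 2 * exp (- real s / (5 * sqrt m))" .
  have "pairs k (m - s) \<le> pairs k (m - i * S)" using iS by (intro pairs_mono k) auto
  also have "\<dots> \<le> 1 / 2 ^ i * pairs k m" using it[of i] iS assms by simp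
  also have "\<dots> \<le> 2 * exp (- real s / (5 * sqrt m)) * pairs k m"
    by (intro mult_right_mono e pairs_nonneg)
  finally show ?thesis .
qed

section \<open>Summatory function of the divisor sums\<close>

lemma divsum_mono: "k \<le> l \<Longrightarrow> divsum k s \<le> divsum l s"
proof -
  assume "k \<le> l"
  then have "(\<Sum>j<k. if 2 * j + 1 dvd s then 2 * (2 * real j + 1) else 0)
      \<le> (\<Sum>j<l. if 2 * j + 1 dvd s then 2 * (2 * real j + 1) else 0)"
    by (intro sum_mono2) auto
  then show ?thesis by (simp add: divsum_def)
qed

lemma divsum_stable:
  assumes "s \<le> 2 * k" "k \<le> l"
  shows "divsum l s = divsum k s"
proof -
  have "(\<Sum>j<l. if 2 * j + 1 dvd s then 2 * (2 * real j + 1) else 0)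
      = (\<Sum>j<k. if 2 * j + 1 dvd s then 2 * (2 * real j + 1) else 0)" if "s > 0"
    using assms that by (intro sum.mono_neutral_right) (auto dest!: dvd_imp_le)
  then show ?thesis by (simp add: divsum_def)
qed

text \<open>Index S+1 admits all odd numbers up to 2S+1, hence all odd divisors of every s \<le> S:
  this is the untruncated summatory function.\<close>

definition divtotal :: "nat \<Rightarrow> real" where
  "divtotal S = (\<Sum>s\<le>S. divsum (S + 1) s)"

lemma sum_divsum_le: "(\<Sum>s\<le>S. divsum k s) \<le> divtotal S"
proof -
  have "divsum k s \<le> divsum (S + 1) s" if "s \<le> S" for s
    using divsum_mono[of k "max k (S + 1)" s] divsum_stable[of s "S + 1" "max k (S + 1)"] that by simp
  then show ?thesis unfolding divtotal_def by (intro sum_mono) auto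
qed

lemma sum_divsum_eq:
  assumes "S \<le> 2 * k"
  shows "(\<Sum>s\<le>S. divsum k s) = divtotal S"
  unfolding divtotal_def
proof (intro sum.cong refl)
  fix s assume "s \<in> {..S}"
  then show "divsum k s = divsum (S + 1) s"
    using divsum_stable[of s "S + 1" "max k (S + 1)"] divsum_stable[of s k "max k (S + 1)"] assms by simp
qed

text \<open>Double counting by the cofactor a in s = a(2j+1). For fixed a, the odd numbers up to S/a
  sum to the square of their number, which is (S div a + 1) div 2.\<close>

lemma divtotal_eq: "divtotal S = (\<Sum>a=1..S. 2 * (real ((S div a + 1) div 2))\<^sup>2)"
proof -
  have "divtotal S = (\<Sum>s=1..S. divsum (S + 1) s)"
    unfolding divtotal_def by (intro sum.mono_neutral_right) (auto simp: divsum_def)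
  also have "\<dots> = (\<Sum>s=1..S. \<Sum>j<S+1. \<Sum>a=1..S. if a * (2 * j + 1) = s then 2 * (2 * real j + 1) else 0)"
  proof (intro sum.cong refl)
    fix s assume s: "s \<in> {1..S}"
    have "(\<Sum>a=1..S. if a * (2 * j + 1) = s then 2 * (2 * real j + 1) else 0)
        = (if 2 * j + 1 dvd s then 2 * (2 * real j + 1) else 0)" for j
    proof (cases "2 * j + 1 dvd s")
      case True
      then obtain b where b: "s = b * (2 * j + 1)" by (metis dvd_def mult.commute)
      have "b \<in> {1..S}" using b s by (cases b) auto
      have "(\<Sum>a=1..S. if a * (2 * j + 1) = s then 2 * (2 * real j + 1) else 0)
          = (\<Sum>a=1..S. if a = b then 2 * (2 * real j + 1) else 0)"
      proof -
        have "a * (2 * j + 1) = b * (2 * j + 1) \<longleftrightarrow> a = b" for a by (subst mult_cancel2) simp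
        then show ?thesis unfolding b by (simp only:)
      qed
      then show ?thesis using True \<open>b \<in> {1..S}\<close> by simp
    next
      case False
      have ne: "a * (2 * j + 1) = s \<longleftrightarrow> False" for a using False by (metis dvd_triv_right)
      show ?thesis using False by (simp only: ne if_False sum.neutral_const)
    qed
    then show "divsum (S + 1) s = (\<Sum>j<S+1. \<Sum>a=1..S. if a * (2 * j + 1) = s then 2 * (2 * real j + 1) else 0)"
      using s by (simp add: divsum_def)
  qed
  also have "\<dots> = (\<Sum>a=1..S. \<Sum>j<S+1. \<Sum>s=1..S. if a * (2 * j + 1) = s then 2 * (2 * real j + 1) else 0)"
    by (subst sum.swap, subst (2) sum.swap, subst sum.swap) (rule refl)
  also have "\<dots> = (\<Sum>a=1..S. 2 * (real ((S div a + 1) div 2))\<^sup>2)"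
  proof (intro sum.cong refl)
    fix a assume a: "a \<in> {1..S}"
    define y where "y = (S div a + 1) div 2"
    have iff: "a * (2 * j + 1) \<le> S \<longleftrightarrow> j < y" for j
    proof -
      have "a * (2 * j + 1) \<le> S \<longleftrightarrow> 2 * j + 1 \<le> S div a"
        using a by (metis atLeastAtMost_iff less_eq_div_iff_mult_less_eq less_le_trans mult.commute
            zero_less_one)
      then show ?thesis unfolding y_def by linarith
    qed
    have yS: "y \<le> S + 1" unfolding y_def using div_le_dividend[of S a] by linarith
    have "(\<Sum>j<S+1. \<Sum>s=1..S. if a * (2 * j + 1) = s then 2 * (2 * real j + 1) else 0)
        = (\<Sum>j<S+1. if j < y then 2 * (2 * real j + 1) else 0)"
    proof (intro sum.cong refl)
      fix j
      have "a * (2 * j + 1) \<ge> 1" using a by simp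
      then show "(\<Sum>s=1..S. if a * (2 * j + 1) = s then 2 * (2 * real j + 1) else 0)
          = (if j < y then 2 * (2 * real j + 1) else 0)"
        using iff[of j] by (simp add: sum.delta')
    qed
    also have "\<dots> = (\<Sum>j<y. 2 * (2 * real j + 1))"
      using yS by (intro sum.mono_neutral_cong_right) auto
    also have "\<dots> = 2 * (real y)\<^sup>2"
      by (induction y) (auto simp: power2_eq_square algebra_simps)
    finally show "(\<Sum>j<S+1. \<Sum>s=1..S. if a * (2 * j + 1) = s then 2 * (2 * real j + 1) else 0)
        = 2 * (real ((S div a + 1) div 2))\<^sup>2"
      by (simp add: y_def)
  qed
  finally show ?thesis .
qed

text \<open>Tannery's theorem applied to the sum over cofactors: the term for a = k+1, divided by
  S^2, tends to 1/(2 a^2) and is dominated by 2/a^2. The limits sum to half of pi^2/6.\<close>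

lemma divtotal_asymp: "(\<lambda>S. divtotal S / (real S)\<^sup>2) \<longlonglongrightarrow> pi\<^sup>2 / 12"
proof -
  define t where "t = (\<lambda>k S. 2 * (real ((S div Suc k + 1) div 2) / real S)\<^sup>2)"
  have lim: "(\<lambda>S. t k S) \<longlonglongrightarrow> 2 * (1 / (2 * real (Suc k)))\<^sup>2" for k
    unfolding t_def
  proof (intro tendsto_mult tendsto_power tendsto_const)
    show "(\<lambda>S. real ((S div Suc k + 1) div 2) / real S) \<longlonglongrightarrow> 1 / (2 * real (Suc k))"
    proof -
      have b: "\<bar>real ((S div Suc k + 1) div 2) / real S - 1 / (2 * real (Suc k))\<bar> \<le> 1 / real S" if "0 < S" for S
      proof -
        define x where "x = real S / real (Suc k)"
        have 1: "real (S div Suc k) \<le> x" unfolding x_def by (rule of_nat_div_le_of_nat)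
        have 2: "x < real (S div Suc k) + 1" unfolding x_def
          by (metis floor_divide_of_nat_eq floor_less_iff of_int_of_nat_eq less_add_one
              real_of_int_floor_add_one_gt)
        have "\<bar>real ((S div Suc k + 1) div 2) - x / 2\<bar> \<le> 1" using 1 2 by linarith
        moreover have "real ((S div Suc k + 1) div 2) / real S - 1 / (2 * real (Suc k))
            = (real ((S div Suc k + 1) div 2) - x / 2) / real S"
          using that by (simp add: x_def field_simps)
        ultimately show ?thesis by (simp add: abs_divide divide_right_mono)
      qed
      have "(\<lambda>S. real ((S div Suc k + 1) div 2) / real S - 1 / (2 * real (Suc k))) \<longlonglongrightarrow> 0"
        by (rule Lim_null_comparison[OF _ lim_1_over_n])
           (use eventually_gt_at_top[of 0] in eventually_elim, use b in simp)
      then show ?thesis by (simp add: LIM_zero_iff)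
    qed
  qed
  have bd: "norm (t k S) \<le> 2 * (1 / real ((k + 1)\<^sup>2))" for k S
  proof (cases "Suc k \<le> S")
    case True
    have "1 \<le> S div Suc k" using True by (metis div_greater_zero_iff less_eq_Suc_le One_nat_def zero_less_Suc)
    then have "real ((S div Suc k + 1) div 2) \<le> real (S div Suc k)" by linarith
    also have "\<dots> \<le> real S / real (Suc k)" by (rule of_nat_div_le_of_nat)
    finally have "real ((S div Suc k + 1) div 2) / real S \<le> 1 / real (Suc k)"
      using True by (simp add: field_simps)
    then have "(real ((S div Suc k + 1) div 2) / real S)\<^sup>2 \<le> (1 / real (Suc k))\<^sup>2"
      by (intro power_mono) auto
    then show ?thesis by (simp add: t_def power_divide)
  qed (simp add: t_def)
  have S1: "(\<lambda>k. 1 / real ((k + 1)\<^sup>2)) sums (pi\<^sup>2 / 6)"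
    using inverse_squares_sums by simp
  have "((\<lambda>S. suminf (\<lambda>k. t k S)) \<longlongrightarrow> (\<Sum>k. 2 * (1 / (2 * real (Suc k)))\<^sup>2)) sequentially"
  proof (rule tannerys_theorem[OF lim, where M
      = "\<lambda>k. 2 * (1 / real ((k + 1)\<^sup>2))", THEN conjunct2, THEN conjunct2])
    show "eventually (\<lambda>(k, S). norm (t k S) \<le> 2 * (1 / real ((k + 1)\<^sup>2))) (at_top \<times>\<^sub>F sequentially)"
      by (intro always_eventually) (simp only: split_paired_All case_prod_conv bd simp_thms)
    show "summable (\<lambda>k. 2 * (1 / real ((k + 1)\<^sup>2)))"
      by (intro summable_mult sums_summable[OF S1])
  qed simp
  also have "(\<Sum>k. 2 * (1 / (2 * real (Suc k)))\<^sup>2) = pi\<^sup>2 / 12"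
  proof -
    have "(\<lambda>k. 1/2 * (1 / real ((k + 1)\<^sup>2))) sums (1/2 * (pi\<^sup>2 / 6))" by (intro sums_mult S1)
    moreover have "1/2 * (1 / x\<^sup>2) = 2 * (1 / (2 * x))\<^sup>2" for x :: real
      by (simp add: power2_eq_square)
    then have "1/2 * (1 / real ((k + 1)\<^sup>2)) = 2 * (1 / (2 * real (Suc k)))\<^sup>2" for k
      by (simp only: of_nat_power Suc_eq_plus1)
    ultimately have "(\<lambda>k. 2 * (1 / (2 * real (Suc k)))\<^sup>2) sums (1/2 * (pi\<^sup>2 / 6))"
      by (simp only:)
    then show ?thesis by (simp add: sums_iff)
  qed
  also have "(\<lambda>S. suminf (\<lambda>k. t k S)) = (\<lambda>S. divtotal S / (real S)\<^sup>2)"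
  proof
    fix S
    have "suminf (\<lambda>k. t k S) = (\<Sum>k<S. t k S)"
      by (rule suminf_finite) (auto simp: t_def)
    also have "\<dots> = (\<Sum>a=1..S. 2 * (real ((S div a + 1) div 2) / real S)\<^sup>2)"
      unfolding t_def by (rule sum.reindex_bij_witness[of _ "\<lambda>a. a - 1" Suc]) auto
    also have "\<dots> = divtotal S / (real S)\<^sup>2"
      unfolding divtotal_eq by (simp add: sum_divide_distrib power_divide)
    finally show "suminf (\<lambda>k. t k S) = divtotal S / (real S)\<^sup>2" .
  qed
  finally show ?thesis .
qed

section \<open>Partial sums, summation by parts, and the comparison of g with Q\<close>

definition psum :: "nat \<Rightarrow> nat \<Rightarrow> real" where
  "psum k n = (\<Sum>s\<le>n. pairs k s)"

text \<open>The strict bound makes this the convolution of g with the weight s and gives Q(n+1) =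
  Q(n) + P(n), the form that leads to the Riccati equation.\<close>

definition ppsum :: "nat \<Rightarrow> nat \<Rightarrow> real" where
  "ppsum k n = (\<Sum>s<n. psum k s)"

lemma ppsum_eq: "ppsum k n = (\<Sum>s\<le>n. real s * pairs k (n - s))"
proof (induction n)
  case (Suc n)
  have P: "psum k n = (\<Sum>s\<le>n. pairs k (n - s))"
    unfolding psum_def by (rule sum.reindex_bij_witness[of _ "\<lambda>s. n - s" "\<lambda>s. n - s"]) auto
  have "(\<Sum>s\<le>Suc n. real s * pairs k (Suc n - s)) = (\<Sum>s\<le>n. (real s + 1) * pairs k (n - s))"
    by (simp add: sum.atMost_Suc_shift add.commute del: sum.atMost_Suc)
  also have "\<dots> = ppsum k n + psum k n"
    by (simp add: Suc.IH P algebra_simps sum.distrib)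
  finally show ?case by (simp add: ppsum_def)
qed (simp add: ppsum_def)

text \<open>Abel summation with g(-1) read as 0, which the case s = N encodes.\<close>

lemma sum_conv_by_parts:
  fixes v g :: "nat \<Rightarrow> real"
  shows "(\<Sum>s\<le>N. v s * g (N - s)) = (\<Sum>s\<le>N. (\<Sum>i\<le>s. v i) * (g (N - s) - (if s = N then 0 else g (N - s - 1))))"
proof (induction N)
  case (Suc N)
  define G where "G = (\<lambda>n. \<Sum>s\<le>n. v s * g (n - s))"
  define V where "V = (\<lambda>s. \<Sum>i\<le>s. v i)"
  have "(\<Sum>s\<le>Suc N. V s * (g (Suc N - s) - (if s = Suc N then 0 else g (Suc N - s - 1))))
      = (\<Sum>s\<le>Suc N. V s * g (Suc N - s)) - (\<Sum>s\<le>N. V s * g (N - s))"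
    by (simp add: algebra_simps sum_subtractf)
  also have "(\<Sum>s\<le>Suc N. V s * g (Suc N - s)) = V 0 * g (Suc N) + (\<Sum>s\<le>N. V (Suc s) * g (N - s))"
    by (simp add: sum.atMost_Suc_shift del: sum.atMost_Suc)
  also have "(\<Sum>s\<le>N. V (Suc s) * g (N - s)) = (\<Sum>s\<le>N. V s * g (N - s)) + (\<Sum>s\<le>N. v (Suc s) * g (N - s))"
    by (simp add: V_def algebra_simps sum.distrib)
  also have "V 0 * g (Suc N) + ((\<Sum>s\<le>N. V s * g (N - s)) + (\<Sum>s\<le>N. v (Suc s) * g (N - s))) - (\<Sum>s\<le>N. V s * g (N
      - s))
     = (\<Sum>s\<le>Suc N. v s * g (Suc N - s))"
    by (simp add: V_def sum.atMost_Suc_shift del: sum.atMost_Suc)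
  finally show ?case unfolding V_def by simp
qed simp

lemma geometric_exp_sum_le:
  assumes "0 < x"
  shows "(\<Sum>s\<le>n. exp (- real s * x)) \<le> 1 + 1 / x"
proof -
  define r where "r = exp (- x)"
  have r: "0 < r" "r < 1" using assms by (auto simp: r_def)
  have "(\<Sum>s\<le>n. exp (- real s * x)) = (\<Sum>s\<le>n. r ^ s)"
    by (simp add: r_def exp_of_nat_mult[symmetric])
  also have "\<dots> \<le> 1 / (1 - r)"
    using r by (simp add: sum_gp0 divide_right_mono)
  also have "\<dots> \<le> 1 + 1 / x"
  proof -
    have "1 + x \<le> exp x" by (rule exp_ge_add_one_self)
    then have "r \<le> 1 / (1 + x)" using assms by (simp add: r_def exp_minus field_simps)
    then have "1 - r \<ge> x / (1 + x)" using assms by (simp add: field_simps)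
    then have "1 / (1 - r) \<le> 1 / (x / (1 + x))" using assms by (intro divide_left_mono) (auto simp: r)
    also have "\<dots> = 1 + 1 / x" using assms by (simp add: field_simps)
    finally show ?thesis .
  qed
  finally show ?thesis .
qed

text \<open>Half of the exponent in the decay bound absorbs s^2 through y^2 \<le> 2 exp y at y = s /
  (10 sqrt N); the other half is summed geometrically and contributes 11 sqrt N. The constant is 100
  * 4 * 11.\<close>

lemma pairs_second_moment:
  assumes "1 \<le> N" "3 * sqrt N \<le> 2 * real k"
  shows "(\<Sum>s\<le>N. (real s)\<^sup>2 * pairs k (N - s)) \<le> 4400 * real N * sqrt N * pairs k N"
proof -
  have sN: "sqrt N \<ge> 1" using assms by simp
  define x where "x = 1 / (10 * sqrt N)"
  have x: "x > 0" using sN by (simp add: x_def)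
  have "(real s)\<^sup>2 * pairs k (N - s) \<le> 400 * real N * pairs k N * exp (- real s * x)" if "s \<le> N" for s
  proof -
    define y where "y = real s * x"
    have y0: "y \<ge> 0" using x by (simp add: y_def)
    have sy: "(real s)\<^sup>2 = 100 * real N * y\<^sup>2" using sN
        by (simp add: y_def x_def power_divide power_mult_distrib)
    have "y\<^sup>2 \<le> 2 * exp y"
    proof -
      have "1 + y + y\<^sup>2 / 2 \<le> exp y" using exp_lower_Taylor_quadratic[OF y0] by simp
      then show ?thesis using y0 by linarith
    qed
    moreover have "pairs k (N - s) \<le> 2 * exp (- 2 * y) * pairs k N"
      using pairs_decay[OF assms that] by (simp add: y_def x_def)
    ultimately have "y\<^sup>2 * pairs k (N - s) \<le> (2 * exp y) * (2 * exp (- 2 * y) * pairs k N)"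
      by (intro mult_mono pairs_nonneg) auto
    also have "\<dots> = 4 * pairs k N * exp (- y)" by (simp add: exp_add[symmetric] mult.assoc[symmetric])
    finally have "100 * real N * (y\<^sup>2 * pairs k (N - s)) \<le> 100 * real N * (4 * pairs k N * exp (- y))"
      by (intro mult_left_mono) auto
    then show ?thesis unfolding sy by (simp add: y_def mult_ac)
  qed
  then have "(\<Sum>s\<le>N. (real s)\<^sup>2 * pairs k (N - s)) \<le> (\<Sum>s\<le>N. 400 * real N * pairs k N * exp (- real s * x))"
    by (intro sum_mono) auto
  also have "\<dots> = 400 * real N * pairs k N * (\<Sum>s\<le>N. exp (- real s * x))"
    by (simp add: sum_distrib_left)
  also have "\<dots> \<le> 400 * real N * pairs k N * (11 * sqrt N)"
  proof (intro mult_left_mono)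
    have "(\<Sum>s\<le>N. exp (- real s * x)) \<le> 1 + 1 / x" by (rule geometric_exp_sum_le[OF x])
    also have "\<dots> \<le> 11 * sqrt N" using sN by (simp add: x_def)
    finally show "(\<Sum>s\<le>N. exp (- real s * x)) \<le> 11 * sqrt N" .
  qed (auto simp: pairs_nonneg)
  finally show ?thesis by (simp add: mult_ac)
qed

text \<open>With D(s) = g(N-s) - g(N-s-1) \<ge> 0, summation by parts writes N g(N) as the sum of
  V(s) D(s), where V sums \<open>divsum k\<close>, and Q(N) as the sum of s(s+1)/2 D(s). So V(s) is
  compared with (pi^2/12) s(s+1) under nonnegative weights. The error is a relative one d, a
  constant C from small s, and a contribution of s > 2k, where V is incomplete. The last two are
  absorbed by d N g(N): the constant because N \<ge> K, the tail by the second moment and k \<ge> K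
  sqrt N. As K depends on e alone, the estimate is uniform in k.\<close>

lemma pairs_vs_ppsum:
  assumes "0 < e"
  shows "\<exists>K\<ge>1. \<forall>k N. real N \<ge> K \<longrightarrow> real k \<ge> K * sqrt N \<longrightarrow>
           \<bar>real N * pairs k N - pi\<^sup>2 / 6 * ppsum k N\<bar> \<le> e * ppsum k N"
proof -
  define d where "d = min (1/4) (e / 4)"
  have d: "0 < d" "d \<le> 1/4" "4 * d \<le> e" using assms by (auto simp: d_def)
  \<comment> \<open>S(S+1) replaces S^2, being the weight that produces Q. The finitely many S that
    are too small for the asymptotics go into C, the sum of their errors.\<close>
  have ex1: "\<exists>C\<ge>0. \<forall>S. \<bar>divtotal S - pi\<^sup>2 / 12 * (real S * (real S + 1))\<bar> \<le> d * (real S * (real S + 1) / 2) + C"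
  proof -
    have "(\<lambda>S. divtotal S / (real S)\<^sup>2 - pi\<^sup>2 / 12 * (1 + 1 / real S)) \<longlonglongrightarrow> pi\<^sup>2 / 12 - pi\<^sup>2 / 12 * (1 + 0)"
      by (intro tendsto_intros divtotal_asymp lim_1_over_n)
    then have "eventually (\<lambda>S. dist (divtotal S / (real S)\<^sup>2 - pi\<^sup>2 / 12 * (1 + 1 / real S)) (pi\<^sup>2 / 12 - pi\<^sup>2
        / 12 * (1 + 0)) < d / 2) sequentially"
      by (rule tendstoD) (use d in simp)
    then have "eventually (\<lambda>S. \<bar>divtotal S / (real S)\<^sup>2 - pi\<^sup>2 / 12 * (1 + 1 / real S)\<bar> < d / 2) sequentially"
      by (simp add: dist_real_def)
    then obtain S0 where S0: "\<And>S. S \<ge> S0 \<Longrightarrow> \<bar>divtotal S / (real S)\<^sup>2 - pi\<^sup>2 / 12 * (1 + 1 / real S)\<bar> < d / 2"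
      by (auto simp: eventually_sequentially)
    define f where "f = (\<lambda>S. divtotal S - pi\<^sup>2 / 12 * (real S * (real S + 1)))"
    define C where "C = (\<Sum>S\<le>S0. \<bar>f S\<bar>)"
    have "\<bar>f S\<bar> \<le> d * (real S * (real S + 1) / 2) + C" for S
    proof (cases "S \<le> S0")
      case True
      then have "\<bar>f S\<bar> \<le> C" unfolding C_def by (intro member_le_sum) auto
      then show ?thesis using d by (simp add: add_increasing)
    next
      case False
      then have "f S = (divtotal S / (real S)\<^sup>2 - pi\<^sup>2 / 12 * (1 + 1 / real S)) * (real S)\<^sup>2"
        by (simp add: f_def field_simps power2_eq_square)
      then have "\<bar>f S\<bar> \<le> d / 2 * (real S)\<^sup>2"
        using S0[of S] False by (simp add: abs_mult mult_right_mono less_imp_le)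
      also have "\<dots> \<le> d * (real S * (real S + 1) / 2)" using d by (simp add: power2_eq_square algebra_simps)
      finally show ?thesis by (simp add: C_def add_increasing2 sum_nonneg)
    qed
    moreover have "C \<ge> 0" by (simp add: C_def sum_nonneg)
    ultimately show ?thesis unfolding f_def by blast
  qed
  then obtain C where C: "C \<ge> 0" "\<And>S. \<bar>divtotal S - pi\<^sup>2 / 12 * (real S * (real S + 1))\<bar>
      \<le> d * (real S * (real S + 1) / 2) + C"
    by blast
  define C1 where "C1 = pi\<^sup>2 / 6 + d + C"
  have C1: "C1 > 0" using d C by (simp add: C1_def add_pos_nonneg)
  have far: "\<bar>(\<Sum>s\<le>S. divsum k s) - pi\<^sup>2 / 12 * (real S * (real S + 1))\<bar> \<le> C1 * (real S * (real S + 1))"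
      if "S \<ge> 1" for S k
  proof -
    have 0: "0 \<le> (\<Sum>s\<le>S. divsum k s)" by (intro sum_nonneg divsum_nonneg)
    have 1: "(\<Sum>s\<le>S. divsum k s) \<le> divtotal S" by (rule sum_divsum_le)
    have "1 \<le> real S * (real S + 1)" using that mult_mono[of 1 "real S" 1 "real S + 1"] by simp
    then have "C * 1 \<le> C * (real S * (real S + 1))" using C by (intro mult_left_mono) auto
    then have 2: "divtotal S \<le> (pi\<^sup>2 / 12 + d + C) * (real S * (real S + 1))"
    proof -
      have "d * (real S * (real S + 1) / 2) \<le> d * (real S * (real S + 1))" using d
          by (intro mult_left_mono) auto
      then show ?thesis using C(2)[of S] \<open>C * 1 \<le> _\<close> by (simp only: distrib_right)
    qed
    have "(pi\<^sup>2 / 12 + d + C) * (real S * (real S + 1)) \<le> C1 * (real S * (real S + 1))"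
      by (intro mult_right_mono) (auto simp: C1_def)
    moreover have "pi\<^sup>2 / 12 * (real S * (real S + 1)) \<le> C1 * (real S * (real S + 1))"
      using d C by (intro mult_right_mono) (auto simp: C1_def)
    moreover have "pi\<^sup>2 / 12 * (real S * (real S + 1)) \<ge> 0" by simp
    ultimately show ?thesis using 0 1 2 by linarith
  qed
  \<comment> \<open>Beyond 2k the sum is only known to lie between 0 and \<open>divtotal\<close>, an
    error of order S^2. As S > k there, it may be enlarged to order S^3/k; after the second moment
    bound the factor 1/k makes it small.\<close>
  have all: "\<bar>(\<Sum>s\<le>S. divsum k s) - pi\<^sup>2 / 12 * (real S * (real S + 1))\<bar>
      \<le> d * (real S * (real S + 1) / 2) + C + C1 / real k * ((real S)\<^sup>2 * (real S + 1))" if "k \<ge> 1" for S k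
  proof (cases "S \<le> 2 * k")
    case True
    have "C1 / real k * ((real S)\<^sup>2 * (real S + 1)) \<ge> 0" using C1 by simp
    then show ?thesis using C(2)[of S] sum_divsum_eq[OF True] by linarith
  next
    case False
    then have "S \<ge> 1" "real S \<ge> real k" by auto
    have "C1 * (real S * (real S + 1)) = C1 / real k * (real k * (real S * (real S + 1)))" using that by simp
    also have "\<dots> \<le> C1 / real k * (real S * (real S * (real S + 1)))"
      using C1 \<open>real S \<ge> real k\<close> by (intro mult_left_mono mult_right_mono) auto
    finally have "C1 * (real S * (real S + 1)) \<le> C1 / real k * ((real S)\<^sup>2 * (real S + 1))"
      by (simp add: power2_eq_square mult.assoc)
    moreover have "d * (real S * (real S + 1) / 2) \<ge> 0" using d by simp
    ultimately show ?thesis using far[OF \<open>S \<ge> 1\<close>, of k] C(1) by linarith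
  qed
  \<comment> \<open>26400 = 2 * 13200 with 13200 = 3 * 4400, the constant in \<open>e4\<close>
    below; each of the two absolute errors is then at most half of d N g(N).\<close>
  define K where "K = max 2 (max (2 * C / d) (26400 * C1 / d))"
  have K: "K \<ge> 2" "2 * C / d \<le> K" "26400 * C1 / d \<le> K" by (auto simp: K_def)
  have main: "\<bar>real N * pairs k N - pi\<^sup>2 / 6 * ppsum k N\<bar> \<le> e * ppsum k N"
    if N: "real N \<ge> K" and k: "real k \<ge> K * sqrt N" for k N
  proof -
    have N1: "N \<ge> 1" using N K by linarith
    have sN: "sqrt N \<ge> 1" using N1 by simp
    have "K * sqrt N \<ge> 2 * sqrt N" using K sN by (intro mult_right_mono) auto
    then have k3: "3 * sqrt N \<le> 2 * real k" and k1: "k \<ge> 1" using k sN by linarith+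
    define D where "D = (\<lambda>s. pairs k (N - s) - (if s = N then 0 else pairs k (N - s - 1)))"
    have D0: "D s \<ge> 0" if "s \<le> N" for s
      unfolding D_def using pairs_nonneg pairs_mono[OF k1, of "N - s - 1" "N - s"] by auto
    have tri: "(\<Sum>i\<le>s. real i) = real s * (real s + 1) / 2" for s by (induction s) (auto simp: field_simps)
    \<comment> \<open>The increments i(3i-1) have partial sums s^2 (s+1), so the cubic weight on the
      differences turns back into a second moment of g.\<close>
    have cub: "(\<Sum>i\<le>s. real i * (3 * real i - 1)) = (real s)\<^sup>2 * (real s + 1)" for s
      by (induction s) (auto simp: field_simps power2_eq_square)
    have e1: "real N * pairs k N = (\<Sum>s\<le>N. (\<Sum>i\<le>s. divsum k i) * D s)"
      unfolding pairs_recurrence D_def by (rule sum_conv_by_parts)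
    have e2: "ppsum k N = (\<Sum>s\<le>N. real s * (real s + 1) / 2 * D s)"
      unfolding ppsum_eq D_def tri[symmetric] by (rule sum_conv_by_parts)
    have e3: "pairs k N = (\<Sum>s\<le>N. 1 * D s)"
    proof -
      have "(\<Sum>s\<le>N. (if s = 0 then 1 else 0) * pairs k (N - s)) = (\<Sum>s\<le>N. (\<Sum>i\<le>s. if i = 0 then 1 else 0) * D s)"
        unfolding D_def by (rule sum_conv_by_parts)
      moreover have "(\<Sum>i\<le>s. if i = 0 then 1 else 0) = (1::real)" for s :: nat by simp
      moreover have "(\<Sum>s\<le>N. (if s = 0 then 1 else 0) * pairs k (N - s)) = pairs k N"
        by (subst sum.mono_neutral_cong_right[where S = "{0}" and h = "\<lambda>s. pairs k (N - s)"]) auto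
      ultimately show ?thesis by simp
    qed
    have e4: "(\<Sum>s\<le>N. (real s)\<^sup>2 * (real s + 1) * D s) \<le> 13200 * real N * sqrt N * pairs k N"
    proof -
      have "(\<Sum>s\<le>N. (real s)\<^sup>2 * (real s + 1) * D s) = (\<Sum>s\<le>N. real s * (3 * real s - 1) * pairs k (N - s))"
        unfolding D_def cub[symmetric] by (rule sum_conv_by_parts[symmetric])
      also have "\<dots> \<le> (\<Sum>s\<le>N. 3 * ((real s)\<^sup>2 * pairs k (N - s)))"
        by (intro sum_mono) (auto simp: algebra_simps power2_eq_square pairs_nonneg)
      also have "\<dots> = 3 * (\<Sum>s\<le>N. (real s)\<^sup>2 * pairs k (N - s))" by (simp add: sum_distrib_left)
      also have "\<dots> \<le> 3 * (4400 * real N * sqrt N * pairs k N)"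
        by (intro mult_left_mono pairs_second_moment N1 k3) auto
      finally show ?thesis by simp
    qed
    have "real N * pairs k N - pi\<^sup>2 / 6 * ppsum k N
        = (\<Sum>s\<le>N. ((\<Sum>i\<le>s. divsum k i) - pi\<^sup>2 / 12 * (real s * (real s + 1))) * D s)"
    proof -
      have "pi\<^sup>2 / 6 * (\<Sum>s\<le>N. real s * (real s + 1) / 2 * D s)
          = (\<Sum>s\<le>N. pi\<^sup>2 / 12 * (real s * (real s + 1)) * D s)"
        unfolding sum_distrib_left by (intro sum.cong) auto
      then show ?thesis unfolding e1 e2 by (simp only: left_diff_distrib sum_subtractf)
    qed
    then have "\<bar>real N * pairs k N - pi\<^sup>2 / 6 * ppsum k N\<bar>
        \<le> (\<Sum>s\<le>N. \<bar>((\<Sum>i\<le>s. divsum k i) - pi\<^sup>2 / 12 * (real s * (real s + 1))) * D s\<bar>)"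
      by (simp only: sum_abs)
    also have "\<dots> \<le> (\<Sum>s\<le>N. (d * (real s * (real s + 1) / 2) + C + C1 / real k * ((real s)\<^sup>2 * (real s + 1)))
        * D s)"
    proof (rule sum_mono)
      fix s assume "s \<in> {..N}"
      then have "D s \<ge> 0" using D0 by blast
      then show "\<bar>((\<Sum>i\<le>s. divsum k i) - pi\<^sup>2 / 12 * (real s * (real s + 1))) * D s\<bar>
          \<le> (d * (real s * (real s + 1) / 2) + C + C1 / real k * ((real s)\<^sup>2 * (real s + 1))) * D s"
        unfolding abs_mult by (simp only: abs_of_nonneg mult_right_mono[OF all[OF k1]])
    qed
    also have "\<dots> = d * ppsum k N + C * pairs k N + C1 / real k * (\<Sum>s\<le>N. (real s)\<^sup>2 * (real s + 1) * D s)"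
    proof -
      have "(p + C + q * r) * x = p * x + C * (1 * x) + q * (r * x)" for p q r x :: real
        by (simp add: algebra_simps)
      then show ?thesis
        unfolding e2 e3 sum_distrib_left by (simp only: sum.distrib mult.assoc)
    qed
    also have "\<dots> \<le> d * ppsum k N + C * pairs k N + C1 / real k * (13200 * real N * sqrt N * pairs k N)"
      using C1 by (intro add_left_mono mult_left_mono e4) auto
    also have "\<dots> \<le> d * ppsum k N + d * (real N * pairs k N)"
    proof -
      have "2 * C \<le> d * K" using K(2) d by (simp add: field_simps)
      also have "d * K \<le> d * real N" using N d by simp
      finally have "2 * C * pairs k N \<le> d * real N * pairs k N" by (intro mult_right_mono pairs_nonneg)
      moreover have "C1 / real k * (13200 * real N * sqrt N * pairs k N) \<le> d / 2 * (real N * pairs k N)"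
      proof -
        have "26400 * C1 \<le> d * K" using K(3) d by (simp add: field_simps)
        then have "26400 * C1 * sqrt N \<le> d * K * sqrt N" using sN by (intro mult_right_mono) auto
        also have "\<dots> \<le> d * real k" using k d by (simp add: mult.assoc)
        finally have "C1 / real k * (13200 * sqrt N) \<le> d / 2" using k1 by (simp add: field_simps)
        then have "C1 / real k * (13200 * sqrt N) * (real N * pairs k N) \<le> d / 2 * (real N * pairs k N)"
          by (intro mult_right_mono mult_nonneg_nonneg pairs_nonneg) auto
        then show ?thesis by (simp add: mult_ac)
      qed
      moreover have "d / 2 * (real N * pairs k N) + d / 2 * (real N * pairs k N) = d * (real N * pairs k N)"
        by simp
      moreover have "d * real N * pairs k N = d * (real N * pairs k N)" by simp
      ultimately show ?thesis by linarith
    qed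
    finally have A: "\<bar>real N * pairs k N - pi\<^sup>2 / 6 * ppsum k N\<bar> \<le> d * ppsum k N + d * (real N * pairs k N)" .
    have Q0: "ppsum k N \<ge> 0" unfolding ppsum_eq by (intro sum_nonneg mult_nonneg_nonneg pairs_nonneg) auto
    have pi2: "pi\<^sup>2 / 6 \<le> 2"
    proof -
      have "pi\<^sup>2 \<le> 3.2\<^sup>2" using pi_less_4 pi_approx by (intro power_mono) auto
      then show ?thesis by (simp add: power2_eq_square)
    qed
    \<comment> \<open>The term d N g(N) on the right of \<open>A\<close> is first absorbed using d
      \<le> 1/4 and pi^2/6 \<le> 2, which bounds N g(N) by 3Q; inserted again, this gives d + 3d =
      4d \<le> e.\<close>
    have "real N * pairs k N \<le> 3 * ppsum k N"
    proof -
      have "real N * pairs k N \<le> pi\<^sup>2 / 6 * ppsum k N + d * ppsum k N + d * (real N * pairs k N)" using A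
          by linarith
      also have "\<dots> \<le> 2 * ppsum k N + 1/4 * ppsum k N + 1/4 * (real N * pairs k N)"
        using d pi2 Q0 pairs_nonneg[of k N] by (intro add_mono mult_right_mono) auto
      finally show ?thesis by linarith
    qed
    then have "d * (real N * pairs k N) \<le> d * (3 * ppsum k N)" using d by (intro mult_left_mono) auto
    with A have "\<bar>real N * pairs k N - pi\<^sup>2 / 6 * ppsum k N\<bar> \<le> (4 * d) * ppsum k N" by linarith
    also have "\<dots> \<le> e * ppsum k N" using d Q0 by (intro mult_right_mono) auto
    finally show ?thesis .
  qed
  show ?thesis using K(1) main by (intro exI[of _ K]) auto
qed

section \<open>The discrete Riccati equation\<close>

text \<open>Limits along this filter mean \<open>m \<rightarrow> \<infinity>\<close> and \<open>k/\<surd>m \<rightarrow> \<infinity>\<close>, hence uniformity in \<open>k\<close>.\<close>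

definition wide :: "(nat \<times> nat) filter" where
  "wide = filtercomap (\<lambda>(k, m). min (real m) (real k / sqrt (real m))) at_top"

lemma eventually_wide:
  "eventually P wide \<longleftrightarrow> (\<exists>K>0. \<forall>k m. real m \<ge> K \<longrightarrow> real k \<ge> K * sqrt m \<longrightarrow> P (k, m))"
proof
  assume "eventually P wide"
  then obtain K where K: "\<And>k m. min (real m) (real k / sqrt m) \<ge> K \<Longrightarrow> P (k, m)"
    unfolding wide_def eventually_filtercomap_at_top_linorder by auto
  have "P (k, m)" if "real m \<ge> max K 1" "real k \<ge> max K 1 * sqrt m" for k m
  proof (rule K)
    have "sqrt m > 0" using that by simp
    then have "max K 1 \<le> real k / sqrt m" using that(2) by (subst pos_le_divide_eq) auto
    then show "min (real m) (real k / sqrt m) \<ge> K" using that by simp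
  qed
  then show "\<exists>K>0. \<forall>k m. real m \<ge> K \<longrightarrow> real k \<ge> K * sqrt m \<longrightarrow> P (k, m)"
    by (intro exI[of _ "max K 1"]) auto
next
  assume "\<exists>K>0. \<forall>k m. real m \<ge> K \<longrightarrow> real k \<ge> K * sqrt m \<longrightarrow> P (k, m)"
  then obtain K where K: "K > 0" "\<And>k m. real m \<ge> K \<Longrightarrow> real k \<ge> K * sqrt m \<Longrightarrow> P (k, m)" by auto
  have "P (k, m)" if "min (real m) (real k / sqrt m) \<ge> K" for k m
  proof (rule K(2))
    have "sqrt m > 0" using that K(1) by simp
    then show "real k \<ge> K * sqrt m" using that by (simp add: pos_le_divide_eq)
  qed (use that in auto)
  then show "eventually P wide"
    unfolding wide_def eventually_filtercomap_at_top_linorder by (intro exI[of _ K]) auto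
qed

lemma filterlim_wide:
  assumes "filterlim m at_top F" "filterlim (\<lambda>i. real (k i) / sqrt (real (m i))) at_top F"
  shows "filterlim (\<lambda>i. (k i, m i)) wide F"
  unfolding wide_def filterlim_filtercomap_iff o_def case_prod_conv
proof (subst filterlim_at_top, intro allI)
  fix Z :: real
  have "eventually (\<lambda>i. real (m i) \<ge> Z) F"
    using filterlim_compose[OF filterlim_real_sequentially assms(1)] by (auto simp: filterlim_at_top)
  moreover have "eventually (\<lambda>i. real (k i) / sqrt (real (m i)) \<ge> Z) F"
    using assms(2) by (auto simp: filterlim_at_top)
  ultimately show "eventually (\<lambda>i. Z \<le> min (real (m i)) (real (k i) / sqrt (real (m i)))) F"
    by eventually_elim auto
qed

lemma filterlim_at_top_eventually:
  fixes f :: "'i \<Rightarrow> real"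
  assumes "filterlim f at_top F"
  shows "eventually (\<lambda>i. Z \<le> f i) F" "eventually (\<lambda>i. Z < f i) F"
proof -
  have ge: "eventually (\<lambda>i. Z \<le> f i) F" for Z
    using assms by (auto simp: filterlim_at_top)
  show "eventually (\<lambda>i. Z \<le> f i) F" by (rule ge)
  show "eventually (\<lambda>i. Z < f i) F" using ge[of "Z + 1"] by eventually_elim simp
qed

lemma filterlim_nat_if_real:
  assumes "filterlim (\<lambda>i. real (f i)) at_top F"
  shows "filterlim f at_top F"
  unfolding filterlim_at_top
proof
  fix Z :: nat
  have "eventually (\<lambda>i. real (f i) \<ge> real Z) F"
    using assms by (rule filterlim_at_top_eventually)
  then show "eventually (\<lambda>i. Z \<le> f i) F" by simp
qed

section \<open>The limit of the ratio of the first to the second partial sum\<close>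

definition lam :: real where "lam = pi / sqrt 6"

lemma lam_pos: "lam > 0" by (simp add: lam_def)

lemma lam_square: "lam\<^sup>2 = pi\<^sup>2 / 6" by (simp add: lam_def power_divide)

lemma psum_pos: "1 \<le> k \<Longrightarrow> psum k n > 0"
  unfolding psum_def by (intro sum_pos) (auto intro: pairs_pos)

lemma ppsum_pos: "1 \<le> k \<Longrightarrow> 1 \<le> n \<Longrightarrow> ppsum k n > 0"
  unfolding ppsum_def by (intro sum_pos) (auto intro: psum_pos simp: lessThan_empty_iff)

lemma eventually_wide_index: "eventually (\<lambda>(k, m). 1 \<le> k \<and> 1 \<le> m) wide"
proof -
  have "1 \<le> k \<and> 1 \<le> m" if "real m \<ge> 1" "real k \<ge> 1 * sqrt m" for k m
    using that real_sqrt_ge_1_iff[of "real m"] by linarith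
  then show ?thesis unfolding eventually_wide by (intro exI[of _ 1]) auto
qed

lemma pairs_over_ppsum_tendsto: "((\<lambda>(k, m). real m * pairs k m / ppsum k m) \<longlongrightarrow> lam\<^sup>2) wide"
proof (rule tendstoI)
  fix e :: real assume e: "e > 0"
  obtain K where K: "K \<ge> 1" "\<And>k N. real N \<ge> K \<Longrightarrow> real k \<ge> K * sqrt N \<Longrightarrow>
      \<bar>real N * pairs k N - pi\<^sup>2 / 6 * ppsum k N\<bar> \<le> (e / 2) * ppsum k N"
    using pairs_vs_ppsum[of "e / 2"] e by auto
  have "eventually (\<lambda>(k, m). \<bar>real m * pairs k m - pi\<^sup>2 / 6 * ppsum k m\<bar> \<le> (e / 2) * ppsum k m) wide"
    unfolding eventually_wide using K by (intro exI[of _ K]) auto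
  then show "eventually (\<lambda>x. dist (case x of (k, m) \<Rightarrow> real m * pairs k m / ppsum k m) (lam\<^sup>2) < e) wide"
    using eventually_wide_index
  proof eventually_elim
    case (elim x)
    obtain k m where x: "x = (k, m)" by (cases x)
    have Q: "ppsum k m > 0" using elim x by (auto intro: ppsum_pos)
    have "real m * pairs k m / ppsum k m - lam\<^sup>2 = (real m * pairs k m - pi\<^sup>2 / 6 * ppsum k m) / ppsum k m"
      using Q by (simp add: lam_square field_simps)
    also have "\<bar>\<dots>\<bar> \<le> e / 2" using elim x Q by (simp add: abs_divide divide_le_eq)
    finally show ?case using e x by (simp add: dist_real_def)
  qed
qed

text \<open>Supersolution: \<mu>/(sqrt N + \<mu>) is r/(1+r) at r = \<mu>/sqrt N and loses \<mu>^2/N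
  to leading order, whereas \<mu>/sqrt N and \<mu>/sqrt (N+1) differ only by order N^(-3/2). For c <
  \<mu>^2 there is room for the forcing c/(N+1).\<close>

lemma riccati_upper_step:
  fixes \<mu> c :: real
  assumes "0 < \<mu>" "c < \<mu>\<^sup>2"
  shows "eventually (\<lambda>N::nat. c / (real N + 1) + \<mu> / (sqrt N + \<mu>) \<le> \<mu> / sqrt (real N + 1)) sequentially"
proof -
  have "(\<lambda>N::nat. real N * (\<mu> / sqrt (real N + 1) - \<mu> / (sqrt N + \<mu>)) - c * (real N / (real N + 1)))
      \<longlonglongrightarrow> \<mu>\<^sup>2 - c * 1"
    using assms(1) by (intro tendsto_intros) (real_asymp simp: power2_eq_square)+
  moreover have "\<mu>\<^sup>2 - c * 1 > 0" using assms by simp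
  ultimately have "eventually (\<lambda>N::nat. real N * (\<mu> / sqrt (real N + 1) - \<mu> / (sqrt N + \<mu>)) - c * (real N
      / (real N + 1)) > 0) sequentially"
    by (rule order_tendstoD)
  then show ?thesis using eventually_gt_at_top[of 0]
  proof eventually_elim
    case (elim N)
    have eq: "real N * (\<mu> / sqrt (real N + 1) - \<mu> / (sqrt N + \<mu>)) - c * (real N / (real N + 1))
        = real N * (\<mu> / sqrt (real N + 1) - \<mu> / (sqrt N + \<mu>) - c / (real N + 1))"
      by (simp add: algebra_simps)
    have "0 < real N * (\<mu> / sqrt (real N + 1) - \<mu> / (sqrt N + \<mu>) - c / (real N + 1))"
      using elim(1) by (simp only: eq)
    then have "0 < \<mu> / sqrt (real N + 1) - \<mu> / (sqrt N + \<mu>) - c / (real N + 1)"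
      using elim(2) by (rule zero_less_mult_pos[OF _ of_nat_0_less_iff[THEN iffD2]])
    then show ?case by linarith
  qed
qed

text \<open>Subsolution by the same expansion: for c > \<nu>^2 the forcing exceeds the loss.\<close>

lemma riccati_lower_step:
  fixes \<nu> c :: real
  assumes "0 < \<nu>" "\<nu>\<^sup>2 < c"
  shows "eventually (\<lambda>N::nat. c / (real N + 1) + \<nu> / (sqrt N + \<nu>) \<ge> \<nu> / sqrt (real N + 1)) sequentially"
proof -
  have "(\<lambda>N::nat. c * (real N / (real N + 1)) - real N * (\<nu> / sqrt (real N + 1) - \<nu> / (sqrt N + \<nu>)))
      \<longlonglongrightarrow> c * 1 - \<nu>\<^sup>2"
    using assms(1) by (intro tendsto_intros) (real_asymp simp: power2_eq_square)+
  moreover have "c * 1 - \<nu>\<^sup>2 > 0" using assms by simp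
  ultimately have "eventually (\<lambda>N::nat. c * (real N / (real N + 1)) - real N * (\<nu> / sqrt (real N + 1) - \<nu>
      / (sqrt N + \<nu>)) > 0) sequentially"
    by (rule order_tendstoD)
  then show ?thesis using eventually_gt_at_top[of 0]
  proof eventually_elim
    case (elim N)
    have eq: "c * (real N / (real N + 1)) - real N * (\<nu> / sqrt (real N + 1) - \<nu> / (sqrt N + \<nu>))
        = real N * (c / (real N + 1) - (\<nu> / sqrt (real N + 1) - \<nu> / (sqrt N + \<nu>)))"
      by (simp add: algebra_simps)
    have "0 < real N * (c / (real N + 1) - (\<nu> / sqrt (real N + 1) - \<nu> / (sqrt N + \<nu>)))"
      using elim(1) by (simp only: eq)
    then have "0 < c / (real N + 1) - (\<nu> / sqrt (real N + 1) - \<nu> / (sqrt N + \<nu>))"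
      using elim(2) by (rule zero_less_mult_pos[OF _ of_nat_0_less_iff[THEN iffD2]])
    then show ?case by linarith
  qed
qed

lemma frac_mono: "0 \<le> x \<Longrightarrow> x \<le> y \<Longrightarrow> x / (1 + x) \<le> y / (1 + y)" for x y :: real
  by (simp add: field_simps)

text \<open>Since Q(N+1) = Q(N) + P(N) and P(N+1) = P(N) + g(N+1), division gives the Riccati
  equation exactly, with forcing g(N+1)/Q(N+1).\<close>

lemma psum_ratio_step:
  assumes "1 \<le> k" "1 \<le> N"
  shows "psum k (Suc N) / ppsum k (Suc N)
    = pairs k (Suc N) / ppsum k (Suc N) + (psum k N / ppsum k N) / (1 + psum k N / ppsum k N)"
proof -
  have Q: "ppsum k N > 0" "psum k N > 0" using assms by (auto intro: ppsum_pos psum_pos)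
  have "ppsum k (Suc N) = ppsum k N + psum k N" "psum k (Suc N) = psum k N + pairs k (Suc N)"
    by (simp_all add: ppsum_def psum_def)
  moreover have "(p / q) / (1 + p / q) = p / (q + p)" if "q > 0" "p > 0" for p q :: real
    using that by (simp add: field_simps)
  from this[OF Q] have "(psum k N / ppsum k N) / (1 + psum k N / ppsum k N)
      = psum k N / (ppsum k N + psum k N)" .
  ultimately show ?thesis by (simp only: add_divide_distrib add.commute)
qed

text \<open>
  The map \<open>r \<mapsto> c\<^sub>n + r/(1+r)\<close> is increasing, so super- and subsolutions bound \<open>P/Q\<close>. The transients come
  from the equation without forcing, which \<open>1/(n-a+1)\<close> solves exactly, and from the growth by
  \<open>\<delta>/n\<close> per step below \<open>\<nu>/\<surd>n\<close>. They make the bounds independent of the initial value, and so of \<open>k\<close>.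
\<close>

lemma psum_ratio_bounds:
  assumes k: "1 \<le> k" and a: "1 \<le> a" "a \<le> N"
    and mu: "0 < \<mu>" and nu: "0 < \<nu>" and dl: "0 < \<delta>"
    and g: "\<And>n. a \<le> n \<Longrightarrow> n \<le> N \<Longrightarrow> c' / real n \<le> pairs k n / ppsum k n"
           "\<And>n. a \<le> n \<Longrightarrow> n \<le> N \<Longrightarrow> pairs k n / ppsum k n \<le> c / real n"
    and su: "\<And>n. n + 1 \<ge> a \<Longrightarrow> c / (real n + 1) + \<mu> / (sqrt n + \<mu>) \<le> \<mu> / sqrt (real n + 1)"
    and sl: "\<And>n. n \<ge> a \<Longrightarrow> c' / (real n + 1) + \<nu> / (sqrt n + \<nu>) \<ge> \<nu> / sqrt (real n + 1)"
            "\<And>n. n \<ge> a \<Longrightarrow> c' / (real n + 1) - \<nu>\<^sup>2 / real n \<ge> \<delta> / real n"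
    and a2: "2 \<le> a"
  shows "psum k N / ppsum k N \<le> \<mu> / sqrt N + 1 / (real N - real a + 1)"
    and "psum k N / ppsum k N \<ge> min (\<nu> / sqrt N) (\<delta> * (real N - real a) / real N)"
proof -
  define r where "r = (\<lambda>n. psum k n / ppsum k n)"
  have r0: "r n \<ge> 0" if "n \<ge> 1" for n
    using psum_pos[OF k, of n] ppsum_pos[OF k that] by (simp add: r_def)
  have step: "r (Suc n) = pairs k (Suc n) / ppsum k (Suc n) + r n / (1 + r n)" if "n \<ge> 1" for n
    unfolding r_def using k that by (rule psum_ratio_step)
  have "r N \<le> \<mu> / sqrt N + 1 / (real N - real a + 1) \<and> r N \<ge> min (\<nu> / sqrt N) (\<delta> * (real N - real a) / real N)"
    using a(2) g
  proof (induction N rule: dec_induct)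
    \<comment> \<open>As r/(1+r) \<le> 1, one step of the equation bounds the ratio at a by c/a + 1
      whatever the previous value, and this 1 is the transient at n = a. The step starts from a-1
      \<ge> 1, which is why a \<ge> 2 and why the supersolution inequality is assumed from n+1 = a
      on.\<close>
    case base
    obtain a' where a': "a = Suc a'" "a' \<ge> 1" using a2 by (cases a) auto
    have "r a = pairs k a / ppsum k a + r a' / (1 + r a')" using step[OF a'(2)] a' by simp
    also have "\<dots> \<le> c / real a + 1"
      using base(2)[of a] r0[OF a'(2)] by (intro add_mono) auto
    also have "c / real a \<le> \<mu> / sqrt a"
    proof -
      have "\<mu> / (sqrt a' + \<mu>) \<ge> 0" using mu by simp
      then show ?thesis using su[of a'] a' by (simp add: add.commute)
    qed
    finally have "r a \<le> \<mu> / sqrt a + 1" by simp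
    moreover have "r a \<ge> 0" using r0 a by simp
    moreover have "min (\<nu> / sqrt a) 0 \<le> 0" by simp
    ultimately show ?case by simp
  next
    case (step n)
    have n1: "n \<ge> 1" using step a by simp
    have IH: "r n \<le> \<mu> / sqrt n + 1 / (real n - real a + 1)" "r n \<ge> min (\<nu> / sqrt n) (\<delta> * (real n - real a)
        / real n)"
      using step.IH step.prems by auto
    have rS: "r (Suc n) = pairs k (Suc n) / ppsum k (Suc n) + r n / (1 + r n)" by (rule \<open>\<And>n. n \<ge> 1 \<Longrightarrow> r (Suc n)
        = _\<close>[OF n1])
    have cu: "pairs k (Suc n) / ppsum k (Suc n) \<le> c / (real n + 1)"
      and cl: "c' / (real n + 1) \<le> pairs k (Suc n) / ppsum k (Suc n)"
      using step.prems(1)[of "Suc n"] step.prems(2)[of "Suc n"] step.hyps by (simp_all add: add.commute)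
    have sn: "sqrt n > 0" using n1 by simp
    have up: "r (Suc n) \<le> \<mu> / sqrt (Suc n) + 1 / (real (Suc n) - real a + 1)"
    proof -
      define u where "u = \<mu> / sqrt n"
      define b where "b = 1 / (real n - real a + 1)"
      have ub: "u \<ge> 0" "b > 0" using mu step.hyps by (auto simp: u_def b_def)
      have "r n / (1 + r n) \<le> (u + b) / (1 + (u + b))"
        using IH(1) r0[OF n1] by (intro frac_mono) (auto simp: u_def b_def)
      \<comment> \<open>The map x/(1+x) is subadditive on nonnegative numbers, so profile and
        transient evolve separately.\<close>
      also have "\<dots> \<le> u / (1 + u) + b / (1 + b)"
      proof -
        have "(u + b) / (1 + (u + b)) = u / (1 + (u + b)) + b / (1 + (u + b))" by (simp add: add_divide_distrib)
        also have "\<dots> \<le> u / (1 + u) + b / (1 + b)" using ub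
            by (intro add_mono divide_left_mono mult_pos_pos) auto
        finally show ?thesis .
      qed
      also have "u / (1 + u) = \<mu> / (sqrt n + \<mu>)" using sn mu by (simp add: u_def field_simps)
      also have "b / (1 + b) = 1 / (real (Suc n) - real a + 1)"
        using step.hyps by (simp add: b_def field_simps)
      finally have "r (Suc n) \<le> c / (real n + 1) + \<mu> / (sqrt n + \<mu>) + 1 / (real (Suc n) - real a + 1)"
        using cu rS by linarith
      also have "\<dots> \<le> \<mu> / sqrt (Suc n) + 1 / (real (Suc n) - real a + 1)"
        using su[of n] step.hyps by (simp add: add.commute)
      finally show ?thesis .
    qed
    have low: "r (Suc n) \<ge> min (\<nu> / sqrt (Suc n)) (\<delta> * (real (Suc n) - real a) / real (Suc n))"
    proof (cases "\<delta> * (real n - real a) / real n \<le> \<nu> / sqrt n")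
      case False
      then have "r n \<ge> \<nu> / sqrt n" using IH(2) by simp
      then have "(\<nu> / sqrt n) / (1 + \<nu> / sqrt n) \<le> r n / (1 + r n)"
        using nu by (intro frac_mono) auto
      also have "(\<nu> / sqrt n) / (1 + \<nu> / sqrt n) = \<nu> / (sqrt n + \<nu>)" using sn nu by (simp add: field_simps)
      finally have "r (Suc n) \<ge> \<nu> / sqrt (real n + 1)"
        using cl rS sl(1)[of n] step.hyps by linarith
      then show ?thesis by (simp add: add.commute)
    next
      \<comment> \<open>Below \<nu>/sqrt n, passing to y/(1+y) loses at most y^2 \<le> \<nu>^2/n,
        while the forcing supplies at least (\<nu>^2 + \<delta>)/n: a net gain of
        \<delta>/n.\<close>
      case True
      define y where "y = \<delta> * (real n - real a) / real n"
      have y0: "y \<ge> 0" using dl step.hyps by (simp add: y_def)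
      have "r n \<ge> y" using IH(2) True by (simp add: y_def)
      then have "y / (1 + y) \<le> r n / (1 + r n)" using y0 by (intro frac_mono)
      moreover have "y - y\<^sup>2 \<le> y / (1 + y)"
      proof -
        have "(y - y\<^sup>2) * (1 + y) = y - y^3" by (simp add: algebra_simps power2_eq_square power3_eq_cube)
        also have "\<dots> \<le> y" using y0 by simp
        finally show ?thesis using y0 by (simp add: le_divide_eq)
      qed
      moreover have "y\<^sup>2 \<le> (\<nu> / sqrt n)\<^sup>2" using True y0 by (intro power_mono) (auto simp: y_def)
      then have "y\<^sup>2 \<le> \<nu>\<^sup>2 / real n" by (simp add: power_divide)
      ultimately have "r (Suc n) \<ge> y + \<delta> / real n"
        using cl rS sl(2)[of n] step.hyps by linarith
      moreover have "y + \<delta> / real n \<ge> \<delta> * (real (Suc n) - real a) / real (Suc n)"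
      proof -
        have "y + \<delta> / real n = \<delta> * (real (Suc n) - real a) / real n"
          using n1 by (simp add: y_def field_simps)
        also have "\<dots> \<ge> \<delta> * (real (Suc n) - real a) / real (Suc n)"
          using dl step.hyps n1 by (intro divide_left_mono mult_nonneg_nonneg) auto
        finally show ?thesis .
      qed
      ultimately show ?thesis by linarith
    qed
    show ?case using up low by simp
  qed
  then show "psum k N / ppsum k N \<le> \<mu> / sqrt N + 1 / (real N - real a + 1)"
    and "psum k N / ppsum k N \<ge> min (\<nu> / sqrt N) (\<delta> * (real N - real a) / real N)"
    by (simp_all add: r_def)
qed

text \<open>For \<nu> < lam < \<mu> the constants c' and c are put strictly between the squares. The
  start a depends on the precision only, so the transients become harmless on the scale 1/sqrt N:
  sqrt N / (N-a+1) tends to 0, while \<delta>(N-a)/N eventually exceeds \<nu>/sqrt N.\<close>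

lemma psum_over_ppsum_tendsto: "((\<lambda>(k, m). sqrt m * psum k m / ppsum k m) \<longlongrightarrow> lam) wide"
proof (rule tendstoI)
  fix e0 :: real assume "e0 > 0"
  define e where "e = min (e0 / 2) lam"
  have e: "e > 0" "e \<le> lam" "e < e0" using \<open>e0 > 0\<close> lam_pos by (auto simp: e_def)
  define \<mu> where "\<mu> = lam + e / 2"
  define \<nu> where "\<nu> = lam - e / 2"
  have mn: "\<mu> > 0" "\<nu> > 0" "\<nu> < lam" "lam < \<mu>" using e lam_pos by (auto simp: \<mu>_def \<nu>_def)
  have sq: "lam\<^sup>2 < \<mu>\<^sup>2" "\<nu>\<^sup>2 < lam\<^sup>2" using mn lam_pos by (auto intro!: power_strict_mono)
  define c where "c = (lam\<^sup>2 + \<mu>\<^sup>2) / 2"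
  define c' where "c' = (lam\<^sup>2 + \<nu>\<^sup>2) / 2"
  have cc: "lam\<^sup>2 < c" "c < \<mu>\<^sup>2" "\<nu>\<^sup>2 < c'" "c' < lam\<^sup>2" using sq by (auto simp: c_def c'_def)
  define \<delta> where "\<delta> = (c' - \<nu>\<^sup>2) / 2"
  have dl: "\<delta> > 0" using cc by (simp add: \<delta>_def)
  have "eventually (\<lambda>x. (case x of (k, m) \<Rightarrow> real m * pairs k m / ppsum k m) < c) wide"
       "eventually (\<lambda>x. (case x of (k, m) \<Rightarrow> real m * pairs k m / ppsum k m) > c') wide"
    using order_tendstoD[OF pairs_over_ppsum_tendsto] cc by auto
  then have "eventually (\<lambda>(k, m). c' < real m * pairs k m / ppsum k m \<and> real m * pairs k m
      / ppsum k m < c) wide"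
    by eventually_elim auto
  then obtain K1 where K1: "K1 > 0" "\<And>k m. real m \<ge> K1 \<Longrightarrow> real k \<ge> K1 * sqrt m \<Longrightarrow>
      c' < real m * pairs k m / ppsum k m \<and> real m * pairs k m / ppsum k m < c"
    unfolding eventually_wide by auto
  have "eventually (\<lambda>N::nat. c' / (real N + 1) - \<nu>\<^sup>2 / real N \<ge> \<delta> / real N) sequentially"
  proof -
    have "(\<lambda>N::nat. c' * (real N / (real N + 1)) - \<nu>\<^sup>2 - \<delta>) \<longlonglongrightarrow> c' * 1 - \<nu>\<^sup>2 - \<delta>"
      by (intro tendsto_intros) real_asymp
    moreover have "c' * 1 - \<nu>\<^sup>2 - \<delta> > 0" using cc by (simp add: \<delta>_def field_simps)
    ultimately have "eventually (\<lambda>N::nat. c' * (real N / (real N + 1)) - \<nu>\<^sup>2 - \<delta> > 0) sequentially"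
      by (rule order_tendstoD)
    then show ?thesis using eventually_gt_at_top[of 0]
    proof eventually_elim
      case (elim N)
      have "c' / (real N + 1) - \<nu>\<^sup>2 / real N - \<delta> / real N = (c' * (real N / (real N + 1)) - \<nu>\<^sup>2 - \<delta>) / real N"
        using elim(2) by (simp add: diff_divide_distrib)
      also have "\<dots> > 0" using elim by simp
      finally show ?case by linarith
    qed
  qed
  with riccati_upper_step[OF mn(1) cc(2)] riccati_lower_step[OF mn(2) cc(3)]
  have "eventually (\<lambda>N::nat. c / (real N + 1) + \<mu> / (sqrt N + \<mu>) \<le> \<mu> / sqrt (real N + 1) \<and>
      c' / (real N + 1) + \<nu> / (sqrt N + \<nu>) \<ge> \<nu> / sqrt (real N + 1) \<and>
      c' / (real N + 1) - \<nu>\<^sup>2 / real N \<ge> \<delta> / real N) sequentially"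
    by eventually_elim auto
  then obtain N0 where N0: "\<And>N. N \<ge> N0 \<Longrightarrow> c / (real N + 1) + \<mu> / (sqrt N + \<mu>) \<le> \<mu> / sqrt (real N + 1) \<and>
      c' / (real N + 1) + \<nu> / (sqrt N + \<nu>) \<ge> \<nu> / sqrt (real N + 1) \<and>
      c' / (real N + 1) - \<nu>\<^sup>2 / real N \<ge> \<delta> / real N"
    unfolding eventually_sequentially by blast
  define a where "a = max (N0 + 1) (nat \<lceil>K1\<rceil>) + 2"
  have a: "a \<ge> N0 + 1" "real a \<ge> K1" "a \<ge> 2" unfolding a_def by linarith+
  have "(\<lambda>N::nat. sqrt N * (1 / (real N - real a + 1))) \<longlonglongrightarrow> 0" by real_asymp
  then have E1: "eventually (\<lambda>N::nat. sqrt N * (1 / (real N - real a + 1)) < e / 2) sequentially"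
    using e by (intro order_tendstoD) auto
  have "filterlim (\<lambda>N::nat. sqrt N * (\<delta> * (real N - real a) / real N)) at_top sequentially"
    using dl by real_asymp
  then have E2: "eventually (\<lambda>N::nat. sqrt N * (\<delta> * (real N - real a) / real N) \<ge> \<nu>) sequentially"
    by (auto simp: filterlim_at_top)
  from E1 E2 obtain N1 where N1: "\<And>N. N \<ge> N1 \<Longrightarrow> sqrt N * (1 / (real N - real a + 1)) < e / 2 \<and>
      sqrt N * (\<delta> * (real N - real a) / real N) \<ge> \<nu>"
    unfolding eventually_sequentially by (metis nat_le_linear order_trans)
  define K where "K = max (max K1 1) (max (real a) (real N1))"
  have main: "dist (sqrt N * psum k N / ppsum k N) lam < e0"
      if N: "real N \<ge> K" and k: "real k \<ge> K * sqrt N" for k N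
  proof -
    have aN: "a \<le> N" "N1 \<le> N" using N by (auto simp: K_def)
    have sN: "sqrt N \<ge> 1" using aN a by simp
    have "K * sqrt N \<ge> 1 * 1" using sN by (intro mult_mono) (auto simp: K_def)
    then have k1: "1 \<le> k" using k by linarith
    \<comment> \<open>k \<ge> K sqrt N entails the same for every n \<le> N, so the forcing is
      controlled along the whole orbit from a to N with one fixed k.\<close>
    have rng: "c' / real n \<le> pairs k n / ppsum k n \<and> pairs k n / ppsum k n \<le> c / real n" if "a \<le> n" "n
        \<le> N" for n
    proof -
      have "K1 * sqrt n \<le> K * sqrt N" using that K1(1) by (intro mult_mono) (auto simp: K_def)
      then have "c' < real n * pairs k n / ppsum k n \<and> real n * pairs k n / ppsum k n < c"
        using that a k by (intro K1(2)) auto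
      moreover have "real n > 0" using that a by simp
      ultimately show ?thesis by (auto simp: field_simps)
    qed
    have B: "psum k N / ppsum k N \<le> \<mu> / sqrt N + 1 / (real N - real a + 1)"
       "psum k N / ppsum k N \<ge> min (\<nu> / sqrt N) (\<delta> * (real N - real a) / real N)"
      by (rule psum_ratio_bounds[where a = a and c = c and c' = c' and \<mu> = \<mu> and \<nu> = \<nu> and \<delta>
          = \<delta>, OF k1 _ aN(1) mn(1,2) dl];
          use a rng N0 in auto)+
    have "sqrt N * (psum k N / ppsum k N) \<le> sqrt N * (\<mu> / sqrt N + 1 / (real N - real a + 1))"
      using B(1) by (intro mult_left_mono) auto
    also have "\<dots> = \<mu> + sqrt N * (1 / (real N - real a + 1))" using sN by (simp add: distrib_left)
    also have "\<dots> < lam + e" using N1[OF aN(2), THEN conjunct1] unfolding \<mu>_def by linarith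
    finally have up: "sqrt N * (psum k N / ppsum k N) < lam + e" .
    have "\<nu> / sqrt N \<le> \<delta> * (real N - real a) / real N"
      using N1[OF aN(2)] sN by (simp add: divide_le_eq mult.commute)
    then have "\<nu> / sqrt N \<le> psum k N / ppsum k N" using B(2) by simp
    then have "sqrt N * (\<nu> / sqrt N) \<le> sqrt N * (psum k N / ppsum k N)" by (intro mult_left_mono) auto
    then have "\<nu> \<le> sqrt N * (psum k N / ppsum k N)" using sN by simp
    then show ?thesis using up e by (simp add: dist_real_def \<nu>_def abs_less_iff)
  qed
  show "eventually (\<lambda>x. dist (case x of (k, m) \<Rightarrow> sqrt m * psum k m / ppsum k m) lam < e0) wide"
    unfolding eventually_wide using main by (intro exI[of _ K]) (auto simp: K_def)
qed

lemma pairs_over_psum_tendsto: "((\<lambda>(k, m). sqrt m * pairs k m / psum k m) \<longlongrightarrow> lam) wide"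
proof -
  have "((\<lambda>x. (case x of (k, m) \<Rightarrow> real m * pairs k m / ppsum k m) / (case x of (k, m) \<Rightarrow> sqrt m * psum k m
      / ppsum k m)) \<longlongrightarrow> lam\<^sup>2 / lam) wide"
    using lam_pos by (intro tendsto_divide pairs_over_ppsum_tendsto psum_over_ppsum_tendsto) auto
  moreover have "eventually (\<lambda>x. (case x of (k, m) \<Rightarrow> real m * pairs k m / ppsum k m)
      / (case x of (k, m) \<Rightarrow> sqrt m * psum k m / ppsum k m)
      = (case x of (k, m) \<Rightarrow> sqrt m * pairs k m / psum k m)) wide"
    using eventually_wide_index
  proof eventually_elim
    case (elim x)
    obtain k m where x: "x = (k, m)" by (cases x)
    have "ppsum k m > 0" "psum k m > 0" "sqrt m > 0" using elim x by (auto intro: ppsum_pos psum_pos)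
    moreover have "real m = sqrt m * sqrt m" by simp
    ultimately show ?case unfolding x by (simp add: field_simps)
  qed
  ultimately have "((\<lambda>(k, m). sqrt m * pairs k m / psum k m) \<longlongrightarrow> lam\<^sup>2 / lam) wide"
    using Lim_transform_eventually by fast
  then show ?thesis using lam_pos by (simp add: power2_eq_square)
qed

section \<open>Exponential profile of the counts\<close>

lemma filterlim_wide_components:
  "filterlim snd at_top wide" "filterlim (\<lambda>(k, m). real k / sqrt (real m)) at_top wide"
proof -
  have c: "filterlim (\<lambda>(k, m). min (real m) (real k / sqrt (real m))) at_top wide"
    unfolding wide_def by (rule filterlim_filtercomap)
  show "filterlim (\<lambda>(k, m). real k / sqrt (real m)) at_top wide"
    by (rule filterlim_at_top_mono[OF c]) (auto intro!: always_eventually)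
  have "filterlim (\<lambda>x. real (snd x)) at_top wide"
    by (rule filterlim_at_top_mono[OF c]) (auto intro!: always_eventually)
  then show "filterlim snd at_top wide"
    by (simp add: filterlim_sequentially_iff_filterlim_real)
qed



text \<open>The increment of P is g itself, so P(m-1) = P(m)(1 - X) with X = g(m)/P(m), which is
  about lam / sqrt m, and -ln (1 - X) lies between X and X + 2X^2. The increments of g are not
  accessible in this way, hence the detour through P.\<close>

lemma psum_log_increment_tendsto:
  "((\<lambda>(k, m). sqrt m * (ln (psum k m) - ln (psum k (m - 1)))) \<longlongrightarrow> lam) wide"
proof -
  define X where "X = (\<lambda>x. pairs (fst x) (snd x) / psum (fst x) (snd x))"
  define S where "S = (\<lambda>x::nat \<times> nat. sqrt (real (snd x)))"
  define L where "L = (\<lambda>x. S x * (ln (psum (fst x) (snd x)) - ln (psum (fst x) (snd x - 1))))"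
  have S: "filterlim S at_top wide"
    unfolding S_def
    by (intro filterlim_compose[OF sqrt_at_top] filterlim_compose[OF filterlim_real_sequentially]
        filterlim_wide_components)
  have SX: "((\<lambda>x. S x * X x) \<longlongrightarrow> lam) wide"
    using pairs_over_psum_tendsto by (simp add: S_def X_def case_prod_unfold)
  have inv: "((\<lambda>x. inverse (S x)) \<longlongrightarrow> 0) wide"
    by (rule tendsto_inverse_0_at_top[OF S])
  have Spos: "eventually (\<lambda>x. S x \<ge> 1) wide"
    using S by (auto simp: filterlim_at_top)
  have "((\<lambda>x. S x * X x * inverse (S x)) \<longlongrightarrow> lam * 0) wide"
    by (intro tendsto_mult SX inv)
  moreover have "eventually (\<lambda>x. S x * X x * inverse (S x) = X x) wide"
    using Spos by eventually_elim (simp add: field_simps)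
  ultimately have X0: "(X \<longlongrightarrow> 0) wide"
    using Lim_transform_eventually by fastforce
  then have X2: "eventually (\<lambda>x. X x < 1 / 2) wide"
    by (rule order_tendstoD) simp
  have "(L \<longlongrightarrow> lam) wide"
  proof (rule tendsto_sandwich[OF _ _ SX])
    have "((\<lambda>x. S x * X x * (1 + 2 * X x)) \<longlongrightarrow> lam * (1 + 2 * 0)) wide"
      by (intro tendsto_intros SX X0)
    then show "((\<lambda>x. S x * X x * (1 + 2 * X x)) \<longlongrightarrow> lam) wide" by simp
    have both: "eventually (\<lambda>x. S x * X x \<le> L x \<and> L x \<le> S x * X x * (1 + 2 * X x)) wide"
      using eventually_wide_index X2
    proof eventually_elim
      case (elim x)
      obtain k m where x: "x = (k, m)" by (cases x)
      have k: "1 \<le> k" "1 \<le> m" using elim x by auto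
      then obtain m' where m': "m = Suc m'" by (cases m) auto
      have P: "psum k m > 0" "psum k m' > 0" by (auto intro: psum_pos k)
      have "psum k m = psum k m' + pairs k m" by (simp add: m' psum_def)
      then have e: "psum k m' = psum k m * (1 - X x)"
        using P(1) by (simp add: x X_def right_diff_distrib)
      have X1: "0 \<le> X x" using P by (simp add: x X_def pairs_nonneg)
      have "ln (psum k m') = ln (psum k m) + ln (1 - X x)"
        unfolding e using P elim X1 by (intro ln_mult_pos) auto
      then have L: "L x = S x * (- ln (1 - X x))" by (simp add: L_def x m')
      have "ln (1 - X x) \<le> - X x" using X1 elim by (intro ln_one_minus_pos_upper_bound) auto
      moreover have "- X x - 2 * (X x)\<^sup>2 \<le> ln (1 - X x)" using X1 elim
          by (intro ln_one_minus_pos_lower_bound) auto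
      moreover have "S x \<ge> 0" by (simp add: S_def)
      ultimately have "X x \<le> - ln (1 - X x)" "- ln (1 - X x) \<le> X x + 2 * (X x)\<^sup>2" "S x \<ge> 0" by linarith+
      then have "S x * X x \<le> S x * (- ln (1 - X x))" "S x * (- ln (1 - X x)) \<le> S x * (X x + 2 * (X x)\<^sup>2)"
        by (blast intro: mult_left_mono)+
      then show ?case unfolding L by (simp add: algebra_simps power2_eq_square)
    qed
    then show "eventually (\<lambda>x. S x * X x \<le> L x) wide" by (rule eventually_mono) simp
    from both show "eventually (\<lambda>x. L x \<le> S x * X x * (1 + 2 * X x)) wide" by (rule eventually_mono) simp
  qed
  then show ?thesis by (simp add: L_def S_def case_prod_unfold)
qed

lemma sum_increments_bounds:
  fixes f :: "nat \<Rightarrow> real"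
  assumes "\<And>j. j < s \<Longrightarrow> lo \<le> f (n + Suc j) - f (n + j) \<and> f (n + Suc j) - f (n + j) \<le> hi"
  shows "real s * lo \<le> f (n + s) - f n \<and> f (n + s) - f n \<le> real s * hi"
  using assms
proof (induction s)
  case (Suc s)
  have "real s * lo \<le> f (n + s) - f n \<and> f (n + s) - f n \<le> real s * hi"
    using Suc.prems by (intro Suc.IH) auto
  then show ?case using Suc.prems[of s] by (simp add: algebra_simps)
qed simp

context
  fixes F :: "'i filter" and k m s :: "'i \<Rightarrow> nat" and A :: real
  assumes W: "filterlim (\<lambda>i. (k i, m i)) wide F"
    and sA: "eventually (\<lambda>i. real (s i) \<le> A * sqrt (m i)) F"
begin

lemma shift_components:
  "filterlim (\<lambda>i. real (m i)) at_top F" "filterlim (\<lambda>i. real (m i - s i)) at_top F"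
  "((\<lambda>i. sqrt (m i) / sqrt (m i - s i)) \<longlongrightarrow> 1) F" "eventually (\<lambda>i. s i \<le> m i) F"
proof -
  show m: "filterlim (\<lambda>i. real (m i)) at_top F"
    using filterlim_compose[OF filterlim_compose[OF filterlim_real_sequentially filterlim_wide_components(1)] W]
        by simp
  have "filterlim (\<lambda>x. x - A * sqrt x) at_top at_top" by real_asymp
  then have mA: "filterlim (\<lambda>i. real (m i) - A * sqrt (m i)) at_top F"
    by (rule filterlim_compose[OF _ m])
  have pos: "eventually (\<lambda>i. real (m i) - A * sqrt (m i) > 0) F"
    using mA by (rule filterlim_at_top_eventually)
  show le: "eventually (\<lambda>i. s i \<le> m i) F"
    using pos sA by eventually_elim linarith
  show "filterlim (\<lambda>i. real (m i - s i)) at_top F"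
    by (rule filterlim_at_top_mono[OF mA]) (use sA le in eventually_elim, simp add: of_nat_diff)
  have "((\<lambda>x. sqrt x / sqrt (x - A * sqrt x)) \<longlongrightarrow> 1) at_top" by real_asymp
  then have up: "((\<lambda>i. sqrt (m i) / sqrt (real (m i) - A * sqrt (m i))) \<longlongrightarrow> 1) F"
    by (rule filterlim_compose[OF _ m])
  show "((\<lambda>i. sqrt (m i) / sqrt (m i - s i)) \<longlongrightarrow> 1) F"
  proof (rule tendsto_sandwich[OF _ _ tendsto_const up])
    show "eventually (\<lambda>i. 1 \<le> sqrt (m i) / sqrt (m i - s i)) F"
      using pos sA le
    proof eventually_elim
      case (elim i)
      then have "real (m i - s i) > 0" by (simp add: of_nat_diff)
      then show ?case by (simp add: le_divide_eq)
    qed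
    show "eventually (\<lambda>i. sqrt (m i) / sqrt (m i - s i) \<le> sqrt (m i) / sqrt (real (m i) - A * sqrt (m i))) F"
      using pos sA le
    proof eventually_elim
      case (elim i)
      then have "real (m i) - A * sqrt (m i) \<le> real (m i - s i)" by (simp add: of_nat_diff)
      with elim show ?case by (intro divide_left_mono mult_pos_pos) auto
    qed
  qed
qed

lemma shift_wide: "filterlim (\<lambda>i. (k i, m i - s i)) wide F"
proof (rule filterlim_wide)
  show "filterlim (\<lambda>i. m i - s i) at_top F"
    using shift_components(2) by (rule filterlim_nat_if_real)
  have k: "filterlim (\<lambda>i. real (k i) / sqrt (m i)) at_top F"
    using filterlim_compose[OF filterlim_wide_components(2) W] by simp
  have pos: "eventually (\<lambda>i. real (m i - s i) > 0) F"
    using shift_components(2) by (rule filterlim_at_top_eventually)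
  show "filterlim (\<lambda>i. real (k i) / sqrt (m i - s i)) at_top F"
    by (rule filterlim_at_top_mono[OF k]) (use pos in eventually_elim, auto intro!: divide_left_mono
        mult_pos_pos)
qed

text \<open>The difference is a sum of s increments, each close to lam / sqrt N with m-s < N \<le>
  m. As s = O(sqrt m), sqrt N is replaced by sqrt m at relative cost \<eta>, and at most B sqrt m
  increments add up to an error O(\<eta>).\<close>

lemma psum_log_shift:
  "((\<lambda>i. ln (psum (k i) (m i)) - ln (psum (k i) (m i - s i)) - lam * (s i / sqrt (m i))) \<longlongrightarrow> 0) F"
proof (rule tendstoI)
  fix e :: real assume e: "e > 0"
  define B where "B = max A 1"
  have B: "B \<ge> 1" "A \<le> B" by (auto simp: B_def)
  define \<eta> where "\<eta> = min (min 1 lam) (e / (2 * (B * (2 + lam))))"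
  have D: "B * (2 + lam) > 0" using B lam_pos by simp
  have \<eta>: "0 < \<eta>" "\<eta> \<le> 1" "\<eta> \<le> lam" using e D lam_pos by (auto simp: \<eta>_def)
  have "\<eta> \<le> e / (2 * (B * (2 + lam)))" by (simp add: \<eta>_def)
  then have \<eta>e: "B * (\<eta> * (2 + lam)) \<le> e / 2" using D by (simp add: field_simps)
  have "eventually (\<lambda>x. dist (case x of (k, m) \<Rightarrow> sqrt m * (ln (psum k m) - ln (psum k (m - 1)))) lam < \<eta>) wide"
    using psum_log_increment_tendsto \<eta>(1) by (rule tendstoD)
  then obtain K where K: "K > 0" "\<And>k m. real m \<ge> K \<Longrightarrow> real k \<ge> K * sqrt m \<Longrightarrow>
      \<bar>sqrt m * (ln (psum k m) - ln (psum k (m - 1))) - lam\<bar> < \<eta>"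
    unfolding eventually_wide by (auto simp: dist_real_def)
  have E1: "eventually (\<lambda>i. real (m i - s i) \<ge> K) F"
    using shift_components(2) by (auto simp: filterlim_at_top)
  have "filterlim (\<lambda>i. real (k i) / sqrt (m i)) at_top F"
    using filterlim_compose[OF filterlim_wide_components(2) W] by simp
  then have E2: "eventually (\<lambda>i. real (k i) / sqrt (m i) \<ge> K) F" by (auto simp: filterlim_at_top)
  have E3: "eventually (\<lambda>i. sqrt (m i) / sqrt (m i - s i) < 1 + \<eta>) F"
    using shift_components(3) by (rule order_tendstoD) (use \<eta> in simp)
  show "eventually (\<lambda>i. dist (ln (psum (k i) (m i)) - ln (psum (k i) (m i - s i)) - lam * (s i
      / sqrt (m i))) 0 < e) F"
    using E1 E2 E3 shift_components(4) sA
  proof eventually_elim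
    case (elim i)
    define n where "n = m i - s i"
    have n0: "real n > 0" using elim(1) K(1) by (simp add: n_def)
    have mi: "m i = n + s i" using elim(4) by (simp add: n_def)
    have m0: "sqrt (m i) > 0" using n0 mi by simp
    have kK: "real (k i) \<ge> K * sqrt (m i)" using elim(2) m0 by (simp add: pos_le_divide_eq)
    have inc: "(lam - \<eta>) / sqrt (m i) \<le> ln (psum (k i) (n + Suc j)) - ln (psum (k i) (n + j)) \<and>
               ln (psum (k i) (n + Suc j)) - ln (psum (k i) (n + j)) \<le> (lam + \<eta>) * (1 + \<eta>) / sqrt (m i)"
                   if "j < s i" for j
    proof -
      define N where "N = n + Suc j"
      define L where "L = ln (psum (k i) N) - ln (psum (k i) (N - 1))"
      have Nb: "n \<le> N" "N \<le> m i" "N - 1 = n + j" using that by (auto simp: N_def mi)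
      have N0: "sqrt N > 0" using Nb n0 by simp
      have "K * sqrt N \<le> K * sqrt (m i)" using Nb K(1) by (intro mult_left_mono) auto
      then have "\<bar>sqrt N * L - lam\<bar> < \<eta>"
        unfolding L_def using Nb elim(1) kK by (intro K(2)) (auto simp: n_def)
      then have "lam - \<eta> < sqrt N * L" "sqrt N * L < lam + \<eta>" by linarith+
      then have "(lam - \<eta>) / sqrt N \<le> L" "L \<le> (lam + \<eta>) / sqrt N"
        using N0 by (simp_all add: field_simps)
      moreover have "(lam - \<eta>) / sqrt (m i) \<le> (lam - \<eta>) / sqrt N"
        using Nb N0 m0 \<eta> by (intro divide_left_mono mult_pos_pos) auto
      moreover have "(lam + \<eta>) / sqrt N \<le> (lam + \<eta>) * (1 + \<eta>) / sqrt (m i)"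
      proof -
        have "sqrt (m i) \<le> (1 + \<eta>) * sqrt n" using elim(3) n0 by (simp add: n_def divide_less_eq)
        also have "\<dots> \<le> (1 + \<eta>) * sqrt N" using Nb \<eta> by (intro mult_left_mono) auto
        finally have "1 / sqrt N \<le> (1 + \<eta>) / sqrt (m i)" using N0 m0 by (simp add: field_simps)
        then have "(lam + \<eta>) * (1 / sqrt N) \<le> (lam + \<eta>) * ((1 + \<eta>) / sqrt (m i))"
          using \<eta> lam_pos by (intro mult_left_mono) auto
        then show ?thesis by simp
      qed
      ultimately show ?thesis unfolding L_def Nb(3) N_def[symmetric] by linarith
    qed
    define t where "t = s i / sqrt (m i)"
    have t: "0 \<le> t" "t \<le> B"
    proof -
      have "real (s i) \<le> B * sqrt (m i)" using elim(5) B m0 mult_right_mono[of A B "sqrt (m i)"] by linarith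
      then show "0 \<le> t" "t \<le> B" using m0 by (auto simp: t_def divide_le_eq)
    qed
    define R where "R = ln (psum (k i) (m i)) - ln (psum (k i) (m i - s i))"
    have "real (s i) * ((lam - \<eta>) / sqrt (m i)) \<le> R \<and> R \<le> real (s i) * ((lam + \<eta>) * (1 + \<eta>) / sqrt (m i))"
    proof -
      have "real (s i) * ((lam - \<eta>) / sqrt (m i)) \<le> ln (psum (k i) (n + s i)) - ln (psum (k i) n) \<and>
          ln (psum (k i) (n + s i)) - ln (psum (k i) n) \<le> real (s i) * ((lam + \<eta>) * (1 + \<eta>) / sqrt (m i))"
        by (rule sum_increments_bounds) (rule inc)
      then show ?thesis unfolding R_def n_def[symmetric] by (simp only: mi[symmetric])
    qed
    then have R: "t * (lam - \<eta>) \<le> R" "R \<le> t * ((lam + \<eta>) * (1 + \<eta>))" by (simp_all add: t_def)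
    have "R - lam * t \<le> t * (\<eta> * (1 + lam + \<eta>))" using R(2) by (simp add: algebra_simps)
    also have "\<dots> \<le> B * (\<eta> * (2 + lam))" using t \<eta> lam_pos by (intro mult_mono) auto
    finally have 1: "R - lam * t \<le> e / 2" using \<eta>e by linarith
    have "- (R - lam * t) \<le> t * \<eta>" using R(1) by (simp add: algebra_simps)
    also have "\<dots> \<le> B * (\<eta> * (2 + lam))" using t \<eta> lam_pos by (intro mult_mono) (auto simp: algebra_simps)
    finally have "\<bar>R - lam * t\<bar> \<le> e / 2" using 1 \<eta>e by linarith
    then show ?case using e by (simp add: dist_real_def R_def t_def)
  qed
qed

text \<open>Since g(m) = G(m) P(m) / sqrt m with G tending to lam, the ratio for P carries over to
  g: the quotient R of the ratio and the exponential E tends to 1. The claim is a difference because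
  s / sqrt m is merely bounded and need not converge.\<close>

lemma pairs_shift:
  "((\<lambda>i. pairs (k i) (m i - s i) / pairs (k i) (m i) - exp (- lam * (s i / sqrt (m i)))) \<longlongrightarrow> 0) F"
proof -
  define G where "G = (\<lambda>(k, m). sqrt m * pairs k m / psum k m)"
  define D where "D = (\<lambda>i. ln (psum (k i) (m i)) - ln (psum (k i) (m i - s i)) - lam * (s i / sqrt (m i)))"
  define R where "R = (\<lambda>i. G (k i, m i - s i) / G (k i, m i) * (sqrt (m i) / sqrt (m i - s i)) * exp (- D i))"
  define E where "E = (\<lambda>i. exp (- lam * (s i / sqrt (m i))))"
  have "(R \<longlongrightarrow> lam / lam * 1 * exp (- 0)) F"
    unfolding R_def using lam_pos
    by (intro tendsto_intros shift_components psum_log_shift[folded D_def]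
          filterlim_compose[OF pairs_over_psum_tendsto[folded G_def] W]
          filterlim_compose[OF pairs_over_psum_tendsto[folded G_def] shift_wide]) auto
  then have "((\<lambda>i. R i - 1) \<longlongrightarrow> 0) F" using lam_pos by (simp add: LIM_zero_iff)
  then have "((\<lambda>i. norm (R i - 1)) \<longlongrightarrow> 0) F" by (rule tendsto_norm_zero)
  moreover have "norm ((R i - 1) * E i) \<le> norm (R i - 1)" for i
    using lam_pos unfolding norm_mult by (intro mult_right_le_one_le) (auto simp: E_def)
  then have "eventually (\<lambda>i. norm ((R i - 1) * E i) \<le> norm (R i - 1)) F" by simp
  ultimately have "((\<lambda>i. (R i - 1) * E i) \<longlongrightarrow> 0) F"
    by (rule Lim_null_comparison[rotated])
  moreover have "eventually (\<lambda>i. (R i - 1) * E i = pairs (k i) (m i - s i) / pairs (k i) (m i) - E i) F"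
    using eventually_compose_filterlim[OF eventually_wide_index W]
          eventually_compose_filterlim[OF eventually_wide_index shift_wide]
  proof eventually_elim
    case (elim i)
    have k: "1 \<le> k i" and m: "1 \<le> m i" and ms: "1 \<le> m i - s i" using elim by auto
    define a where "a = psum (k i) (m i)"
    define b where "b = psum (k i) (m i - s i)"
    have ab: "a > 0" "b > 0" by (auto simp: a_def b_def intro: psum_pos k)
    have "exp (- D i) * E i = exp (ln b - ln a)"
      unfolding E_def D_def a_def b_def by (simp flip: exp_add)
    also have "\<dots> = b / a" using ab by (simp add: exp_diff)
    finally have DE: "exp (- D i) * E i = b / a" .
    have "pairs (k i) (m i) > 0" by (intro pairs_pos k)
    then have "G (k i, m i - s i) / G (k i, m i) * (sqrt (m i) / sqrt (m i - s i)) * (b / a)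
        = pairs (k i) (m i - s i) / pairs (k i) (m i)"
      using ab m ms by (simp add: G_def a_def[symmetric] b_def[symmetric] field_simps)
    moreover have "R i * E i = G (k i, m i - s i) / G (k i, m i) * (sqrt (m i) / sqrt (m i - s i))
        * (exp (- D i) * E i)"
      by (simp add: R_def)
    ultimately have "R i * E i = pairs (k i) (m i - s i) / pairs (k i) (m i)" unfolding DE by simp
    then show ?case by (simp add: left_diff_distrib)
  qed
  ultimately show ?thesis unfolding E_def by (rule Lim_transform_eventually)
qed

end

lemma pairs_decay_wide:
  "eventually (\<lambda>(k, m). 1 \<le> k \<and> 1 \<le> m \<and> (\<forall>s\<le>m. pairs k (m - s)
      \<le> 2 * exp (- real s / (5 * sqrt m)) * pairs k m)) wide"
proof -
  have "1 \<le> k \<and> 1 \<le> m \<and> (\<forall>s\<le>m. pairs k (m - s) \<le> 2 * exp (- real s / (5 * sqrt m)) * pairs k m)"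
    if "real m \<ge> 2" "real k \<ge> 2 * sqrt m" for k m
  proof -
    have "sqrt m \<ge> 1" using that by simp
    then have k: "1 \<le> k" "3 * sqrt m \<le> 2 * real k" using that(2) by linarith+
    moreover have "1 \<le> m" using that(1) by simp
    ultimately show ?thesis using pairs_decay by blast
  qed
  then show ?thesis unfolding eventually_wide by (intro exI[of _ 2]) auto
qed

text \<open>For s > A sqrt m both terms are small, by the a priori decay and by lam > 0. For s \<le>
  A sqrt m the limit is taken along a filter on triples ((k,m),s) that leaves s free in this range;
  holding eventually along it is uniformity in s.\<close>

lemma pairs_uniform:
  assumes e: "e > 0"
  shows "eventually (\<lambda>(k, m). \<forall>s\<le>m. \<bar>pairs k (m - s) - exp (- lam * (s / sqrt m)) * pairs k m\<bar>
      \<le> e * pairs k m) wide"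
proof -
  have "((\<lambda>A. exp (- l * A)) \<longlongrightarrow> 0) at_top" if "l > 0" for l :: real
    using that by real_asymp
  moreover have "((\<lambda>A::real. 2 * exp (- A / 5)) \<longlongrightarrow> 0) at_top" by real_asymp
  ultimately have "((\<lambda>A. 2 * exp (- A / 5) + exp (- lam * A)) \<longlongrightarrow> 0 + 0) at_top"
    using lam_pos by (intro tendsto_add)
  then have "((\<lambda>A. 2 * exp (- A / 5) + exp (- lam * A)) \<longlongrightarrow> 0) at_top" by simp
  then have "eventually (\<lambda>A. 2 * exp (- A / 5) + exp (- lam * A) < e) at_top"
    by (rule order_tendstoD) (rule e)
  then obtain A where A: "2 * exp (- A / 5) + exp (- lam * A) < e"
    by (meson eventually_happens trivial_limit_at_top_linorder)
  define F where "F = inf (filtercomap fst wide) (principal {((k::nat, m::nat), s::nat). real s \<le> A * sqrt m})"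
  have W: "filterlim (\<lambda>i. (fst (fst i), snd (fst i))) wide F"
    unfolding F_def using filterlim_mono[OF filterlim_filtercomap order_refl inf_le1] by simp
  have sA: "eventually (\<lambda>i. real (snd i) \<le> A * sqrt (snd (fst i))) F"
    unfolding F_def by (auto simp: eventually_inf_principal intro!: always_eventually)
  have "eventually (\<lambda>i. dist (pairs (fst (fst i)) (snd (fst i) - snd i) / pairs (fst (fst i)) (snd (fst i))
      - exp (- lam * (snd i / sqrt (snd (fst i))))) 0 < e) F"
    by (rule tendstoD[OF pairs_shift[OF W sA] e])
  then obtain P where P: "eventually P wide"
    and close: "\<And>k m s. P (k, m) \<Longrightarrow> real s \<le> A * sqrt m
        \<Longrightarrow> \<bar>pairs k (m - s) / pairs k m - exp (- lam * (s / sqrt m))\<bar> < e"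
    unfolding F_def eventually_inf_principal eventually_filtercomap by (fastforce simp: dist_real_def)
  from P pairs_decay_wide show ?thesis
  proof eventually_elim
    case (elim x)
    obtain k m where x: "x = (k, m)" by (cases x)
    have k: "1 \<le> k" and m: "1 \<le> m" using elim x by auto
    have p: "pairs k m > 0" by (intro pairs_pos k)
    have "\<bar>pairs k (m - s) - exp (- lam * (s / sqrt m)) * pairs k m\<bar> \<le> e * pairs k m" if s: "s \<le> m" for s
    proof (cases "real s \<le> A * sqrt m")
      case True
      have "\<bar>pairs k (m - s) / pairs k m - exp (- lam * (s / sqrt m))\<bar> * pairs k m \<le> e * pairs k m"
        using close[OF elim(1)[unfolded x] True] p by (intro mult_right_mono) auto
      moreover have "pairs k (m - s) - exp (- lam * (s / sqrt m)) * pairs k m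
          = (pairs k (m - s) / pairs k m - exp (- lam * (s / sqrt m))) * pairs k m"
        using p by (simp add: field_simps)
      ultimately show ?thesis using p by (simp only: abs_mult abs_of_pos)
    next
      case False
      have sm: "sqrt m > 0" using m by simp
      have t: "s / sqrt m \<ge> A" using False sm by (simp add: pos_le_divide_eq)
      have "pairs k (m - s) \<le> 2 * exp (- real s / (5 * sqrt m)) * pairs k m"
        using elim(2) s x by auto
      also have "- real s / (5 * sqrt m) = - (s / sqrt m) / 5" by simp
      also have "2 * exp (- (s / sqrt m) / 5) * pairs k m \<le> 2 * exp (- A / 5) * pairs k m"
        using t p by (intro mult_right_mono mult_left_mono) auto
      finally have 1: "pairs k (m - s) \<le> 2 * exp (- A / 5) * pairs k m" .
      have 2: "exp (- lam * (s / sqrt m)) * pairs k m \<le> exp (- lam * A) * pairs k m"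
      proof -
        have "lam * A \<le> lam * (s / sqrt m)" using t lam_pos by (intro mult_left_mono) auto
        then show ?thesis using p by (intro mult_right_mono) (auto simp only: mult_minus_left exp_le_cancel_iff
            neg_le_iff_le)
      qed
      have "\<bar>pairs k (m - s) - exp (- lam * (s / sqrt m)) * pairs k m\<bar>
          \<le> pairs k (m - s) + exp (- lam * (s / sqrt m)) * pairs k m"
        using pairs_nonneg[of k "m - s"] p by (intro order_trans[OF abs_triangle_ineq4]) simp
      also have "\<dots> \<le> (2 * exp (- A / 5) + exp (- lam * A)) * pairs k m"
        using 1 2 by (simp add: distrib_right)
      also have "\<dots> \<le> e * pairs k m" using A p by (intro mult_right_mono) auto
      finally show ?thesis .
    qed
    then show ?case unfolding x by simp
  qed
qed

section \<open>Rank generating function for a fixed peak\<close>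

text \<open>Reading coefficients downwards from m turns multiplication by X^d into the shift from s
  to s+d, and the value 0 beyond m lets recurrences hold for all s.\<close>

definition back_coeff :: "'a::zero fps \<Rightarrow> nat \<Rightarrow> nat \<Rightarrow> 'a" where
  "back_coeff f m s = (if s \<le> m then fps_nth f (m - s) else 0)"

text \<open>The product h satisfies (1 - z X^d) h = (1 - X^d) f, and coefficients at m-s are
  compared. The factor (1 - X^d) removes the unweighted copies of d from one side;
  \<open>geo z d\<close> puts back copies weighted by powers of z.\<close>

lemma back_coeff_recurrence:
  fixes f :: "'a::field fps"
  assumes "0 < d"
  shows "back_coeff ((1 - fps_X ^ d) * geo z d * f) m s - z * back_coeff ((1 - fps_X ^ d) * geo z d * f) m (s
      + d)
       = back_coeff f m s - back_coeff f m (s + d)"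
proof -
  define h where "h = (1 - fps_X ^ d) * geo z d * f"
  have "(1 - fps_const z * fps_X ^ d) * h = (1 - fps_X ^ d) * ((1 - fps_const z * fps_X ^ d) * geo z d) * f"
    unfolding h_def by (simp only: mult_ac)
  also have "\<dots> = (1 - fps_const 1 * fps_X ^ d) * f" by (simp add: geo_inverse[OF assms])
  finally have eq: "(1 - fps_const z * fps_X ^ d) * h = (1 - fps_const 1 * fps_X ^ d) * f" .
  have nth: "fps_nth ((1 - fps_const c * fps_X ^ d) * p) n
      = fps_nth p n - (if n < d then 0 else c * fps_nth p (n - d))" for c :: 'a and p n
    by (simp only: left_diff_distrib mult_1_left fps_sub_nth fps_const_X_power_mult_nth)
  have rec: "fps_nth h n - (if n < d then 0 else z * fps_nth h (n - d))
      = fps_nth f n - (if n < d then 0 else fps_nth f (n - d))" for n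
    using arg_cong[OF eq, of "\<lambda>p. fps_nth p n"] unfolding nth by simp
  show ?thesis
  proof (cases "s \<le> m")
    case True
    then have "s + d \<le> m \<longleftrightarrow> \<not> (m - s < d)" "m - (s + d) = m - s - d" by auto
    then show ?thesis using rec[of "m - s"] True unfolding h_def[symmetric] back_coeff_def by auto
  qed (auto simp: back_coeff_def)
qed

text \<open>Unrolling gives z-1 times a sum of values of E with unimodular coefficients, and a
  remainder tending to 0. It is applied to the difference of output and input of a twist: there z-1
  is of order 1/sqrt m and balances a geometric sum of order sqrt m.\<close>

lemma twisted_recursion_bound:
  fixes z :: complex and R E :: "nat \<Rightarrow> complex"
  assumes z: "cmod z = 1" and x: "0 < x"
    and rec: "\<And>s. R s = (z - 1) * E (s + d) + z * R (s + d)"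
    and E: "\<And>a. cmod (E (s + a * d)) \<le> b * exp (- real a * x)"
    and lim: "(\<lambda>n. R (s + n * d)) \<longlonglongrightarrow> 0"
    and b: "0 \<le> b"
  shows "cmod (R s) \<le> cmod (z - 1) * (b * (1 + 1 / x))"
proof -
  have step: "cmod (R s) \<le> cmod (z - 1) * (\<Sum>a\<le>n. b * exp (- real a * x)) + cmod (R (s + n * d))" for n
  proof (induction n)
    case 0
    then show ?case using b by simp
  next
    case (Suc n)
    have "R (s + n * d) = (z - 1) * E (s + Suc n * d) + z * R (s + Suc n * d)"
      using rec[of "s + n * d"] by (simp add: algebra_simps)
    then have "cmod (R (s + n * d)) \<le> cmod (z - 1) * cmod (E (s + Suc n * d)) + cmod (R (s + Suc n * d))"
      using norm_triangle_ineq[of "(z - 1) * E (s + Suc n * d)" "z * R (s + Suc n * d)"] z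
          by (simp add: norm_mult)
    also have "cmod (z - 1) * cmod (E (s + Suc n * d)) \<le> cmod (z - 1) * (b * exp (- real (Suc n) * x))"
      by (intro mult_left_mono E) auto
    finally show ?case using Suc.IH unfolding sum.atMost_Suc distrib_left by linarith
  qed
  have "cmod (R s) \<le> cmod (z - 1) * (b * (1 + 1 / x)) + cmod (R (s + n * d))" for n
  proof -
    have "(\<Sum>a\<le>n. b * exp (- real a * x)) = b * (\<Sum>a\<le>n. exp (- real a * x))" by (simp add: sum_distrib_left)
    also have "\<dots> \<le> b * (1 + 1 / x)" by (intro mult_left_mono geometric_exp_sum_le x b)
    finally have "cmod (z - 1) * (\<Sum>a\<le>n. b * exp (- real a * x)) \<le> cmod (z - 1) * (b * (1 + 1 / x))"
      by (intro mult_left_mono) auto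
    then show ?thesis using step[of n] by linarith
  qed
  moreover have "(\<lambda>n. cmod (z - 1) * (b * (1 + 1 / x)) + cmod (R (s + n * d)))
      \<longlonglongrightarrow> cmod (z - 1) * (b * (1 + 1 / x)) + 0"
    by (intro tendsto_intros tendsto_norm_zero lim)
  ultimately show ?thesis
    using LIMSEQ_le_const by fastforce
qed

lemma cmod_iexp_minus_1: "cmod (iexp x - 1) \<le> \<bar>x\<bar>"
  using iexp_approx1[of x 0] by simp

text \<open>Puts the profile exp(-lam s / sqrt m) below the majorant of rate 1/5, so that the error
  of a profile obeys a majorant of the same rate.\<close>

lemma lam_gt: "lam > 1/5"
proof -
  have "sqrt 6 < 3" by (rule real_less_lsqrt) auto
  moreover have "pi > 3" by (rule pi_gt3)
  ultimately show ?thesis by (simp add: lam_def divide_simps)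
qed

lemma sqrt_split:
  fixes e g B x S :: real
  assumes "0 \<le> B" "0 \<le> e"
  shows "(e * g) * (B * exp (- (x / (5 * S))) * g) = (sqrt (B * e) * exp (- (x / (10 * S))) * g)\<^sup>2"
proof -
  have 1: "- (x / (5 * S)) = 2 * (- (x / (10 * S)))" by simp
  have 2: "exp (- (x / (5 * S))) = (exp (- (x / (10 * S))))\<^sup>2" unfolding 1 by (rule exp_double)
  have 3: "(sqrt (B * e))\<^sup>2 = B * e" using assms by simp
  have 4: "(a * b * g)\<^sup>2 = a\<^sup>2 * b\<^sup>2 * (g * g)" for a b :: real by (simp add: power2_eq_square)
  show ?thesis unfolding 2 4 3 by (simp only: mult_ac)
qed

text \<open>
  The second clause says that \<open>f\<^sub>m\<^sub>-\<^sub>s\<close> is \<open>\<kappa> exp(-\<lambda>s/\<surd>m) g(m)\<close> uniformly in \<open>s\<close>; the first is the majorant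
  which keeps sums over \<open>s\<close> under control. The coefficients are extended by zero to \<open>s > m\<close>.
\<close>

definition exp_profile :: "'i filter \<Rightarrow> ('i \<Rightarrow> nat) \<Rightarrow> ('i \<Rightarrow> nat) \<Rightarrow> ('i \<Rightarrow> complex fps) \<Rightarrow> complex \<Rightarrow> bool" where
  "exp_profile F k m f \<kappa> \<longleftrightarrow>
     (\<exists>M\<ge>0. eventually (\<lambda>i. \<forall>s. cmod (back_coeff (f i) (m i) s)
         \<le> M * exp (- (real s / (5 * sqrt (m i)))) * pairs (k i) (m i)) F) \<and>
     (\<forall>e>0. eventually (\<lambda>i. \<forall>s. cmod (back_coeff (f i) (m i) s - \<kappa> * of_real (exp (- (lam * (real s
         / sqrt (m i)))) * pairs (k i) (m i))) \<le> e * pairs (k i) (m i)) F)"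

context
  fixes F :: "'i filter" and k m :: "'i \<Rightarrow> nat"
  assumes W: "filterlim (\<lambda>i. (k i, m i)) wide F"
begin

lemma wide_basic: "eventually (\<lambda>i. 1 \<le> k i \<and> 1 \<le> m i) F"
  using eventually_compose_filterlim[OF eventually_wide_index W] by simp

lemma wide_m: "filterlim (\<lambda>i. real (m i)) at_top F"
  using filterlim_compose[OF filterlim_compose[OF filterlim_real_sequentially filterlim_wide_components(1)] W]
      by simp

lemma wide_sqrt_m: "filterlim (\<lambda>i. sqrt (m i)) at_top F"
  by (rule filterlim_compose[OF sqrt_at_top wide_m])

lemma exp_profile_base: "exp_profile F k m (\<lambda>i. (odd_gf 1 (k i))\<^sup>2) 1"
proof -
  have nth: "fps_nth ((odd_gf (1::complex) l)\<^sup>2) n = of_real (pairs l n)" for l n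
  proof -
    have "fps_nth (odd_gf (1::complex) l) n = of_real (fps_nth (odd_gf (1::real) l) n)" for n
    proof (induction l arbitrary: n)
      case (Suc l)
      have "fps_nth (geo (1::complex) d) n = of_real (fps_nth (geo (1::real) d) n)" for d n
        by (simp add: geo_def)
      then show ?case unfolding odd_gf_Suc fps_mult_nth by (simp add: Suc.IH)
    qed (simp add: odd_gf_0)
    then show ?thesis unfolding pairs_def power2_eq_square fps_mult_nth by simp
  qed
  have D: "eventually (\<lambda>i. 1 \<le> k i \<and> 1 \<le> m i \<and> (\<forall>s\<le>m i. pairs (k i) (m i - s)
      \<le> 2 * exp (- real s / (5 * sqrt (m i))) * pairs (k i) (m i))) F"
    using eventually_compose_filterlim[OF pairs_decay_wide W] by simp
  have 1: "eventually (\<lambda>i. \<forall>s. cmod (back_coeff ((odd_gf 1 (k i))\<^sup>2) (m i) s)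
      \<le> 2 * exp (- (real s / (5 * sqrt (m i)))) * pairs (k i) (m i)) F"
    using D by eventually_elim (auto simp: back_coeff_def nth pairs_nonneg)
  have 2: "eventually (\<lambda>i. \<forall>s. cmod (back_coeff ((odd_gf 1 (k i))\<^sup>2) (m i) s - 1 * of_real (exp (- (lam
      * (real s / sqrt (m i)))) * pairs (k i) (m i))) \<le> e * pairs (k i) (m i)) F"
    if e: "e > 0" for e
  proof -
    have "((\<lambda>x. exp (- (l * x))) \<longlongrightarrow> 0) at_top" if "l > 0" for l :: real using that by real_asymp
    from filterlim_compose[OF this[OF lam_pos] wide_sqrt_m]
    have "eventually (\<lambda>i. exp (- (lam * sqrt (m i))) < e) F"
      by (rule order_tendstoD) (rule e)
    moreover have "eventually (\<lambda>i. \<forall>s\<le>m i. \<bar>pairs (k i) (m i - s) - exp (- lam * (s / sqrt (m i)))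
        * pairs (k i) (m i)\<bar> \<le> e * pairs (k i) (m i)) F"
      using eventually_compose_filterlim[OF pairs_uniform[OF e] W] by simp
    ultimately show ?thesis using wide_basic
    proof eventually_elim
      case (elim i)
      show ?case
      proof
        fix s
        let ?g = "pairs (k i) (m i)"
        show "cmod (back_coeff ((odd_gf 1 (k i))\<^sup>2) (m i) s - 1 * of_real (exp (- (lam * (real s / sqrt (m i))))
            * ?g)) \<le> e * ?g"
        proof (cases "s \<le> m i")
          case True
          have "back_coeff ((odd_gf 1 (k i))\<^sup>2) (m i) s - 1 * of_real (exp (- (lam * (real s / sqrt (m i))))
              * ?g)
              = complex_of_real (pairs (k i) (m i - s) - exp (- lam * (s / sqrt (m i))) * ?g)"
            using True by (simp add: back_coeff_def nth)
          then show ?thesis using elim(2) True by (simp only: norm_of_real)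
        next
          \<comment> \<open>Here the coefficient is 0, and s > m gives s / sqrt m \<ge> sqrt m, so
            the profile itself is already below e.\<close>
          case False
          have "sqrt (m i) = m i / sqrt (m i)" by (simp add: real_div_sqrt)
          also have "\<dots> \<le> s / sqrt (m i)" using False by (intro divide_right_mono) auto
          finally have "lam * sqrt (m i) \<le> lam * (s / sqrt (m i))" using lam_pos by (intro mult_left_mono) auto
          then have "exp (- (lam * (s / sqrt (m i)))) \<le> e" using elim(1) by (smt (verit) exp_le_cancel_iff)
          then have "exp (- (lam * (s / sqrt (m i)))) * ?g \<le> e * ?g" by (intro mult_right_mono pairs_nonneg)
          moreover have "cmod (back_coeff ((odd_gf 1 (k i))\<^sup>2) (m i) s - 1 * of_real (exp (- (lam * (real s
              / sqrt (m i)))) * ?g))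
              = exp (- (lam * (s / sqrt (m i)))) * ?g"
            using False pairs_nonneg[of "k i" "m i"] by (simp add: back_coeff_def norm_mult del: of_real_mult)
          ultimately show ?thesis by simp
        qed
      qed
    qed
  qed
  show ?thesis unfolding exp_profile_def using 1 2 by (intro conjI exI[of _ 2]) auto
qed

text \<open>The limit is the characteristic function at \<theta> of the exponential law of rate lam
  d. Multiplied by sqrt m, the quantities 1 - r and e^(i\<alpha>) - 1 tend to lam d and i\<theta>,
  and 1 - e^(i\<alpha>) r = (1 - r) - r (e^(i\<alpha>) - 1).\<close>

lemma twist_limit:
  fixes \<alpha> :: "'i \<Rightarrow> real"
  assumes \<alpha>: "((\<lambda>i. \<alpha> i * sqrt (m i)) \<longlongrightarrow> \<theta>) F" and d: "0 < d"
  defines "r \<equiv> \<lambda>i. exp (- (lam * (real d / sqrt (m i))))"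
  shows "((\<lambda>i. (1 - of_real (r i)) / (1 - iexp (\<alpha> i) * of_real (r i))) \<longlongrightarrow> of_real (lam * d) / (of_real (lam * d)
      - \<i> * of_real \<theta>)) F"
proof -
  define S where "S = (\<lambda>i. sqrt (m i))"
  have S: "filterlim S at_top F" unfolding S_def by (rule wide_sqrt_m)
  have "((\<lambda>x. x * (1 - exp (- (l * (real d / x))))) \<longlongrightarrow> l * d) at_top" if "l > 0" for l :: real
    using d that by real_asymp
  from filterlim_compose[OF this[OF lam_pos] S]
  have rS: "((\<lambda>i. S i * (1 - r i)) \<longlongrightarrow> lam * d) F" by (simp add: r_def S_def)
  have "((\<lambda>x. exp (- (l * (real d / x)))) \<longlongrightarrow> 1) at_top" if "l > 0" for l :: real
    using that by real_asymp
  from filterlim_compose[OF this[OF lam_pos] S]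
  have r1: "(r \<longlongrightarrow> 1) F" by (simp add: r_def S_def)
  have inv: "((\<lambda>i. inverse (S i)) \<longlongrightarrow> 0) F" by (rule tendsto_inverse_0_at_top[OF S])
  have zS: "((\<lambda>i. of_real (S i) * (iexp (\<alpha> i) - 1)) \<longlongrightarrow> \<i> * of_real \<theta>) F"
  proof -
    have "((\<lambda>i. (\<alpha> i * S i)\<^sup>2 * inverse (S i)) \<longlongrightarrow> \<theta>\<^sup>2 * 0) F"
      using \<alpha> by (intro tendsto_intros inv) (simp add: S_def)
    then have b0: "((\<lambda>i. (\<alpha> i * S i)\<^sup>2 * inverse (S i)) \<longlongrightarrow> 0) F" by simp
    have "((\<lambda>i. of_real (S i) * (iexp (\<alpha> i) - 1) - \<i> * of_real (\<alpha> i * S i)) \<longlongrightarrow> 0) F"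
    proof (rule Lim_null_comparison[OF _ b0])
      show "eventually (\<lambda>i. cmod (of_real (S i) * (iexp (\<alpha> i) - 1) - \<i> * of_real (\<alpha> i * S i))
          \<le> (\<alpha> i * S i)\<^sup>2 * inverse (S i)) F"
        using wide_basic
      proof eventually_elim
        case (elim i)
        have S0: "S i > 0" using elim by (simp add: S_def)
        have "cmod (iexp (\<alpha> i) - (1 + \<i> * of_real (\<alpha> i))) \<le> (\<alpha> i)\<^sup>2 / 2"
          using iexp_approx1[of "\<alpha> i" 1] by (simp add: power2_eq_square numeral_2_eq_2)
        also have "\<dots> \<le> (\<alpha> i)\<^sup>2" by simp
        finally have "S i * cmod (iexp (\<alpha> i) - (1 + \<i> * of_real (\<alpha> i))) \<le> S i * (\<alpha> i)\<^sup>2"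
          using S0 by (intro mult_left_mono) auto
        moreover have "of_real (S i) * (iexp (\<alpha> i) - 1) - \<i> * of_real (\<alpha> i * S i)
            = of_real (S i) * (iexp (\<alpha> i) - (1 + \<i> * of_real (\<alpha> i)))"
          by (simp add: algebra_simps)
        moreover have "(\<alpha> i * S i)\<^sup>2 * inverse (S i) = S i * (\<alpha> i)\<^sup>2" using S0
            by (simp add: power2_eq_square field_simps)
        ultimately show ?case using S0 by (simp only: norm_mult norm_of_real abs_of_pos)
      qed
    qed
    moreover have "((\<lambda>i. \<i> * of_real (\<alpha> i * S i)) \<longlongrightarrow> \<i> * of_real \<theta>) F"
      using \<alpha> unfolding S_def by (intro tendsto_intros)
    ultimately have "((\<lambda>i. (of_real (S i) * (iexp (\<alpha> i) - 1) - \<i> * of_real (\<alpha> i * S i)) + \<i> * of_real (\<alpha> i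
        * S i)) \<longlongrightarrow> 0 + \<i> * of_real \<theta>) F"
      by (rule tendsto_add)
    then show ?thesis by simp
  qed
  have nz: "of_real (lam * d) - 1 * (\<i> * of_real \<theta>) \<noteq> (0::complex)"
  proof
    assume "of_real (lam * d) - 1 * (\<i> * of_real \<theta>) = (0::complex)"
    then have "Re (of_real (lam * d) - 1 * (\<i> * of_real \<theta>)) = 0" by simp
    then show False using lam_pos d by simp
  qed
  have "((\<lambda>i. of_real (S i * (1 - r i)) / (of_real (S i * (1 - r i)) - of_real (r i) * (of_real (S i)
      * (iexp (\<alpha> i) - 1))))
      \<longlongrightarrow> of_real (lam * d) / (of_real (lam * d) - of_real 1 * (\<i> * of_real \<theta>))) F"
    using nz by (intro tendsto_divide tendsto_diff tendsto_mult tendsto_of_real rS r1 zS) simp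
  moreover have "eventually (\<lambda>i. of_real (S i * (1 - r i)) / (of_real (S i * (1 - r i)) - of_real (r i)
      * (of_real (S i) * (iexp (\<alpha> i) - 1)))
      = (1 - of_real (r i)) / (1 - iexp (\<alpha> i) * of_real (r i))) F"
    using wide_basic
  proof eventually_elim
    case (elim i)
    have S0: "complex_of_real (S i) \<noteq> 0" using elim by (simp add: S_def)
    have "of_real (S i * (1 - r i)) - of_real (r i) * (of_real (S i) * (iexp (\<alpha> i) - 1))
        = of_real (S i) * (1 - iexp (\<alpha> i) * of_real (r i))"
      by (simp add: algebra_simps)
    moreover have "of_real (S i * (1 - r i)) = complex_of_real (S i) * (1 - of_real (r i))" by simp
    ultimately show ?case using S0 by (simp only: mult_divide_mult_cancel_left not_False_eq_True)
  qed
  ultimately show ?thesis using Lim_transform_eventually by fastforce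
qed

text \<open>
  The error \<open>E\<close> of the profile of \<open>f\<close> is at most the geometric mean of its two bounds, \<open>e\<^sub>1 g\<close> and
  \<open>B exp(-s/(5\<surd>m)) g\<close>. This is small and still summable, as the recursion for the error \<open>D\<close> requires.
\<close>

lemma exp_profile_step:
  fixes \<alpha> :: "'i \<Rightarrow> real"
  assumes f: "exp_profile F k m f \<kappa>" and \<alpha>: "((\<lambda>i. \<alpha> i * sqrt (m i)) \<longlongrightarrow> \<theta>) F" and d: "0 < d"
  shows "exp_profile F k m (\<lambda>i. (1 - fps_X ^ d) * geo (iexp (\<alpha> i)) d * f i) (\<kappa> * (of_real (lam * d)
      / (of_real (lam * d) - \<i> * of_real \<theta>)))"
proof -
  define h where "h = (\<lambda>i. (1 - fps_X ^ d) * geo (iexp (\<alpha> i)) d * f i)"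
  define c where "c = of_real (lam * d) / (of_real (lam * d) - \<i> * of_real \<theta>)"
  define T where "T = \<bar>\<theta>\<bar> + 1"
  have T: "T > 0" by (simp add: T_def)
  obtain M where M: "M \<ge> 0" and fM: "eventually (\<lambda>i. \<forall>s. cmod (back_coeff (f i) (m i) s)
      \<le> M * exp (- (real s / (5 * sqrt (m i)))) * pairs (k i) (m i)) F"
    using f unfolding exp_profile_def by blast
  have fe: "eventually (\<lambda>i. \<forall>s. cmod (back_coeff (f i) (m i) s - \<kappa> * of_real (exp (- (lam * (real s
      / sqrt (m i)))) * pairs (k i) (m i))) \<le> e * pairs (k i) (m i)) F" if "e > 0" for e
    using f that unfolding exp_profile_def by blast
  have aT: "eventually (\<lambda>i. \<bar>\<alpha> i\<bar> * sqrt (m i) < T) F"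
  proof -
    have "((\<lambda>i. \<bar>\<alpha> i * sqrt (m i)\<bar>) \<longlongrightarrow> \<bar>\<theta>\<bar>) F" by (intro tendsto_intros \<alpha>)
    then have "eventually (\<lambda>i. \<bar>\<alpha> i * sqrt (m i)\<bar> < T) F" by (rule order_tendstoD) (simp add: T_def)
    then show ?thesis by (simp add: abs_mult)
  qed
  have z1: "cmod (iexp x) = 1" for x by simp
  have tail: "(\<lambda>n. back_coeff p q (s + n * d)) \<longlonglongrightarrow> 0" for p :: "complex fps" and q s
  proof (rule tendsto_eventually)
    show "eventually (\<lambda>n. back_coeff p q (s + n * d) = 0) sequentially"
      using eventually_gt_at_top[of q]
    proof eventually_elim
      case (elim n)
      have "n * 1 \<le> n * d" using d by (intro mult_left_mono) auto
      then have "q < s + n * d" using elim by linarith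
      then show ?case by (simp add: back_coeff_def)
    qed
  qed
  \<comment> \<open>6T arises since the geometric sum 1 + 5 sqrt m is at most 6 sqrt m and
    |\<alpha>| sqrt m < T.\<close>
  have first: "eventually (\<lambda>i. \<forall>s. cmod (back_coeff (h i) (m i) s)
      \<le> (M * (1 + 6 * T)) * exp (- (real s / (5 * sqrt (m i)))) * pairs (k i) (m i)) F"
    using fM aT wide_basic
  proof eventually_elim
    case (elim i)
    define S where "S = sqrt (m i)"
    define g where "g = pairs (k i) (m i)"
    have S1: "S \<ge> 1" using elim by (simp add: S_def)
    have g0: "g \<ge> 0" by (simp add: g_def pairs_nonneg)
    show ?case
    proof
      fix s
      define R where "R = (\<lambda>s. back_coeff (h i) (m i) s - back_coeff (f i) (m i) s)"
      have rec: "R s = (iexp (\<alpha> i) - 1) * back_coeff (f i) (m i) (s + d) + iexp (\<alpha> i) * R (s + d)" for s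
        using back_coeff_recurrence[OF d, of "iexp (\<alpha> i)" "f i" "m i" s] unfolding R_def h_def
            by (simp add: algebra_simps)
      have "cmod (R s) \<le> cmod (iexp (\<alpha> i) - 1) * ((M * exp (- (s / (5 * S))) * g) * (1 + 1 / (1 / (5 * S))))"
      proof (rule twisted_recursion_bound[where d = d and z = "iexp (\<alpha> i)" and R = R and E
          = "back_coeff (f i) (m i)", OF z1 _ rec])
        show "0 < 1 / (5 * S)" using S1 by simp
        show "cmod (back_coeff (f i) (m i) (s + a * d))
            \<le> M * exp (- (s / (5 * S))) * g * exp (- real a * (1 / (5 * S)))" for a
        proof -
          have "cmod (back_coeff (f i) (m i) (s + a * d)) \<le> M * exp (- (real (s + a * d) / (5 * S))) * g"
            using elim(1)[rule_format, of "s + a * d"] unfolding S_def g_def .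
          also have "\<dots> \<le> M * exp (- (s / (5 * S)) + - real a * (1 / (5 * S))) * g"
          proof -
            have "real a * 1 \<le> real a * real d" using d by (intro mult_left_mono) auto
            then have "real s + real a * 1 \<le> real (s + a * d)" by simp
            then have "(real s + real a * 1) / (5 * S) \<le> real (s + a * d) / (5 * S)" using S1
                by (intro divide_right_mono) auto
            then show ?thesis using M g0 by (intro mult_right_mono mult_left_mono) (auto simp:
                add_divide_distrib)
          qed
          also have "\<dots> = M * exp (- (s / (5 * S))) * g * exp (- real a * (1 / (5 * S)))"
            by (simp only: exp_add mult_ac)
          finally show ?thesis .
        qed
        show "(\<lambda>n. R (s + n * d)) \<longlonglongrightarrow> 0"
          unfolding R_def using tendsto_diff[OF tail tail] by simp
        show "0 \<le> M * exp (- (s / (5 * S))) * g" using M g0 by simp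
      qed
      also have "\<dots> \<le> \<bar>\<alpha> i\<bar> * ((M * exp (- (s / (5 * S))) * g) * (6 * S))"
        using cmod_iexp_minus_1[of "\<alpha> i"] S1 M g0 by (intro mult_mono) auto
      also have "\<dots> = (\<bar>\<alpha> i\<bar> * S) * (6 * (M * exp (- (s / (5 * S))) * g))" by simp
      also have "\<dots> \<le> T * (6 * (M * exp (- (s / (5 * S))) * g))"
        using elim(2) M g0 by (intro mult_right_mono) (auto simp: S_def)
      finally have "cmod (R s) \<le> T * (6 * (M * exp (- (s / (5 * S))) * g))" .
      moreover have "cmod (back_coeff (f i) (m i) s) \<le> M * exp (- (s / (5 * S))) * g"
        using elim(1) by (auto simp: S_def g_def)
      moreover have "back_coeff (h i) (m i) s = R s + back_coeff (f i) (m i) s" by (simp add: R_def)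
      ultimately have "cmod (back_coeff (h i) (m i) s)
          \<le> T * (6 * (M * exp (- (s / (5 * S))) * g)) + M * exp (- (s / (5 * S))) * g"
        using norm_triangle_ineq[of "R s" "back_coeff (f i) (m i) s"] by simp
      then show "cmod (back_coeff (h i) (m i) s)
          \<le> (M * (1 + 6 * T)) * exp (- (real s / (5 * sqrt (m i)))) * pairs (k i) (m i)"
        by (simp add: S_def g_def algebra_simps)
    qed
  qed
  have second: "eventually (\<lambda>i. \<forall>s. cmod (back_coeff (h i) (m i) s - \<kappa> * c * of_real (exp (- (lam * (real s
      / sqrt (m i)))) * pairs (k i) (m i))) \<le> e * pairs (k i) (m i)) F" if e: "e > 0" for e
  proof -
    define B where "B = M + cmod \<kappa> + 1"
    have B: "B \<ge> 1" using M by (simp add: B_def)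
    \<comment> \<open>33 = 3 * 11: the recursion bound below is |\<alpha>| sqrt m times 11 sqrt (B
      e1) g, and the second entry makes it at most e g / 3. The first entry bounds the error of f
      itself by e g / 3.\<close>
    define e1 where "e1 = min (e / 3) ((e / (33 * T))\<^sup>2 / B)"
    have e1: "e1 > 0" using e T B by (simp add: e1_def)
    have e1e: "e1 \<le> e / 3" unfolding e1_def by (rule min.cobounded1)
    have "B * e1 \<le> B * ((e / (33 * T))\<^sup>2 / B)" using B by (intro mult_left_mono) (auto simp: e1_def)
    then have "B * e1 \<le> (e / (33 * T))\<^sup>2" using B by simp
    then have sq: "sqrt (B * e1) \<le> e / (33 * T)" using e T by (intro real_le_lsqrt) auto
    \<comment> \<open>On an exact geometric profile, with ratio r per step d, the twist multiplies
      by this q. Comparing with \<kappa> q \<phi> instead of \<kappa> c \<phi> makes the recurrence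
      for the error exact; the limit c of q enters only at the end.\<close>
    define q where "q = (\<lambda>i. (1 - of_real (exp (- (lam * (real d / sqrt (m i)))))) / (1 - iexp (\<alpha> i)
        * of_real (exp (- (lam * (real d / sqrt (m i)))))))"
    have "((\<lambda>i. cmod (\<kappa> * q i - \<kappa> * c)) \<longlongrightarrow> cmod (\<kappa> * c - \<kappa> * c)) F"
      unfolding c_def q_def by (intro tendsto_intros twist_limit[OF \<alpha> d])
    then have qe: "eventually (\<lambda>i. cmod (\<kappa> * q i - \<kappa> * c) < e / 3) F"
      by (rule order_tendstoD) (use e in simp)
    show ?thesis using fe[OF e1] fM aT wide_basic qe
    proof eventually_elim
      case (elim i)
      define S where "S = sqrt (m i)"
      define g where "g = pairs (k i) (m i)"
      define z where "z = iexp (\<alpha> i)"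
      define r where "r = exp (- (lam * (real d / S)))"
      define \<phi> where "\<phi> = (\<lambda>s. complex_of_real (exp (- (lam * (real s / S))) * g))"
      define E where "E = (\<lambda>s. back_coeff (f i) (m i) s - \<kappa> * \<phi> s)"
      define D where "D = (\<lambda>s. back_coeff (h i) (m i) s - \<kappa> * q i * \<phi> s)"
      have S1: "S \<ge> 1" using elim by (simp add: S_def)
      have g0: "g \<ge> 0" by (simp add: g_def pairs_nonneg)
      have r: "0 < r" "r < 1" using lam_pos d S1 by (auto simp: r_def)
      have zr: "1 - z * of_real r \<noteq> 0"
      proof
        assume "1 - z * of_real r = 0"
        then have "cmod (z * of_real r) = 1" by simp
        then show False using r by (simp add: z_def norm_mult)
      qed
      have \<phi>d: "\<phi> (s + d) = of_real r * \<phi> s" for s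
      proof -
        have "exp (- (lam * (real (s + d) / S))) = r * exp (- (lam * (real s / S)))"
          unfolding r_def by (simp only: of_nat_add add_divide_distrib distrib_left minus_add_distrib exp_add
              mult.commute)
        then show ?thesis by (simp add: \<phi>_def)
      qed
      have qi: "q i * (1 - z * of_real r) = 1 - of_real r"
        using zr unfolding q_def z_def r_def S_def by simp
      have \<phi>0: "cmod (\<phi> s) \<le> exp (- (s / (5 * S))) * g" for s
      proof -
        have "1 / 5 * (real s / S) \<le> lam * (real s / S)" using lam_gt S1 by (intro mult_right_mono) auto
        then have "exp (- (lam * (real s / S))) \<le> exp (- (s / (5 * S)))" by simp
        then show ?thesis unfolding \<phi>_def using g0 by (simp add: norm_mult mult_right_mono del: of_real_mult)
      qed
      have Ebd: "cmod (E s) \<le> e1 * g" for s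
        using elim(1) by (auto simp: E_def \<phi>_def S_def g_def)
      have Ebd2: "cmod (E s) \<le> B * exp (- (s / (5 * S))) * g" for s
      proof -
        have "cmod (E s) \<le> cmod (back_coeff (f i) (m i) s) + cmod \<kappa> * cmod (\<phi> s)"
          unfolding E_def using norm_triangle_ineq4 by (metis norm_mult)
        also have "\<dots> \<le> M * exp (- (s / (5 * S))) * g + cmod \<kappa> * (exp (- (s / (5 * S))) * g)"
          using elim(2) \<phi>0 by (intro add_mono mult_left_mono) (auto simp: S_def g_def)
        also have "\<dots> \<le> B * exp (- (s / (5 * S))) * g" using g0 by (simp add: B_def algebra_simps)
        finally show ?thesis .
      qed
      have Esq: "cmod (E s) \<le> sqrt (B * e1) * exp (- (s / (10 * S))) * g" for s
      proof -
        have "(cmod (E s))\<^sup>2 \<le> (e1 * g) * (B * exp (- (s / (5 * S))) * g)"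
          unfolding power2_eq_square by (intro mult_mono Ebd Ebd2) (use e1 g0 in auto)
        also have "\<dots> = (sqrt (B * e1) * exp (- (s / (10 * S))) * g)\<^sup>2"
          using B e1 by (intro sqrt_split) auto
        finally have le: "(cmod (E s))\<^sup>2 \<le> (sqrt (B * e1) * exp (- (s / (10 * S))) * g)\<^sup>2" .
        have "0 \<le> sqrt (B * e1) * exp (- (s / (10 * S))) * g"
          using B e1 g0 by (intro mult_nonneg_nonneg real_sqrt_ge_zero exp_ge_zero) auto
        then show ?thesis by (rule power2_le_imp_le[OF le])
      qed
      define R where "R = (\<lambda>s. D s - E s)"
      have rec: "R s = (z - 1) * E (s + d) + z * R (s + d)" for s
      proof -
        have 1: "back_coeff (h i) (m i) s - z * back_coeff (h i) (m i) (s + d)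
            = back_coeff (f i) (m i) s - back_coeff (f i) (m i) (s + d)"
          unfolding h_def z_def by (rule back_coeff_recurrence[OF d])
        have 2: "q i * \<phi> s - z * (q i * (of_real r * \<phi> s)) = \<phi> s - of_real r * \<phi> s"
          using arg_cong[OF qi, of "\<lambda>x. x * \<phi> s"] by (simp add: algebra_simps)
        have "R s - z * R (s + d) - (z - 1) * E (s + d)
            = (back_coeff (h i) (m i) s - z * back_coeff (h i) (m i) (s + d)) - (back_coeff (f i) (m i) s
                - back_coeff (f i) (m i) (s + d))
              - \<kappa> * ((q i * \<phi> s - z * (q i * (of_real r * \<phi> s))) - (\<phi> s - of_real r * \<phi> s))"
          unfolding R_def D_def E_def \<phi>d by (simp add: algebra_simps)
        also have "\<dots> = 0" unfolding 1 2 by simp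
        finally show ?thesis by (simp add: algebra_simps)
      qed
      show ?case
      proof
        fix s
        have \<phi>lim: "(\<lambda>n. \<phi> (s + n * d)) \<longlonglongrightarrow> 0"
        proof -
          have "\<phi> (s + n * d) = of_real r ^ n * \<phi> s" for n
          proof (induction n)
            case (Suc n)
            have "s + Suc n * d = (s + n * d) + d" by simp
            then show ?case using Suc.IH by (simp only: \<phi>d) simp
          qed simp
          moreover have "(\<lambda>n. of_real r ^ n * \<phi> s) \<longlonglongrightarrow> 0 * \<phi> s"
            using r by (intro tendsto_intros LIMSEQ_power_zero) simp
          ultimately show ?thesis by simp
        qed
        have "cmod (R s) \<le> cmod (z - 1) * ((sqrt (B * e1) * g) * (1 + 1 / (1 / (10 * S))))"
        proof (rule twisted_recursion_bound[where d = d and z = z and R = R and E = E, OF _ _ rec])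
          show "cmod z = 1" by (simp add: z_def)
          show "0 < 1 / (10 * S)" using S1 by simp
          show "cmod (E (s + a * d)) \<le> sqrt (B * e1) * g * exp (- real a * (1 / (10 * S)))" for a
          proof -
            have "real a * 1 \<le> real a * real d" using d by (intro mult_left_mono) auto
            then have "real a * 1 \<le> real (s + a * d)" by simp
            then have "(real a * 1) / (10 * S) \<le> real (s + a * d) / (10 * S)" using S1
                by (intro divide_right_mono) auto
            then have "sqrt (B * e1) * exp (- (real (s + a * d) / (10 * S))) * g
                \<le> sqrt (B * e1) * exp (- real a * (1 / (10 * S))) * g"
              using B e1 g0 by (intro mult_right_mono mult_left_mono) auto
            then show ?thesis using Esq[of "s + a * d"] by (simp add: mult_ac)
          qed
          have "(\<lambda>n. (back_coeff (h i) (m i) (s + n * d) - \<kappa> * q i * \<phi> (s + n * d)) - (back_coeff (f i) (m i) (s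
              + n * d) - \<kappa> * \<phi> (s + n * d))) \<longlonglongrightarrow> (0 - \<kappa> * q i * 0) - (0 - \<kappa> * 0)"
            by (intro tendsto_intros tail \<phi>lim)
          then show "(\<lambda>n. R (s + n * d)) \<longlonglongrightarrow> 0" by (simp add: R_def D_def E_def)
          show "0 \<le> sqrt (B * e1) * g" using B e1 g0 by simp
        qed
        also have "\<dots> \<le> \<bar>\<alpha> i\<bar> * ((sqrt (B * e1) * g) * (11 * S))"
          using cmod_iexp_minus_1[of "\<alpha> i"] S1 B e1 g0 by (intro mult_mono) (auto simp: z_def)
        also have "\<dots> = (\<bar>\<alpha> i\<bar> * S) * (11 * (sqrt (B * e1) * g))" by simp
        also have "\<dots> \<le> T * (11 * ((e / (33 * T)) * g))"
          using elim(3) sq g0 T B e1 by (intro mult_mono mult_left_mono mult_right_mono) (auto simp: S_def)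
        also have "\<dots> = e / 3 * g" using T by simp
        finally have R: "cmod (R s) \<le> e / 3 * g" .
        have "cmod (E s) \<le> e / 3 * g" using Ebd[of s] mult_right_mono[OF e1e g0] by linarith
        then have "cmod (D s) \<le> e / 3 * g + e / 3 * g"
          using R norm_triangle_ineq[of "R s" "E s"] by (simp add: R_def)
        moreover have "cmod ((\<kappa> * q i - \<kappa> * c) * \<phi> s) \<le> e / 3 * g"
        proof -
          have "exp (- (s / (5 * S))) * g \<le> 1 * g" using g0 S1 by (intro mult_right_mono) auto
          then have "cmod (\<phi> s) \<le> g" using \<phi>0[of s] by simp
          then show ?thesis unfolding norm_mult using elim(5) e by (intro mult_mono) auto
        qed
        moreover have "back_coeff (h i) (m i) s - \<kappa> * c * \<phi> s = D s + (\<kappa> * q i - \<kappa> * c) * \<phi> s"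
          by (simp add: D_def algebra_simps)
        ultimately have "cmod (back_coeff (h i) (m i) s - \<kappa> * c * \<phi> s) \<le> e * g"
          using norm_triangle_ineq[of "D s" "(\<kappa> * q i - \<kappa> * c) * \<phi> s"] by simp
        then show "cmod (back_coeff (h i) (m i) s - \<kappa> * c * of_real (exp (- (lam * (real s / sqrt (m i))))
            * pairs (k i) (m i))) \<le> e * pairs (k i) (m i)"
          by (simp add: \<phi>_def S_def g_def)
      qed
    qed
  qed
  show ?thesis
    unfolding exp_profile_def h_def[symmetric] c_def[symmetric]
    using first second M T by (intro conjI exI[of _ "M * (1 + 6 * T)"]) auto
qed

end

text \<open>
  Only the multiplicities of the \<open>J\<close> smallest parts are weighted by the rank. For \<open>J = 0\<close> this counts
  pairs, for \<open>J = k\<close> it is the full rank generating function.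
\<close>

definition twist :: "real \<Rightarrow> nat \<Rightarrow> nat \<Rightarrow> complex fps" where
  "twist \<alpha> k J = (\<Prod>j<J. ((1 - fps_X ^ (2*j+1)) * geo (iexp (- \<alpha>)) (2*j+1)) * ((1 - fps_X ^ (2*j+1))
      * geo (iexp \<alpha>) (2*j+1))) * (odd_gf 1 k)\<^sup>2"

lemma twist_0: "twist \<alpha> k 0 = (odd_gf 1 k)\<^sup>2"
  by (simp add: twist_def)

lemma twist_Suc:
  "twist \<alpha> k (Suc J) = (1 - fps_X ^ (2*J+1)) * geo (iexp (- \<alpha>)) (2*J+1) * ((1 - fps_X ^ (2*J+1))
      * geo (iexp \<alpha>) (2*J+1) * twist \<alpha> k J)"
  unfolding twist_def prod.lessThan_Suc by (simp only: mult_ac)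

lemma twist_Suc_index: "twist \<alpha> (Suc k) J = geo 1 (2*k+1) * (geo 1 (2*k+1) * twist \<alpha> k J)"
  unfolding twist_def odd_gf_Suc power2_eq_square by (simp only: mult_ac)

lemma geo_one_inverse: "0 < d \<Longrightarrow> (1 - fps_X ^ d) * geo 1 d = 1"
  using geo_inverse[of d 1] by simp

lemma twist_full: "twist \<alpha> k k = odd_gf (iexp \<alpha>) k * odd_gf (iexp (- \<alpha>)) k"
proof (induction k)
  case 0
  then show ?case by (simp add: twist_def odd_gf_0)
next
  case (Suc k)
  let ?d = "2*k+1"
  let ?y = "fps_X ^ ?d :: complex fps"
  have i: "(1 - ?y) * geo 1 ?d = 1" by (rule geo_one_inverse) simp
  have "twist \<alpha> (Suc k) (Suc k) = ((1 - ?y) * geo 1 ?d) * ((1 - ?y) * geo 1 ?d) * (geo (iexp (- \<alpha>)) ?d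
      * geo (iexp \<alpha>) ?d * twist \<alpha> k k)"
    unfolding twist_Suc twist_Suc_index by (simp only: mult_ac)
  also have "\<dots> = geo (iexp (- \<alpha>)) ?d * geo (iexp \<alpha>) ?d * (odd_gf (iexp \<alpha>) k * odd_gf (iexp (- \<alpha>)) k)"
    unfolding i Suc.IH by simp
  finally show ?case unfolding odd_gf_Suc by (simp only: mult_ac)
qed

section \<open>Coefficient majorants and the tail of the product\<close>

lemma majorant_mult:
  fixes f g :: "complex fps" and f' g' :: "real fps"
  assumes "\<And>n. cmod (fps_nth f n) \<le> fps_nth f' n" "\<And>n. cmod (fps_nth g n) \<le> fps_nth g' n"
  shows "cmod (fps_nth (f * g) n) \<le> fps_nth (f' * g') n"
proof -
  have "cmod (fps_nth (f * g) n) \<le> (\<Sum>i=0..n. cmod (fps_nth f i) * cmod (fps_nth g (n - i)))"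
    unfolding fps_mult_nth by (rule order_trans[OF norm_sum]) (simp add: norm_mult)
  also have "\<dots> \<le> (\<Sum>i=0..n. fps_nth f' i * fps_nth g' (n - i))"
    by (intro sum_mono mult_mono assms order_trans[OF norm_ge_zero assms(1)]) auto
  finally show ?thesis by (simp add: fps_mult_nth)
qed

lemma majorant_geo: "cmod z \<le> 1 \<Longrightarrow> cmod (fps_nth (geo z d) n) \<le> fps_nth (geo 1 d) n"
  by (auto simp: geo_def norm_power power_le_one)

lemma majorant_odd_gf:
  assumes "cmod z \<le> 1"
  shows "cmod (fps_nth (odd_gf z k) n) \<le> fps_nth (odd_gf 1 k) n"
proof (induction k arbitrary: n)
  case (Suc k)
  show ?case unfolding odd_gf_Suc by (intro majorant_mult majorant_geo assms Suc.IH)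
qed (simp add: odd_gf_0)

text \<open>The factors 1 - X^d have a negative coefficient, so factorwise majorants are too weak.
  The induction starts at k = J, where these factors have cancelled and only weights of modulus 1
  remain; each further index adds two nonnegative factors.\<close>

lemma majorant_twist:
  assumes "J \<le> k"
  shows "cmod (fps_nth (twist \<alpha> k J) n) \<le> pairs k n"
  using assms
proof (induction k arbitrary: n rule: dec_induct)
  case base
  show ?case unfolding twist_full pairs_def power2_eq_square
    by (intro majorant_mult majorant_odd_gf) auto
next
  case (step k)
  have "cmod (fps_nth (twist \<alpha> k J) n) \<le> fps_nth ((odd_gf 1 k)\<^sup>2) n" for n
    using step.IH by (simp add: pairs_def)
  then show ?case unfolding twist_Suc_index pairs_Suc
    by (intro majorant_mult majorant_geo) auto
qed

text \<open>With y = d / (5 sqrt m) the decay bound turns the coefficient into a double geometric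
  sum, at most 2 e^(-y) (1 + 1/y)^2 g(m). The factor e^(-y), due to the shift by d, keeps this below
  4/y^2 for large y too; 4/y^2 = 100 m / d^2.\<close>

lemma geo_geo_pairs_bound:
  assumes m: "1 \<le> m" "d \<le> m" and d: "0 < d"
    and dec: "\<And>s. s \<le> m \<Longrightarrow> pairs k (m - s) \<le> 2 * exp (- real s / (5 * sqrt m)) * pairs k m"
  shows "fps_nth (geo 1 d * (geo 1 d * (odd_gf 1 k)\<^sup>2)) (m - d) \<le> 100 * real m / (real d)\<^sup>2 * pairs k m"
proof -
  define y where "y = real d / (5 * sqrt m)"
  define g where "g = pairs k m"
  define e where "e = (\<lambda>n. \<Sum>a\<le>n. exp (- real a * y))"
  have y: "y > 0" using m d by (simp add: y_def)
  have g0: "g \<ge> 0" by (simp add: g_def pairs_nonneg)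
  have e: "e n \<le> 1 + 1 / y" for n
    unfolding e_def by (rule geometric_exp_sum_le[OF y])
  have summand: "pairs k (m - d - a * d - b * d) \<le> 2 * exp (- y) * g * exp (- real a * y) * exp (- real b * y)"
    if "a \<le> (m - d) div d" "b \<le> (m - d - a * d) div d" for a b
  proof -
    have "a * d \<le> m - d" using that(1) by (metis div_times_less_eq_dividend le_trans mult_le_mono1)
    moreover have "b * d \<le> m - d - a * d" using that(2)
        by (metis div_times_less_eq_dividend le_trans mult_le_mono1)
    ultimately have le: "d + a * d + b * d \<le> m" using m(2) by linarith
    have "m - d - a * d - b * d = m - (d + a * d + b * d)" by simp
    then have "pairs k (m - d - a * d - b * d) \<le> 2 * exp (- real (d + a * d + b * d) / (5 * sqrt m)) * g"
      using dec[OF le] by (simp add: g_def)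
    also have "- real (d + a * d + b * d) / (5 * sqrt m) = - y + - real a * y + - real b * y"
      by (simp add: y_def add_divide_distrib diff_divide_distrib)
    finally show ?thesis by (simp only: exp_add mult_ac)
  qed
  have "fps_nth (geo 1 d * (geo 1 d * (odd_gf 1 k)\<^sup>2)) (m - d)
      = (\<Sum>a\<le>(m - d) div d. \<Sum>b\<le>(m - d - a * d) div d. pairs k (m - d - a * d - b * d))"
    by (simp add: geo_mult_nth_sum[OF d] pairs_def)
  also have "\<dots> \<le> (\<Sum>a\<le>(m - d) div d. \<Sum>b\<le>(m - d - a * d) div d. 2 * exp (- y) * g * exp (- real a * y)
      * exp (- real b * y))"
    by (intro sum_mono summand) auto
  also have "\<dots> = (\<Sum>a\<le>(m - d) div d. 2 * exp (- y) * g * exp (- real a * y) * e ((m - d - a * d) div d))"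
    by (simp add: e_def sum_distrib_left)
  also have "\<dots> \<le> (\<Sum>a\<le>(m - d) div d. 2 * exp (- y) * g * exp (- real a * y) * (1 + 1 / y))"
    by (intro sum_mono mult_left_mono e) (use g0 in auto)
  also have "\<dots> = 2 * exp (- y) * g * e ((m - d) div d) * (1 + 1 / y)"
    by (simp add: e_def sum_distrib_left sum_distrib_right)
  also have "\<dots> \<le> 2 * exp (- y) * g * (1 + 1 / y) * (1 + 1 / y)"
    by (intro mult_right_mono mult_left_mono e) (use g0 y in auto)
  also have "\<dots> = 2 * g * (exp (- y) * (1 + 1 / y)\<^sup>2)" by (simp add: power2_eq_square)
  also have "\<dots> \<le> 2 * g * (2 / y\<^sup>2)"
  proof (intro mult_left_mono)
    have ey: "1 + y + y\<^sup>2 / 2 \<le> exp y" using exp_lower_Taylor_quadratic[of y] y by simp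
    have "(1 + y)\<^sup>2 \<le> 2 * (1 + y + y\<^sup>2 / 2)" by (simp add: power2_eq_square algebra_simps)
    also have "\<dots> \<le> 2 * exp y" using ey by simp
    finally have "exp (- y) * (1 + y)\<^sup>2 \<le> exp (- y) * (2 * exp y)" by (intro mult_left_mono) auto
    also have "\<dots> = 2" by (simp add: exp_minus)
    finally have "exp (- y) * (1 + y)\<^sup>2 / y\<^sup>2 \<le> 2 / y\<^sup>2" by (intro divide_right_mono) auto
    moreover have "(1 + 1 / y)\<^sup>2 = (1 + y)\<^sup>2 / y\<^sup>2" using y
        by (simp add: power_divide[symmetric] add_divide_distrib)
    ultimately show "exp (- y) * (1 + 1 / y)\<^sup>2 \<le> 2 / y\<^sup>2" by simp
  qed (use g0 in auto)
  also have "\<dots> = 100 * real m / (real d)\<^sup>2 * g"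
    using m d by (simp add: y_def power_divide power_mult_distrib)
  finally show ?thesis by (simp add: g_def)
qed

text \<open>The weights on the two sides are conjugate, so the terms linear in \<alpha> cancel: (1 -
  y)^2 - (1 - w y)(1 - w' y) = -(2 - w - w') y, and 2 - w - w' = (w - 1)(w' - 1) has modulus at most
  \<alpha>^2. Together with the factor 1/d^2 this makes the increments summable over J.\<close>

lemma twist_increment:
  assumes J: "J < k" and m: "1 \<le> m"
    and dec: "\<And>s. s \<le> m \<Longrightarrow> pairs k (m - s) \<le> 2 * exp (- real s / (5 * sqrt m)) * pairs k m"
  shows "cmod (fps_nth (twist \<alpha> k (Suc J)) m - fps_nth (twist \<alpha> k J) m)
      \<le> \<alpha>\<^sup>2 * (100 * real m / (real (2*J+1))\<^sup>2 * pairs k m)"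
proof -
  define d where "d = 2 * J + 1"
  define w where "w = iexp \<alpha>"
  define w' where "w' = iexp (- \<alpha>)"
  define a where "a = geo w d"
  define b where "b = geo w' d"
  define y :: "complex fps" where "y = fps_X ^ d"
  define C where "C = twist \<alpha> k J"
  have d: "0 < d" by (simp add: d_def)
  have ww: "w * w' = 1" by (simp add: w_def w'_def exp_add[symmetric])
  have wc: "fps_const w * fps_const w' = 1" by (simp only: fps_const_mult ww fps_const_1_eq_1)
  have ia: "(1 - fps_const w * y) * a = 1" and ib: "(1 - fps_const w' * y) * b = 1"
    unfolding a_def b_def y_def by (rule geo_inverse[OF d])+
  have "C = ((1 - fps_const w * y) * a) * ((1 - fps_const w' * y) * b) * C" by (simp add: ia ib)
  also have "\<dots> = ((1 - fps_const w * y) * (1 - fps_const w' * y)) * (b * (a * C))" by (simp only: mult_ac)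
  finally have C: "C = ((1 - fps_const w * y) * (1 - fps_const w' * y)) * (b * (a * C))" .
  have S: "twist \<alpha> k (Suc J) = ((1 - y) * (1 - y)) * (b * (a * C))"
    unfolding twist_Suc d_def[symmetric] y_def a_def b_def w_def w'_def C_def by (simp only: mult_ac)
  have poly: "(1 - y) * (1 - y) - (1 - fps_const w * y) * (1 - fps_const w' * y)
      = - (2 - fps_const w - fps_const w') * y"
  proof -
    have "(1 - y) * (1 - y) - (1 - p * y) * (1 - q * y)
        = - (2 - p - q) * y + (1 - p * q) * y * y" for p q :: "complex fps"
      by (simp add: algebra_simps)
    from this[of "fps_const w" "fps_const w'"] show ?thesis by (simp only: wc) simp
  qed
  have "twist \<alpha> k (Suc J) - C = ((1 - y) * (1 - y) - (1 - fps_const w * y) * (1 - fps_const w' * y)) * (b * (a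
      * C))"
    unfolding S by (subst (2) C) (simp only: left_diff_distrib)
  also have "\<dots> = fps_const (- (2 - w - w')) * y * (b * (a * C))"
    unfolding poly by (simp flip: fps_const_neg fps_const_sub fps_numeral_fps_const)
  finally have diff: "fps_nth (twist \<alpha> k (Suc J)) m - fps_nth C m
      = (if m < d then 0 else - (2 - w - w') * fps_nth (b * (a * C)) (m - d))"
    unfolding y_def by (metis fps_sub_nth fps_const_X_power_mult_nth)
  have "2 - w - w' = (w - 1) * (w' - 1)" using ww by (simp add: algebra_simps)
  then have "cmod (2 - w - w') = cmod (w - 1) * cmod (w' - 1)" by (simp add: norm_mult)
  also have "\<dots> \<le> \<bar>\<alpha>\<bar> * \<bar>- \<alpha>\<bar>"
    unfolding w_def w'_def by (intro mult_mono cmod_iexp_minus_1) auto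
  finally have c: "cmod (- (2 - w - w')) \<le> \<alpha>\<^sup>2"
      by (simp add: power2_eq_square norm_minus_commute flip: abs_mult)
  show ?thesis
  proof (cases "m < d")
    case True
    then show ?thesis using diff pairs_nonneg[of k m] by (simp add: C_def)
  next
    case False
    have "cmod (fps_nth C n) \<le> fps_nth ((odd_gf 1 k)\<^sup>2) n" for n
      using majorant_twist[of J k \<alpha> n] J by (simp add: C_def pairs_def)
    then have "cmod (fps_nth (b * (a * C)) (m - d)) \<le> fps_nth (geo 1 d * (geo 1 d * (odd_gf 1 k)\<^sup>2)) (m - d)"
      unfolding a_def b_def by (intro majorant_mult majorant_geo) (auto simp: w_def w'_def)
    also have "\<dots> \<le> 100 * real m / (real d)\<^sup>2 * pairs k m"
      using False by (intro geo_geo_pairs_bound m d dec) auto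
    finally have "cmod (fps_nth (b * (a * C)) (m - d)) \<le> 100 * real m / (real d)\<^sup>2 * pairs k m" .
    then have "cmod (- (2 - w - w')) * cmod (fps_nth (b * (a * C)) (m - d))
        \<le> \<alpha>\<^sup>2 * (100 * real m / (real d)\<^sup>2 * pairs k m)"
      using c by (intro mult_mono) auto
    moreover have "fps_nth (twist \<alpha> k (Suc J)) m - fps_nth (twist \<alpha> k J) m
        = - (2 - w - w') * fps_nth (b * (a * C)) (m - d)"
      using diff False by (simp add: C_def)
    ultimately show ?thesis by (simp only: norm_mult d_def)
  qed
qed

lemma sum_odd_square_tail:
  assumes "1 \<le> J" "J \<le> k"
  shows "(\<Sum>j=J..<k. 1 / (real (2*j+1))\<^sup>2) \<le> 1 / real J - 1 / real k"
  using assms(2)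
proof (induction k rule: dec_induct)
  case (step k)
  have k: "real k \<ge> 1" using step.hyps assms by simp
  have "1 / (real (2*k+1))\<^sup>2 \<le> 1 / (real k * real (Suc k))"
    using k by (intro divide_left_mono) (auto simp: power2_eq_square algebra_simps intro!: mult_pos_pos
        add_pos_pos)
  also have "\<dots> = 1 / real k - 1 / real (Suc k)" using k by (simp add: field_simps)
  finally show ?case using step by simp
qed simp

text \<open>Telescoping over the index. As \<alpha>^2 m stays bounded in the application, the parts
  from the J-th on contribute O(1/J), which justifies passing to an infinite product.\<close>

lemma twist_tail:
  assumes J: "1 \<le> J" "J \<le> k" and m: "1 \<le> m"
    and dec: "\<And>s. s \<le> m \<Longrightarrow> pairs k (m - s) \<le> 2 * exp (- real s / (5 * sqrt m)) * pairs k m"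
  shows "cmod (fps_nth (twist \<alpha> k k) m - fps_nth (twist \<alpha> k J) m) \<le> 100 * (\<alpha>\<^sup>2 * real m) / real J * pairs k m"
proof -
  have "fps_nth (twist \<alpha> k k) m - fps_nth (twist \<alpha> k J) m
      = (\<Sum>j=J..<k. fps_nth (twist \<alpha> k (Suc j)) m - fps_nth (twist \<alpha> k j) m)"
    using J(2) by (rule sum_Suc_diff'[symmetric])
  also have "cmod \<dots> \<le> (\<Sum>j=J..<k. \<alpha>\<^sup>2 * (100 * real m / (real (2*j+1))\<^sup>2 * pairs k m))"
    by (intro sum_norm_le twist_increment m dec) auto
  also have "\<dots> = 100 * (\<alpha>\<^sup>2 * real m) * pairs k m * (\<Sum>j=J..<k. 1 / (real (2*j+1))\<^sup>2)"
    unfolding sum_distrib_left by (intro sum.cong) auto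
  also have "\<dots> \<le> 100 * (\<alpha>\<^sup>2 * real m) * pairs k m * (1 / real J)"
    using sum_odd_square_tail[OF J] by (intro mult_left_mono) (auto intro: order_trans simp: pairs_nonneg)
  finally show ?thesis by simp
qed

text \<open>The exponential factors for \<theta> and -\<theta>, one for each side, multiply to 1 /
  (1 + (\<theta>/lam)^2 / d^2) with d = 2J+1.\<close>

lemma exp_profile_twist:
  fixes \<alpha> :: "'i \<Rightarrow> real"
  assumes W: "filterlim (\<lambda>i. (k i, m i)) wide F" and \<alpha>: "((\<lambda>i. \<alpha> i * sqrt (m i)) \<longlongrightarrow> \<theta>) F"
  shows "exp_profile F k m (\<lambda>i. twist (\<alpha> i) (k i) J) (of_real (1 / (\<Prod>j<J. 1 + (\<theta> / lam)\<^sup>2 / (2 * real j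
      + 1)\<^sup>2)))"
proof (induction J)
  case 0
  show ?case using exp_profile_base[OF W] by (simp add: twist_0)
next
  case (Suc J)
  define d where "d = 2 * J + 1"
  have d: "0 < d" by (simp add: d_def)
  define P where "P = (\<Prod>j<J. 1 + (\<theta> / lam)\<^sup>2 / (2 * real j + 1)\<^sup>2)"
  have \<alpha>': "((\<lambda>i. - \<alpha> i * sqrt (m i)) \<longlongrightarrow> - \<theta>) F" using tendsto_minus[OF \<alpha>] by simp
  have "exp_profile F k m (\<lambda>i. twist (\<alpha> i) (k i) (Suc J))
      (of_real (1 / P) * (of_real (lam * d) / (of_real (lam * d) - \<i> * of_real \<theta>)) * (of_real (lam * d)
          / (of_real (lam * d) - \<i> * of_real (- \<theta>))))"
    unfolding twist_Suc d_def[symmetric] P_def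
        by (intro exp_profile_step[OF W _ \<alpha>' d] exp_profile_step[OF W _ \<alpha> d] Suc.IH)
  also have "of_real (1 / P) * (of_real (lam * d) / (of_real (lam * d) - \<i> * of_real \<theta>)) * (of_real (lam * d)
      / (of_real (lam * d) - \<i> * of_real (- \<theta>)))
      = complex_of_real (1 / (P * (1 + (\<theta> / lam)\<^sup>2 / (2 * real J + 1)\<^sup>2)))"
  proof -
    have L: "lam * d > 0" using lam_pos d by simp
    have "(of_real (lam * d) - \<i> * of_real \<theta>) * (of_real (lam * d) - \<i> * of_real (- \<theta>))
        = complex_of_real ((lam * d)\<^sup>2 + \<theta>\<^sup>2)"
      by (simp add: algebra_simps power2_eq_square)
    then have "(of_real (lam * d) / (of_real (lam * d) - \<i> * of_real \<theta>)) * (of_real (lam * d) / (of_real (lam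
        * d) - \<i> * of_real (- \<theta>)))
       = complex_of_real ((lam * d)\<^sup>2 / ((lam * d)\<^sup>2 + \<theta>\<^sup>2))"
      by (simp only: times_divide_times_eq of_real_divide of_real_mult power2_eq_square)
    also have "(lam * d)\<^sup>2 / ((lam * d)\<^sup>2 + \<theta>\<^sup>2) = 1 / (((lam * d)\<^sup>2 + \<theta>\<^sup>2) / (lam * d)\<^sup>2)" by simp
    also have "((lam * d)\<^sup>2 + \<theta>\<^sup>2) / (lam * d)\<^sup>2 = 1 + (\<theta> / lam)\<^sup>2 / (real d)\<^sup>2"
      using L lam_pos d by (simp add: add_divide_distrib power_divide power_mult_distrib)
    finally have X: "(of_real (lam * d) / (of_real (lam * d) - \<i> * of_real \<theta>)) * (of_real (lam * d)
        / (of_real (lam * d) - \<i> * of_real (- \<theta>)))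
        = complex_of_real (1 / (1 + (\<theta> / lam)\<^sup>2 / (real d)\<^sup>2))" .
    have rd: "2 * real J + 1 = real d" by (simp add: d_def)
    show ?thesis unfolding rd mult.assoc X by (simp only: of_real_mult[symmetric] times_divide_times_eq mult_1)
  qed
  finally show ?case unfolding P_def prod.lessThan_Suc .
qed

text \<open>J is fixed before the limit, so large that the partial product is close to its limit and
  the tail of the twist is at most e/4. The profile with J twists is then used at s = 0 only, where
  it gives the coefficient at m.\<close>

lemma twisted_ratio_tendsto:
  fixes \<alpha> :: "'i \<Rightarrow> real"
  assumes W: "filterlim (\<lambda>i. (k i, m i)) wide F" and \<alpha>: "((\<lambda>i. \<alpha> i * sqrt (m i)) \<longlongrightarrow> \<theta>) F"
  shows "((\<lambda>i. fps_nth (odd_gf (iexp (\<alpha> i)) (k i) * odd_gf (iexp (- \<alpha> i)) (k i)) (m i)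
      / of_real (pairs (k i) (m i)))
           \<longlongrightarrow> of_real (1 / cosh (pi * (\<theta> / lam) / 2))) F"
proof (rule tendstoI)
  fix e :: real assume e: "e > 0"
  define \<kappa> where "\<kappa> = (\<lambda>J. 1 / (\<Prod>j<J. 1 + (\<theta> / lam)\<^sup>2 / (2 * real j + 1)\<^sup>2))"
  define c where "c = 1 / cosh (pi * (\<theta> / lam) / 2)"
  define T where "T = \<theta>\<^sup>2 + 1"
  have "\<kappa> \<longlonglongrightarrow> c" unfolding \<kappa>_def c_def
    by (intro tendsto_divide tendsto_const cosh_product_formula) simp
  then have 1: "eventually (\<lambda>J. dist (\<kappa> J) c < e / 4) sequentially" by (rule tendstoD) (use e in simp)
  have "(\<lambda>J. 100 * T / real J) \<longlonglongrightarrow> 0" by real_asymp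
  then have 2: "eventually (\<lambda>J. 100 * T / real J < e / 4) sequentially" by (rule order_tendstoD) (use e in simp)
  obtain J where J: "dist (\<kappa> J) c < e / 4" "100 * T / real J < e / 4" "1 \<le> J"
    using eventually_happens[OF eventually_conj[OF 1 eventually_conj[OF 2 eventually_ge_at_top[of 1]]]] by auto
  have "((\<lambda>i. (\<alpha> i * sqrt (m i))\<^sup>2) \<longlongrightarrow> \<theta>\<^sup>2) F" by (intro tendsto_intros \<alpha>)
  then have "eventually (\<lambda>i. (\<alpha> i * sqrt (m i))\<^sup>2 < T) F" by (rule order_tendstoD) (simp add: T_def)
  moreover have "eventually (\<lambda>i. J \<le> k i) F"
  proof -
    have "eventually (\<lambda>i. real (k i) / sqrt (m i) \<ge> real J) F"
      using filterlim_at_top_eventually(1)[OF filterlim_compose[OF filterlim_wide_components(2) W]] by simp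
    then show ?thesis using wide_basic[OF W]
    proof eventually_elim
      case (elim i)
      have s: "sqrt (m i) \<ge> 1" using elim by simp
      have "real J * 1 \<le> real J * sqrt (m i)" using s by (intro mult_left_mono) auto
      also have "\<dots> \<le> real (k i)" using elim s by (simp add: le_divide_eq)
      finally show ?case by simp
    qed
  qed
  moreover have "eventually (\<lambda>i. \<forall>s. cmod (back_coeff (twist (\<alpha> i) (k i) J) (m i) s - of_real (\<kappa> J)
      * of_real (exp (- (lam * (real s / sqrt (m i)))) * pairs (k i) (m i))) \<le> e / 4 * pairs (k i) (m i)) F"
  proof -
    have "exp_profile F k m (\<lambda>i. twist (\<alpha> i) (k i) J) (of_real (\<kappa> J))"
      unfolding \<kappa>_def by (rule exp_profile_twist[OF W \<alpha>])
    moreover have "e / 4 > 0" using e by simp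
    ultimately show ?thesis unfolding exp_profile_def by blast
  qed
  moreover have "eventually (\<lambda>i. 1 \<le> k i \<and> 1 \<le> m i \<and> (\<forall>s\<le>m i. pairs (k i) (m i - s)
      \<le> 2 * exp (- real s / (5 * sqrt (m i))) * pairs (k i) (m i))) F"
    using eventually_compose_filterlim[OF pairs_decay_wide W] by simp
  ultimately show "eventually (\<lambda>i. dist (fps_nth (odd_gf (iexp (\<alpha> i)) (k i) * odd_gf (iexp (- \<alpha> i)) (k i)) (m i)
      / of_real (pairs (k i) (m i)))
      (of_real (1 / cosh (pi * (\<theta> / lam) / 2))) < e) F"
  proof eventually_elim
    case (elim i)
    define g where "g = pairs (k i) (m i)"
    have g: "g > 0" using elim by (auto simp: g_def intro: pairs_pos)
    define A where "A = fps_nth (twist (\<alpha> i) (k i) (k i)) (m i)"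
    define B where "B = fps_nth (twist (\<alpha> i) (k i) J) (m i)"
    have "cmod (A - B) \<le> 100 * ((\<alpha> i)\<^sup>2 * real (m i)) / real J * g"
      unfolding A_def B_def g_def using elim J by (intro twist_tail) auto
    also have "\<dots> \<le> e / 4 * g"
    proof (intro mult_right_mono)
      have "100 * ((\<alpha> i)\<^sup>2 * real (m i)) / real J \<le> 100 * T / real J"
        using elim(1) by (intro divide_right_mono) (auto simp: power_mult_distrib)
      then show "100 * ((\<alpha> i)\<^sup>2 * real (m i)) / real J \<le> e / 4" using J(2) by linarith
    qed (use g in auto)
    finally have 1: "cmod (A - B) \<le> e / 4 * g" .
    have 2: "cmod (B - of_real (\<kappa> J) * of_real g) \<le> e / 4 * g"
      using elim(3)[rule_format, of 0] by (simp add: back_coeff_def B_def g_def)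
    have 3: "cmod (of_real (\<kappa> J) * of_real g - of_real c * of_real g) \<le> e / 4 * g"
    proof -
      have "of_real (\<kappa> J) * of_real g - of_real c * of_real g = complex_of_real ((\<kappa> J - c) * g)"
        by (simp add: algebra_simps)
      then have "cmod (of_real (\<kappa> J) * of_real g - of_real c * of_real g) = \<bar>\<kappa> J - c\<bar> * g"
        using g by (simp only: norm_of_real abs_mult abs_of_pos)
      also have "\<dots> \<le> e / 4 * g" using J(1) g by (intro mult_right_mono) (auto simp: dist_real_def)
      finally show ?thesis .
    qed
    have "A - of_real c * of_real g = (A - B) + (B - of_real (\<kappa> J) * of_real g) + (of_real (\<kappa> J) * of_real g
        - of_real c * of_real g)"
      by simp
    also have "cmod \<dots> \<le> cmod (A - B) + cmod (B - of_real (\<kappa> J) * of_real g) + cmod (of_real (\<kappa> J) * of_real g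
        - of_real c * of_real g)"
      by (intro norm_triangle_le add_mono norm_triangle_ineq order_refl)
    also have "\<dots> \<le> 3 / 4 * e * g" using 1 2 3 by linarith
    finally have "cmod (A - of_real c * of_real g) \<le> 3 / 4 * e * g" .
    moreover have "A / of_real g - of_real c = (A - of_real c * of_real g) / of_real g" using g
        by (simp add: field_simps)
    ultimately have "cmod (A / of_real g - of_real c) \<le> 3 / 4 * e" using g
        by (simp add: norm_divide divide_le_eq)
    also have "\<dots> < e" using e by simp
    finally show ?case by (simp add: dist_norm A_def g_def c_def twist_full)
  qed
qed

section \<open>Odd unimodal sequences with a given peak\<close>

definition odd_parts :: "nat \<Rightarrow> nat \<Rightarrow> nat list set" where
  "odd_parts k m = {xs. sorted xs \<and> (\<forall>x\<in>set xs. odd x \<and> x < 2 * k) \<and> sum_list xs = m}"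

lemma finite_odd_parts: "finite (odd_parts k m)"
proof (rule finite_subset)
  show "odd_parts k m \<subseteq> {xs. set xs \<subseteq> {..m} \<and> length xs \<le> m}"
    by (auto simp: odd_parts_def member_le_sum_list intro!: sum_list_ge_length intro: odd_pos)
  show "finite {xs :: nat list. set xs \<subseteq> {..m} \<and> length xs \<le> m}"
    by (intro finite_lists_length_le) simp
qed

text \<open>If 2k+1 occurs, it is the largest admissible part and so the last entry; deleting it
  mirrors the recurrence for multiplication by \<open>geo\<close>.\<close>

lemma odd_parts_Suc:
  "odd_parts (Suc k) m = odd_parts k m \<union>
     (if m < 2 * k + 1 then {} else (\<lambda>xs. xs @ [2 * k + 1]) ` odd_parts (Suc k) (m - (2 * k + 1)))"
proof (intro equalityI subsetI)
  fix xs assume xs: "xs \<in> odd_parts (Suc k) m"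
  show "xs \<in> odd_parts k m \<union> (if m < 2 * k + 1 then {} else (\<lambda>xs. xs @ [2 * k + 1]) ` odd_parts (Suc k) (m - (2
      * k + 1)))"
  proof (cases "2 * k + 1 \<in> set xs")
    case False
    have "x < 2 * k" if "x \<in> set xs" for x
    proof -
      have "x < 2 * k + 2" "odd x" "x \<noteq> 2 * k + 1" using xs that False by (auto simp: odd_parts_def)
      moreover have "x \<noteq> 2 * k" using \<open>odd x\<close> by auto
      ultimately show ?thesis by linarith
    qed
    then show ?thesis using xs by (auto simp: odd_parts_def)
  next
    case True
    then have ne: "xs \<noteq> []" by auto
    define ys where "ys = butlast xs"
    have xs_eq: "xs = ys @ [last xs]" using ne by (simp add: ys_def)
    have srt: "sorted (ys @ [last xs])" using xs xs_eq by (simp add: odd_parts_def)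
    have "x \<le> last xs" if "x \<in> set xs" for x
    proof -
      have "x \<in> set (ys @ [last xs])" using that arg_cong[OF xs_eq, of set] by simp
      then show ?thesis using srt by (auto simp: sorted_append)
    qed
    then have "2 * k + 1 \<le> last xs" using True by blast
    moreover have "last xs < 2 * Suc k" using xs ne last_in_set[OF ne] unfolding odd_parts_def by blast
    ultimately have last: "last xs = 2 * k + 1" by simp
    have xs_eq': "xs = ys @ [2 * k + 1]" using xs_eq unfolding last .
    have sum: "sum_list ys + (2 * k + 1) = m"
    proof -
      have "sum_list xs = sum_list ys + (2 * k + 1)" using arg_cong[OF xs_eq', of sum_list] by simp
      then show ?thesis using xs by (simp add: odd_parts_def)
    qed
    have "set ys \<subseteq> set xs" using in_set_butlastD[of _ xs] by (auto simp: ys_def)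
    then have "ys \<in> odd_parts (Suc k) (m - (2 * k + 1))"
      using xs srt sum unfolding odd_parts_def sorted_append by auto
    moreover have "\<not> m < 2 * k + 1" using sum by linarith
    ultimately show ?thesis unfolding xs_eq' by (simp only: if_False) blast
  qed
next
  fix xs assume "xs \<in> odd_parts k m \<union> (if m < 2 * k + 1 then {} else (\<lambda>xs. xs @ [2 * k
      + 1]) ` odd_parts (Suc k) (m - (2 * k + 1)))"
  then consider "xs \<in> odd_parts k m"
    | ys where "m \<ge> 2 * k + 1" "xs = ys @ [2 * k + 1]" "ys \<in> odd_parts (Suc k) (m - (2 * k + 1))"
    by (auto split: if_splits)
  then show "xs \<in> odd_parts (Suc k) m"
    by cases (auto simp: odd_parts_def sorted_append)
qed

lemma odd_gf_counts:
  fixes w :: "'a::field"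
  shows "(\<Sum>xs\<in>odd_parts k m. w ^ length xs) = fps_nth (odd_gf w k) m"
proof (induction k arbitrary: m)
  case 0
  have "odd_parts 0 m = (if m = 0 then {[]} else {})"
    by (auto simp: odd_parts_def)
  then show ?case by (simp add: odd_gf_0)
next
  case (Suc k)
  show ?case
  proof (induction m rule: less_induct)
    case (less m)
    let ?A = "odd_parts (Suc k) (m - (2 * k + 1))" and ?f = "\<lambda>xs. xs @ [2 * k + 1]"
    show ?case
    proof (cases "m < 2 * k + 1")
      case True
      then show ?thesis using Suc.IH[of m] geo_mult_nth[of "2*k+1" w "odd_gf w k" m]
        by (simp add: odd_parts_Suc odd_gf_Suc)
    next
      case False
      have "xs @ [2 * k + 1] \<notin> odd_parts k m" for xs by (simp add: odd_parts_def)
      then have disj: "odd_parts k m \<inter> ?f ` ?A = {}" by blast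
      have U: "odd_parts (Suc k) m = odd_parts k m \<union> ?f ` ?A"
        using odd_parts_Suc[of k m] False by (simp only: if_False)
      have "(\<Sum>xs\<in>odd_parts (Suc k) m. w ^ length xs)
          = (\<Sum>xs\<in>odd_parts k m. w ^ length xs) + (\<Sum>xs\<in>?f ` ?A. w ^ length xs)"
        unfolding U by (intro sum.union_disjoint finite_odd_parts finite_imageI disj)
      also have "(\<Sum>xs\<in>?f ` ?A. w ^ length xs) = w * (\<Sum>xs\<in>?A. w ^ length xs)"
        by (subst sum.reindex) (auto simp: inj_on_def sum_distrib_left)
      also have "(\<Sum>xs\<in>?A. w ^ length xs) = fps_nth (odd_gf w (Suc k)) (m - (2 * k + 1))"
        using False by (intro less.IH) auto
      finally show ?thesis
        using False Suc.IH[of m] geo_mult_nth[of "2*k+1" w "odd_gf w k" m] by (simp add: odd_gf_Suc)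
    qed
  qed
qed

text \<open>For c = 2k+1 an odd x is at most c iff it is below 2(k+1), hence the index c div 2 + 1.
  The right side is reversed to become increasing.\<close>

lemma OU_iff:
  "(as, c, bs) \<in> OU n \<longleftrightarrow> odd c \<and> c + sum_list as + sum_list bs = n \<and>
     as \<in> odd_parts (c div 2 + 1) (sum_list as) \<and> rev bs \<in> odd_parts (c div 2 + 1) (sum_list bs)"
proof (cases "odd c")
  case True
  then obtain k where c: "c = 2 * k + 1" by (auto elim: oddE)
  have lt: "odd x \<Longrightarrow> x < 2 * (k + 1) \<longleftrightarrow> x \<le> c" for x by (auto simp: c elim!: oddE)
  have s1: "sorted_wrt (\<le>) (as @ [c]) \<longleftrightarrow> sorted as \<and> (\<forall>x\<in>set as. x \<le> c)"
    by (auto simp: sorted_wrt_append)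
  have s2: "sorted_wrt (\<ge>) (c # bs) \<longleftrightarrow> sorted (rev bs) \<and> (\<forall>x\<in>set bs. x \<le> c)"
    by (auto simp: sorted_wrt_rev)
  have "c div 2 + 1 = k + 1" by (simp add: c)
  then show ?thesis unfolding OU_def odd_parts_def
    using lt True by (auto simp del: sorted_wrt.simps simp: s1 s2 sum_list_rev)
qed (auto simp: OU_def)

text \<open>Sequences are sorted by the peak 2k+1 and the size i of the left side; k < (n+1) div 2
  means 2k+1 \<le> n. The choice w = w' = 1 counts sequences, conjugate unimodular values give the
  characteristic function of the rank.\<close>

lemma OU_rank_gf:
  fixes w w' :: "'a::field"
  shows "(\<Sum>(as, c, bs)\<in>OU n. w ^ length as * w' ^ length bs)
       = (\<Sum>k<(n + 1) div 2. fps_nth (odd_gf w (k + 1) * odd_gf w' (k + 1)) (n - (2 * k + 1)))"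
proof -
  define D where "D = (SIGMA k:{..<(n + 1) div 2}. SIGMA i:{0..n - (2 * k + 1)}. odd_parts (k
      + 1) i \<times> odd_parts (k + 1) (n - (2 * k + 1) - i))"
  have "(\<Sum>(as, c, bs)\<in>OU n. w ^ length as * w' ^ length bs)
      = (\<Sum>(k, i, as, bs)\<in>D. w ^ length as * w' ^ length bs)"
  proof (rule sum.reindex_bij_witness[of _ "\<lambda>(k, i, as, bs). (as, 2 * k
      + 1, rev bs)" "\<lambda>(as, c, bs). (c div 2, sum_list as, as, rev bs)"])
    fix x assume x: "x \<in> OU n"
    obtain as c bs where [simp]: "x = (as, c, bs)" by (cases x)
    have o: "odd c" "c + sum_list as + sum_list bs
        = n" "as \<in> odd_parts (c div 2 + 1) (sum_list as)" "rev bs \<in> odd_parts (c div 2 + 1) (sum_list bs)"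
      using x by (auto simp: OU_iff)
    then have c: "2 * (c div 2) + 1 = c" by simp
    show "(case case x of (as, c, bs) \<Rightarrow> (c div 2, sum_list as, as, rev bs) of (k, i, as, bs) \<Rightarrow> (as, 2 * k
        + 1, rev bs)) = x"
      using c by simp
    have "n - c - sum_list as = sum_list bs" "c div 2 < (n + 1) div 2" "sum_list as \<le> n - c" using o c
        by linarith+
    then show "(case x of (as, c, bs) \<Rightarrow> (c div 2, sum_list as, as, rev bs)) \<in> D"
      using o c unfolding D_def by (simp del: One_nat_def add: c)
    show "(case case x of (as, c, bs) \<Rightarrow> (c div 2, sum_list as, as, rev bs) of (k, i, as, bs) \<Rightarrow> w ^ length as
        * w' ^ length bs)
        = (case x of (as, c, bs) \<Rightarrow> w ^ length as * w' ^ length bs)" by simp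
  next
    fix y assume y: "y \<in> D"
    obtain k i as bs where [simp]: "y = (k, i, as, bs)" by (cases y)
    have k: "k < (n + 1) div 2" "i \<le> n - (2 * k + 1)" and p: "as \<in> odd_parts (k + 1) i" "bs \<in> odd_parts (k
        + 1) (n - (2 * k + 1) - i)"
      using y by (auto simp: D_def)
    have s: "sum_list as = i" "sum_list bs = n - (2 * k + 1) - i" using p by (auto simp: odd_parts_def)
    show "(case case y of (k, i, as, bs) \<Rightarrow> (as, 2 * k
        + 1, rev bs) of (as, c, bs) \<Rightarrow> (c div 2, sum_list as, as, rev bs)) = y"
      using s by simp
    have "2 * k + 1 + i + (n - (2 * k + 1) - i) = n" using k by linarith
    then show "(case y of (k, i, as, bs) \<Rightarrow> (as, 2 * k + 1, rev bs)) \<in> OU n"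
      using p s by (simp add: OU_iff sum_list_rev)
  qed
  also have "\<dots> = (\<Sum>k<(n + 1) div 2. \<Sum>i=0..n - (2 * k + 1). \<Sum>as\<in>odd_parts (k + 1) i. \<Sum>bs\<in>odd_parts (k + 1) (n
      - (2 * k + 1) - i). w ^ length as * w' ^ length bs)"
    unfolding D_def by (simp add: sum.Sigma finite_odd_parts sum.cartesian_product)
  also have "\<dots> = (\<Sum>k<(n + 1) div 2. fps_nth (odd_gf w (k + 1) * odd_gf w' (k + 1)) (n - (2 * k + 1)))"
    unfolding fps_mult_nth odd_gf_counts[symmetric] by (simp add: sum_product)
  finally show ?thesis .
qed

lemma ou_eq: "real (ou n) = (\<Sum>k<(n + 1) div 2. pairs (k + 1) (n - (2 * k + 1)))"
proof -
  have "real (ou n) = (\<Sum>(as, c, bs)\<in>OU n. (1::real) ^ length as * 1 ^ length bs)"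
    by (simp add: ou_def case_prod_unfold)
  then show ?thesis unfolding OU_rank_gf pairs_def power2_eq_square .
qed

text \<open>A pair with largest part 2k+1 loses one copy of it on one of the two sides, and this
  copy becomes the peak; the choice of side costs the factor 2. Summed over k, the differences
  telescope to the number of all pairs of size n.\<close>

lemma pairs_le_ou:
  assumes "1 \<le> n"
  shows "pairs n n \<le> 2 * real (ou n)"
proof -
  have step: "pairs (Suc k) n - pairs k n \<le> 2 * pairs (k + 1) (n - (2 * k + 1))" if "k < (n + 1) div 2" for k
  proof -
    define d where "d = 2 * k + 1"
    define f where "f = (odd_gf (1::real) k)\<^sup>2"
    define a where "a = geo 1 d * f"
    have d: "0 < d" "\<not> n < d" using that by (auto simp: d_def)
    have f0: "fps_nth f i \<ge> 0" for i using pairs_nonneg[of k i] by (simp add: f_def pairs_def)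
    have a0: "fps_nth a i \<ge> 0" for i unfolding a_def by (intro fps_mult_nonneg geo_nonneg f0)
    have 1: "fps_nth (geo 1 d * a) n = fps_nth a n + fps_nth (geo 1 d * a) (n - d)"
      by (subst geo_mult_nth[OF d(1)]) (simp add: d)
    have 2: "fps_nth a n = fps_nth f n + fps_nth a (n - d)"
      unfolding a_def by (subst geo_mult_nth[OF d(1)]) (simp add: d)
    have 3: "fps_nth a (n - d) \<le> fps_nth (geo 1 d * a) (n - d)" by (intro le_geo_mult a0 d)
    have P: "pairs (Suc k) i = fps_nth (geo 1 d * a) i" for i
      unfolding pairs_Suc a_def f_def d_def ..
    have "pairs k n = fps_nth f n" by (simp add: pairs_def f_def)
    then show ?thesis using 1 2 3 P[of n] P[of "n - d"] by (simp add: d_def)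
  qed
  let ?K = "(n + 1) div 2"
  have "pairs n n = pairs ?K n" by (intro pairs_stable) auto
  also have "\<dots> = (\<Sum>k<?K. pairs (Suc k) n - pairs k n) + pairs 0 n"
    by (simp only: sum_lessThan_telescope[of "\<lambda>k. pairs k n"] diff_add_cancel)
  also have "pairs 0 n = 0" using assms by (simp add: pairs_def odd_gf_0)
  also have "(\<Sum>k<?K. pairs (Suc k) n - pairs k n) \<le> (\<Sum>k<?K. 2 * pairs (k + 1) (n - (2 * k + 1)))"
    using step by (intro sum_mono) auto
  finally show ?thesis by (simp add: ou_eq sum_distrib_left)
qed

section \<open>Concentration of the peak\<close>

text \<open>The logarithmic increments of P exceed l / sqrt N and sum to about 2 l sqrt n. Passing
  from P to g by P(n) \<le> (n+1) g(n) costs only ln (n+1), which \<eta> sqrt n absorbs.\<close>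

lemma log_pairs_lower:
  assumes \<eta>: "0 < \<eta>"
  shows "eventually (\<lambda>n. exp ((2 * lam - \<eta>) * sqrt n) \<le> pairs n n) sequentially"
proof -
  \<comment> \<open>The maximum keeps l positive for large \<eta>. The loss \<eta>/4 becomes
    \<eta>/2 in 2l; the other \<eta>/2 pays for ln (n+1) and the constants.\<close>
  define l where "l = max (lam - \<eta> / 4) (lam / 2)"
  have l: "l < lam" "0 < l" "lam - \<eta> / 4 \<le> l" using \<eta> lam_pos by (auto simp: l_def)
  have "eventually (\<lambda>x. (case x of (k, m) \<Rightarrow> sqrt m * (ln (psum k m) - ln (psum k (m - 1)))) > l) wide"
    using psum_log_increment_tendsto l(1) by (rule order_tendstoD)
  then obtain K where K: "K > 0" "\<And>k m. real m \<ge> K \<Longrightarrow> real k \<ge> K * sqrt m \<Longrightarrow>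
      sqrt m * (ln (psum k m) - ln (psum k (m - 1))) > l"
    unfolding eventually_wide by auto
  define a where "a = nat \<lceil>K\<rceil>"
  have a: "real a \<ge> K" unfolding a_def by linarith
  have main: "2 * l * (sqrt (real n + 1) - sqrt (real a + 1)) \<le> ln (psum n n)"
      if n: "real n \<ge> K\<^sup>2" "n \<ge> a" "n \<ge> 1" for n
  proof -
    have kn: "real n \<ge> K * sqrt n"
    proof -
      have "K \<le> sqrt n" using n(1) K(1) by (intro real_le_rsqrt) auto
      then have "K * sqrt n \<le> sqrt n * sqrt n" by (intro mult_right_mono) auto
      then show ?thesis by simp
    qed
    have "2 * l * (sqrt (real N + 1) - sqrt (real a + 1)) \<le> ln (psum n N)" if N: "a \<le> N" "N \<le> n" for N
      using N
    proof (induction N rule: dec_induct)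
      case base
      have "pairs n 0 \<ge> pairs 1 0" using n(3) by (rule pairs_mono_index)
      then have "pairs n 0 \<ge> 1" using pairs_1[of 0] by linarith
      moreover have "psum n a \<ge> pairs n 0" unfolding psum_def by (intro member_le_sum) (auto simp: pairs_nonneg)
      ultimately show ?case by simp
    next
      case (step N)
      define x where "x = sqrt (real N + 1)"
      define y where "y = sqrt (real N + 2)"
      have xy: "1 \<le> x" "x < y" "y\<^sup>2 = x\<^sup>2 + 1" by (auto simp: x_def y_def)
      have "K * sqrt (Suc N) \<le> K * sqrt n" using step K(1) by (intro mult_left_mono) auto
      then have "sqrt (Suc N) * (ln (psum n (Suc N)) - ln (psum n (Suc N - 1))) > l"
        using step a kn by (intro K(2)) auto
      then have "x * (ln (psum n (Suc N)) - ln (psum n N)) > l" by (simp add: x_def add.commute)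
      then have 1: "l / x \<le> ln (psum n (Suc N)) - ln (psum n N)"
        using xy by (simp add: pos_divide_le_eq mult.commute)
      have "(y - x) * (y + x) = 1" using xy(3) by (simp add: algebra_simps power2_eq_square)
      then have d: "y - x = 1 / (x + y)" using xy by (simp add: field_simps)
      have "2 * (y - x) \<le> 1 / x" unfolding d using xy by (simp add: field_simps)
      then have "l * (2 * (y - x)) \<le> l * (1 / x)" using l(2) by (intro mult_left_mono) auto
      moreover have "2 * l * (x - sqrt (real a + 1)) \<le> ln (psum n N)" using step by (simp add: x_def)
      ultimately have "2 * l * (y - sqrt (real a + 1)) \<le> ln (psum n (Suc N))"
        using 1 by (simp add: algebra_simps)
      then show ?case by (simp add: y_def add.commute)
    qed
    then show ?thesis using n(2) by blast
  qed
  have "filterlim (\<lambda>n::nat. \<eta> / 2 * sqrt n - 2 * l * sqrt (real a + 1) - ln (real n + 1)) at_top sequentially"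
    using \<eta> by real_asymp
  then have ev: "eventually (\<lambda>n::nat. \<eta> / 2 * sqrt n - 2 * l * sqrt (real a + 1) - ln (real n
      + 1) \<ge> 0) sequentially"
    by (rule filterlim_at_top_eventually)
  have "eventually (\<lambda>n. real n \<ge> K\<^sup>2) sequentially"
    using filterlim_real_sequentially by (rule filterlim_at_top_eventually)
  with ev show ?thesis using eventually_ge_at_top[of a] eventually_ge_at_top[of 1]
  proof eventually_elim
    case (elim n)
    have P: "pairs n n > 0" using elim by (intro pairs_pos) auto
    have "psum n n \<le> (\<Sum>s\<le>n. pairs n n)" unfolding psum_def using elim by (intro sum_mono pairs_mono) auto
    then have "psum n n \<le> (real n + 1) * pairs n n" by (simp add: add.commute)
    moreover have "psum n n > 0" using elim by (intro psum_pos) auto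
    ultimately have "ln (psum n n) \<le> ln ((real n + 1) * pairs n n)" by simp
    also have "\<dots> = ln (real n + 1) + ln (pairs n n)" using P by (intro ln_mult_pos) auto
    finally have "2 * l * (sqrt (real n + 1) - sqrt (real a + 1)) \<le> ln (real n + 1) + ln (pairs n n)"
      using main[of n] elim by linarith
    moreover have "2 * l * sqrt n \<le> 2 * l * sqrt (real n + 1)" using l by (intro mult_left_mono) auto
    moreover have "(2 * lam - \<eta> / 2) * sqrt n \<le> 2 * l * sqrt n" using l by (intro mult_right_mono) auto
    ultimately have "(2 * lam - \<eta>) * sqrt n \<le> ln (pairs n n)" using elim(1) by (simp add: algebra_simps)
    then have "exp ((2 * lam - \<eta>) * sqrt n) \<le> exp (ln (pairs n n))" by simp
    then show ?case using P by simp
  qed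
qed

text \<open>The index pairs with i + j \<le> M lie in a square and all terms are nonnegative.
  Truncation at M replaces evaluation of the series at r, so no convergence has to be
  discussed.\<close>

lemma partial_eval_mult:
  fixes f h :: "real fps"
  assumes f: "\<And>n. fps_nth f n \<ge> 0" and h: "\<And>n. fps_nth h n \<ge> 0" and r: "0 \<le> r"
  shows "(\<Sum>m\<le>M. fps_nth (f * h) m * r ^ m) \<le> (\<Sum>m\<le>M. fps_nth f m * r ^ m) * (\<Sum>m\<le>M. fps_nth h m * r ^ m)"
proof -
  have "(\<Sum>m\<le>M. fps_nth (f * h) m * r ^ m)
      = (\<Sum>m\<le>M. \<Sum>i\<le>m. (fps_nth f i * r ^ i) * (fps_nth h (m - i) * r ^ (m - i)))"
  proof (intro sum.cong refl)
    fix m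
    have t: "(fps_nth f i * r ^ i) * (fps_nth h (m - i) * r ^ (m - i))
        = fps_nth f i * fps_nth h (m - i) * r ^ m" if "i \<le> m" for i
    proof -
      have "r ^ m = r ^ i * r ^ (m - i)" using that by (simp flip: power_add)
      then show ?thesis by simp
    qed
    then show "fps_nth (f * h) m * r ^ m = (\<Sum>i\<le>m. (fps_nth f i * r ^ i) * (fps_nth h (m - i) * r ^ (m - i)))"
      unfolding fps_mult_nth sum_distrib_right atLeast0AtMost by (intro sum.cong refl) (simp only: t atMost_iff)
  qed
  also have "\<dots> = (\<Sum>(i, j)\<in>{(i, j). i + j \<le> M}. (fps_nth f i * r ^ i) * (fps_nth h j * r ^ j))"
    by (rule sum.triangle_reindex_eq[symmetric])
  also have "\<dots> \<le> (\<Sum>(i, j)\<in>{..M} \<times> {..M}. (fps_nth f i * r ^ i) * (fps_nth h j * r ^ j))"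
    using f h r by (intro sum_mono2) auto
  also have "\<dots> = (\<Sum>m\<le>M. fps_nth f m * r ^ m) * (\<Sum>m\<le>M. fps_nth h m * r ^ m)"
    by (simp only: sum_product sum.cartesian_product)
  finally show ?thesis .
qed

lemma partial_eval_geo:
  fixes r :: real
  assumes r: "0 < r" "r < 1" and d: "0 < d"
  shows "(\<Sum>m\<le>M. fps_nth (geo 1 d) m * r ^ m) \<le> 1 / (1 - r ^ d)"
proof -
  have rd: "0 < r ^ d" "r ^ d < 1" using r d by (auto simp: power_less_one_iff)
  have iff: "a \<le> M div d \<longleftrightarrow> d * a \<le> M" for a
    using d by (simp add: less_eq_div_iff_mult_less_eq mult.commute)
  have "(\<Sum>m\<le>M. fps_nth (geo 1 d) m * r ^ m) = (\<Sum>m\<in>(\<lambda>a. d * a) ` {..M div d}. r ^ m)"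
  proof (rule sum.mono_neutral_cong_right)
    show "(\<lambda>a. d * a) ` {..M div d} \<subseteq> {..M}" by (auto simp: iff)
    show "\<forall>m\<in>{..M} - (\<lambda>a. d * a) ` {..M div d}. fps_nth (geo 1 d) m * r ^ m = 0"
      by (auto simp: geo_def image_iff iff elim!: dvdE)
    show "fps_nth (geo 1 d) m * r ^ m = r ^ m" if "m \<in> (\<lambda>a. d * a) ` {..M div d}" for m
      using that by (auto simp: geo_def)
  qed simp
  also have "\<dots> = (\<Sum>a\<le>M div d. (r ^ d) ^ a)"
    using d by (subst sum.reindex) (auto simp: inj_on_def power_mult)
  also have "\<dots> \<le> 1 / (1 - r ^ d)"
    using rd by (simp add: sum_gp0 divide_right_mono)
  finally show ?thesis .
qed

lemma partial_eval_odd_gf: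
  fixes r :: real
  assumes r: "0 < r" "r < 1"
  shows "(\<Sum>m\<le>M. fps_nth (odd_gf 1 k) m * r ^ m) \<le> (\<Prod>j<k. 1 / (1 - r ^ (2 * j + 1)))"
proof (induction k)
  case 0
  have "(\<Sum>m\<le>M. fps_nth 1 m * r ^ m) = (\<Sum>m\<le>M. if m = 0 then 1 else 0)" by (intro sum.cong) auto
  then show ?case by (simp add: odd_gf_0)
next
  case (Suc k)
  have p: "r ^ (2 * k + 1) < 1" using r by (subst power_less_one_iff) auto
  have "(\<Sum>m\<le>M. fps_nth (odd_gf 1 (Suc k)) m * r ^ m)
      \<le> (\<Sum>m\<le>M. fps_nth (geo 1 (2 * k + 1)) m * r ^ m) * (\<Sum>m\<le>M. fps_nth (odd_gf 1 k) m * r ^ m)"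
    unfolding odd_gf_Suc using r by (intro partial_eval_mult geo_nonneg odd_gf_nonneg) auto
  also have "\<dots> \<le> 1 / (1 - r ^ (2 * k + 1)) * (\<Prod>j<k. 1 / (1 - r ^ (2 * j + 1)))"
    using p r by (intro mult_mono partial_eval_geo Suc.IH sum_nonneg mult_nonneg_nonneg odd_gf_nonneg) auto
  finally show ?case by (simp add: mult.commute)
qed

text \<open>Expanding the logarithms and summing over j first gives, with q = r^N, the terms (1 -
  q^(2k)) q / (N (1 - q^2)), where q / (1 - q^2) = 1 / (2 sinh (tN)) \<le> 1 / (2tN). Summation over
  N yields pi^2 / (12 t); of the deficits q^(2k) only the one for N = 1 is kept. It measures the
  loss caused by having few parts.\<close>

lemma sum_neg_log_bound:
  assumes t: "0 < t"
  defines "r \<equiv> exp (- t)"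
  shows "(\<Sum>j<k. - ln (1 - r ^ (2 * j + 1))) \<le> pi\<^sup>2 / (12 * t) - r ^ (2 * k) / (2 * t)"
proof -
  have r: "0 < r" "r < 1" using t by (auto simp: r_def)
  have S: "(\<lambda>n. (r ^ (2 * j + 1)) ^ n / real n) sums - ln (1 - r ^ (2 * j + 1))" for j
  proof -
    have "\<bar>- (r ^ (2 * j + 1))\<bar> < 1" using r by (simp del: power_Suc add: power_less_one_iff)
    from sums_minus[OF ln_series'[OF this]] show ?thesis by simp
  qed
  have "(\<lambda>n. \<Sum>j<k. (r ^ (2 * j + 1)) ^ n / real n) sums (\<Sum>j<k. - ln (1 - r ^ (2 * j + 1)))"
    by (intro sums_sum S)
  then have S1: "(\<lambda>n. \<Sum>j<k. (r ^ (2 * j + 1)) ^ Suc n / real (Suc n)) sums (\<Sum>j<k. - ln (1 - r ^ (2 * j + 1)))"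
    by (subst sums_Suc_iff) simp
  have S2: "(\<lambda>n. 1 / (2 * t) * (1 / real ((n + 1)\<^sup>2)) - (if n
      = 0 then r ^ (2 * k) / (2 * t) else 0)) sums (1 / (2 * t) * (pi\<^sup>2 / 6) - r ^ (2 * k) / (2 * t))"
  proof (intro sums_diff sums_mult)
    show "(\<lambda>n. 1 / real ((n + 1)\<^sup>2)) sums (pi\<^sup>2 / 6)" using inverse_squares_sums by simp
    show "(\<lambda>n. if n = 0 then r ^ (2 * k) / (2 * t) else 0) sums (r ^ (2 * k) / (2 * t))"
      using sums_single[of 0 "\<lambda>_. r ^ (2 * k) / (2 * t)"] by simp
  qed
  have "(\<Sum>j<k. - ln (1 - r ^ (2 * j + 1))) \<le> 1 / (2 * t) * (pi\<^sup>2 / 6) - r ^ (2 * k) / (2 * t)"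
  proof (rule sums_le[OF _ S1 S2])
    fix n
    define N where "N = Suc n"
    define q where "q = r ^ N"
    have q: "0 < q" "q < 1" using r by (auto simp: q_def N_def power_less_one_iff simp del: power_Suc)
    have qq: "q\<^sup>2 < 1" using q by (simp add: power_less_one_iff)
    have "(\<Sum>j<k. (r ^ (2 * j + 1)) ^ N) = (\<Sum>j<k. q * (q\<^sup>2) ^ j)"
    proof (intro sum.cong refl)
      fix j
      have "(2 * j + 1) * N = N + N * 2 * j" by (simp add: algebra_simps)
      then show "(r ^ (2 * j + 1)) ^ N = q * (q\<^sup>2) ^ j"
        by (simp only: q_def power_mult[symmetric] power_add[symmetric])
    qed
    also have "\<dots> = q * ((1 - (q\<^sup>2) ^ k) / (1 - q\<^sup>2))"
      using qq by (simp add: sum_distrib_left[symmetric] sum_gp_strict)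
    finally have inner: "(\<Sum>j<k. (r ^ (2 * j + 1)) ^ N) = (1 - q ^ (2 * k)) * (q / (1 - q\<^sup>2))"
      by (simp add: power_mult)
    have "q / (1 - q\<^sup>2) \<le> 1 / (2 * (t * N))"
    proof -
      have qe: "q = exp (- (t * N))" by (simp add: q_def r_def exp_of_nat_mult[symmetric] mult.commute)
      have "t * N \<le> (exp (t * N) - inverse (exp (t * N))) / 2" using t by (intro real_le_x_sinh) auto
      then have "2 * (t * N) \<le> 1 / q - q" by (simp add: qe exp_minus inverse_eq_divide)
      also have "\<dots> = (1 - q\<^sup>2) / q" using q by (simp add: field_simps power2_eq_square)
      finally have le: "2 * (t * N) \<le> (1 - q\<^sup>2) / q" .
      have p0: "2 * (t * N) > 0" using t by (simp add: N_def)
      have p1: "(1 - q\<^sup>2) / q > 0" using q qq by simp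
      have "1 / ((1 - q\<^sup>2) / q) \<le> 1 / (2 * (t * N))"
        by (rule divide_left_mono[OF le zero_le_one mult_pos_pos[OF p1 p0]])
      then show ?thesis by simp
    qed
    moreover have "0 \<le> 1 - q ^ (2 * k)" using q by (simp add: power_le_one)
    ultimately have "(\<Sum>j<k. (r ^ (2 * j + 1)) ^ N) \<le> (1 - q ^ (2 * k)) * (1 / (2 * (t * N)))"
      unfolding inner by (intro mult_left_mono)
    then have "(\<Sum>j<k. (r ^ (2 * j + 1)) ^ N) / N \<le> (1 - q ^ (2 * k)) * (1 / (2 * (t * N))) / N"
      by (intro divide_right_mono) auto
    also have "\<dots> = 1 / (2 * t) * (1 / real (N\<^sup>2)) - q ^ (2 * k) / (2 * t * real (N\<^sup>2))"
      by (simp add: power2_eq_square diff_divide_distrib left_diff_distrib)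
    also have "\<dots> \<le> 1 / (2 * t) * (1 / real (N\<^sup>2)) - (if n = 0 then r ^ (2 * k) / (2 * t) else 0)"
      using q t by (auto simp: N_def q_def)
    finally show "(\<Sum>j<k. (r ^ (2 * j + 1)) ^ Suc n / real (Suc n))
        \<le> 1 / (2 * t) * (1 / real ((n + 1)\<^sup>2)) - (if n = 0 then r ^ (2 * k) / (2 * t) else 0)"
      by (simp only: N_def sum_divide_distrib Suc_eq_plus1)
  qed
  then show ?thesis by simp
qed

text \<open>Bounding one coefficient by the partial sum of the series at r = exp(-t). The choice t =
  lam / sqrt n minimises t n + pi^2 / (6t), making both terms lam sqrt n; the deficit of the
  logarithmic sum remains as the subtracted term.\<close>

lemma pairs_upper:
  assumes n: "1 \<le> n" "m \<le> n"
  shows "pairs k m \<le> exp (2 * lam * sqrt n - sqrt n * exp (- (2 * lam * k / sqrt n)) / lam)"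
proof -
  define t where "t = lam / sqrt n"
  define r where "r = exp (- t)"
  define Z where "Z = (\<Prod>j<k. 1 / (1 - r ^ (2 * j + 1)))"
  have sn: "sqrt n > 0" using n by simp
  have t: "t > 0" using lam_pos sn by (simp add: t_def)
  have r: "0 < r" "r < 1" using t by (auto simp: r_def)
  have pw: "r ^ (2 * j + 1) < 1" for j using r by (subst power_less_one_iff) auto
  have pos: "1 - r ^ (2 * j + 1) > 0" for j using pw[of j] by linarith
  have nz: "1 / (1 - r ^ (2 * j + 1)) \<noteq> 0" for j using pos[of j] by (metis less_irrefl zero_less_divide_1_iff)
  have Z0: "Z > 0" unfolding Z_def using pos by (intro prod_pos) (simp only: zero_less_divide_1_iff)
  have "ln Z = (\<Sum>j<k. ln (1 / (1 - r ^ (2 * j + 1))))"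
    unfolding Z_def by (rule ln_prod) (rule finite_lessThan, rule nz)
  also have "\<dots> = (\<Sum>j<k. - ln (1 - r ^ (2 * j + 1)))"
  proof -
    have "ln (1 / y) = - ln y" if "y > 0" for y :: real using that by (simp add: ln_div)
    then show ?thesis using pos by (intro sum.cong refl) blast
  qed
  also have "\<dots> \<le> pi\<^sup>2 / (12 * t) - r ^ (2 * k) / (2 * t)"
    unfolding r_def by (rule sum_neg_log_bound[OF t])
  also have "pi\<^sup>2 / (12 * t) = lam * sqrt n / 2"
  proof -
    have "pi\<^sup>2 = 6 * lam\<^sup>2" by (simp add: lam_square)
    then show ?thesis using lam_pos sn by (simp add: t_def field_simps power2_eq_square)
  qed
  finally have lnZ: "2 * ln Z \<le> lam * sqrt n - r ^ (2 * k) / t" by (simp add: field_simps)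
  have "pairs k m * r ^ m \<le> (\<Sum>i\<le>m. pairs k i * r ^ i)"
    using r by (intro member_le_sum) (auto simp: pairs_nonneg)
  also have "\<dots> \<le> (\<Sum>i\<le>m. fps_nth (odd_gf 1 k) i * r ^ i) * (\<Sum>i\<le>m. fps_nth (odd_gf 1 k) i * r ^ i)"
    unfolding pairs_def power2_eq_square using r by (intro partial_eval_mult odd_gf_nonneg) auto
  also have "\<dots> \<le> Z * Z"
    unfolding Z_def using r by (intro mult_mono partial_eval_odd_gf sum_nonneg mult_nonneg_nonneg odd_gf_nonneg
        prod_nonneg)
       (use pw in \<open>auto simp: less_imp_le\<close>)
  also have "\<dots> = exp (2 * ln Z)"
  proof -
    have "exp (2 * ln Z) = exp (ln Z) * exp (ln Z)" by (simp add: exp_add[symmetric])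
    then show ?thesis using Z0 by simp
  qed
  also have "\<dots> \<le> exp (lam * sqrt n - r ^ (2 * k) / t)" using lnZ by simp
  finally have 1: "pairs k m * r ^ m \<le> exp (lam * sqrt n - r ^ (2 * k) / t)" .
  have "exp (t * m) * r ^ m = 1" by (simp add: r_def exp_of_nat_mult[symmetric] exp_add[symmetric] mult.commute)
  then have "pairs k m = exp (t * m) * (pairs k m * r ^ m)" by (simp add: algebra_simps)
  also have "\<dots> \<le> exp (lam * sqrt n) * exp (lam * sqrt n - r ^ (2 * k) / t)"
  proof (intro mult_mono 1)
    have "t * m \<le> t * n" using t n by (intro mult_left_mono) auto
    also have "t * n = lam * sqrt n" using sn by (simp add: t_def field_simps)
    finally show "exp (t * m) \<le> exp (lam * sqrt n)" by simp
  qed (use r in \<open>auto simp: pairs_nonneg\<close>)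
  also have "\<dots> = exp (2 * lam * sqrt n - r ^ (2 * k) / t)" by (simp add: exp_add[symmetric])
  also have "r ^ (2 * k) / t = sqrt n * exp (- (2 * lam * k / sqrt n)) / lam"
    by (simp add: r_def t_def exp_of_nat_mult[symmetric] mult_ac)
  finally show ?thesis .
qed

section \<open>Peaks that are too small or too large\<close>

lemma ou_pos: "1 \<le> n \<Longrightarrow> real (ou n) > 0"
  using pairs_le_ou[of n] pairs_pos[of n n] by simp

text \<open>For peaks below K sqrt n the deficit in the upper bound is at least \<delta> sqrt n,
  whereas \<open>ou n\<close> is at least half of exp((2 lam - \<delta>/2) sqrt n). There are at
  most n peaks. K+1 instead of K accounts for the index k+1 in place of the peak 2k+1.\<close>

lemma small_peak_negligible:
  fixes K :: real
  assumes K: "0 \<le> K"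
  shows "(\<lambda>n. (\<Sum>k | k < (n + 1) div 2 \<and> real (2 * k + 1) < K * sqrt n. pairs (k + 1) (n - (2 * k + 1)))
      / real (ou n)) \<longlonglongrightarrow> 0"
proof -
  define \<delta> where "\<delta> = exp (- (lam * (K + 1))) / lam"
  have \<delta>: "\<delta> > 0" "0 < \<delta> / 2" using lam_pos by (simp_all add: \<delta>_def)
  define B where "B = (\<lambda>n::nat. 2 * real n * exp (- (\<delta> / 2 * sqrt n)))"
  have "B \<longlonglongrightarrow> 0" unfolding B_def using \<delta> by real_asymp
  moreover have "eventually (\<lambda>n. norm ((\<Sum>k | k < (n + 1) div 2 \<and> real (2 * k + 1) < K * sqrt n. pairs (k + 1) (n
      - (2 * k + 1))) / real (ou n)) \<le> B n) sequentially"
    using log_pairs_lower[OF \<delta>(2)] eventually_ge_at_top[of 1]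
  proof (eventually_elim)
    case (elim n)
    let ?S = "{k. k < (n + 1) div 2 \<and> real (2 * k + 1) < K * sqrt n}"
    have low: "exp ((2 * lam - \<delta> / 2) * sqrt n) \<le> 2 * real (ou n)"
      using elim \<delta> pairs_le_ou[of n] by simp
    have sn: "sqrt n \<ge> 1" using elim by simp
    have up: "pairs (k + 1) (n - (2 * k + 1)) \<le> exp ((2 * lam - \<delta>) * sqrt n)" if k: "k \<in> ?S" for k
    proof -
      have "pairs (k + 1) (n - (2 * k + 1)) \<le> exp (2 * lam * sqrt n - sqrt n * exp (- (2 * lam * real (k + 1)
          / sqrt n)) / lam)"
        using elim by (intro pairs_upper) auto
      also have "\<dots> \<le> exp ((2 * lam - \<delta>) * sqrt n)"
      proof -
        have "2 * real k + 1 < K * sqrt n" using k by simp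
        moreover have "(K + 1) * sqrt n = K * sqrt n + sqrt n" by (simp add: distrib_right)
        moreover have "2 * real (k + 1) = 2 * real k + 2" by simp
        ultimately have "2 * real (k + 1) \<le> (K + 1) * sqrt n" using sn by linarith
        then have "lam * (2 * real (k + 1) / sqrt n) \<le> lam * (K + 1)"
          using sn lam_pos by (intro mult_left_mono) (auto simp: divide_le_eq)
        then have "exp (- (lam * (K + 1))) \<le> exp (- (2 * lam * real (k + 1) / sqrt n))" by (simp add: mult_ac)
        then have "\<delta> \<le> exp (- (2 * lam * real (k + 1) / sqrt n)) / lam"
          unfolding \<delta>_def using lam_pos by (intro divide_right_mono) auto
        then have "\<delta> * sqrt n \<le> exp (- (2 * lam * real (k + 1) / sqrt n)) / lam * sqrt n"
          using sn by (intro mult_right_mono) auto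
        then show ?thesis by (simp add: algebra_simps)
      qed
      finally show ?thesis .
    qed
    have "(\<Sum>k\<in>?S. pairs (k + 1) (n - (2 * k + 1))) \<le> real (card ?S) * exp ((2 * lam - \<delta>) * sqrt n)"
      using up by (rule sum_bounded_above)
    also have "\<dots> \<le> real n * exp ((2 * lam - \<delta>) * sqrt n)"
    proof (intro mult_right_mono)
      have "card ?S \<le> card {..<(n + 1) div 2}" by (intro card_mono) auto
      then show "real (card ?S) \<le> real n" using elim by simp
    qed auto
    also have "exp ((2 * lam - \<delta>) * sqrt n) = exp ((2 * lam - \<delta> / 2) * sqrt n) * exp (- (\<delta> / 2 * sqrt n))"
      by (simp add: exp_add[symmetric] algebra_simps)
    also have "real n * (exp ((2 * lam - \<delta> / 2) * sqrt n) * exp (- (\<delta> / 2 * sqrt n)))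
        \<le> real n * ((2 * real (ou n)) * exp (- (\<delta> / 2 * sqrt n)))"
      using low by (intro mult_left_mono mult_right_mono) auto
    also have "\<dots> = B n * real (ou n)" by (simp add: B_def)
    finally have "(\<Sum>k\<in>?S. pairs (k + 1) (n - (2 * k + 1))) \<le> B n * real (ou n)" .
    moreover have "0 \<le> (\<Sum>k\<in>?S. pairs (k + 1) (n - (2 * k + 1)))" by (intro sum_nonneg pairs_nonneg)
    ultimately show ?case using ou_pos[OF elim(2)] by (simp add: divide_le_eq)
  qed
  ultimately show ?thesis by (rule Lim_null_comparison[rotated])
qed

text \<open>Removing a peak above e n from the size costs a factor exp(-e sqrt n / 5) relative to
  all pairs of size n, by the a priori decay. Without such peaks the remaining size m satisfies m/n
  close to 1, so sqrt m and sqrt n may be exchanged.\<close>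

lemma large_peak_negligible:
  fixes e :: real
  assumes e: "0 < e"
  shows "(\<lambda>n. (\<Sum>k | k < (n + 1) div 2 \<and> real (2 * k + 1) > e * n. pairs (k + 1) (n - (2 * k + 1)))
      / real (ou n)) \<longlonglongrightarrow> 0"
proof -
  define B where "B = (\<lambda>n::nat. 4 * real n * exp (- (e * sqrt n / 5)))"
  have "B \<longlonglongrightarrow> 0" unfolding B_def using e by real_asymp
  moreover have "eventually (\<lambda>n. norm ((\<Sum>k | k < (n + 1) div 2 \<and> real (2 * k + 1) > e * n. pairs (k + 1) (n - (2
      * k + 1))) / real (ou n)) \<le> B n) sequentially"
    \<comment> \<open>n \<ge> 3 ensures sqrt n \<ge> 3/2, that is 3 sqrt n \<le> 2n, the condition
      of the decay bound for index n.\<close>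
    using eventually_ge_at_top[of 3]
  proof eventually_elim
    case (elim n)
    let ?S = "{k. k < (n + 1) div 2 \<and> real (2 * k + 1) > e * n}"
    have sn: "sqrt n \<ge> 3 / 2" using elim by (intro real_le_rsqrt) (auto simp: power2_eq_square)
    have up: "pairs (k + 1) (n - (2 * k + 1)) \<le> 4 * exp (- (e * sqrt n / 5)) * real (ou n)" if k: "k \<in> ?S" for k
    proof -
      have kn: "2 * k + 1 \<le> n" using k by auto
      have "pairs (k + 1) (n - (2 * k + 1)) \<le> pairs n (n - (2 * k + 1))"
        using kn by (intro pairs_mono_index) auto
      also have "\<dots> \<le> 2 * exp (- real (2 * k + 1) / (5 * sqrt n)) * pairs n n"
      proof (rule pairs_decay)
        have "3 * sqrt n \<le> 2 * sqrt n * sqrt n" using sn by (intro mult_right_mono) auto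
        also have "\<dots> = 2 * real n" by simp
        finally show "3 * sqrt n \<le> 2 * real n" .
      qed (use kn elim in auto)
      also have "\<dots> \<le> 2 * exp (- (e * sqrt n / 5)) * (2 * real (ou n))"
      proof (intro mult_mono mult_left_mono)
        have "e * n / (5 * sqrt n) = e * (n / sqrt n) / 5" by simp
        then have "e * sqrt n / 5 = e * n / (5 * sqrt n)" by (simp only: real_div_sqrt of_nat_0_le_iff)
        also have "\<dots> \<le> real (2 * k + 1) / (5 * sqrt n)" using k sn by (intro divide_right_mono) auto
        finally show "exp (- real (2 * k + 1) / (5 * sqrt n)) \<le> exp (- (e * sqrt n / 5))"
          by (simp only: exp_le_cancel_iff minus_divide_left[symmetric] neg_le_iff_le)
        show "pairs n n \<le> 2 * real (ou n)" using elim by (intro pairs_le_ou) auto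
      qed (auto simp: pairs_nonneg)
      finally show ?thesis by simp
    qed
    have "(\<Sum>k\<in>?S. pairs (k + 1) (n - (2 * k + 1)))
        \<le> real (card ?S) * (4 * exp (- (e * sqrt n / 5)) * real (ou n))"
      using up by (rule sum_bounded_above)
    also have "\<dots> \<le> real n * (4 * exp (- (e * sqrt n / 5)) * real (ou n))"
    proof (intro mult_right_mono)
      have "card ?S \<le> card {..<(n + 1) div 2}" by (intro card_mono) auto
      then show "real (card ?S) \<le> real n" using elim by simp
    qed auto
    also have "\<dots> = B n * real (ou n)" by (simp add: B_def)
    finally have "(\<Sum>k\<in>?S. pairs (k + 1) (n - (2 * k + 1))) \<le> B n * real (ou n)" .
    moreover have "0 \<le> (\<Sum>k\<in>?S. pairs (k + 1) (n - (2 * k + 1)))" by (intro sum_nonneg pairs_nonneg)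
    moreover have "real (ou n) > 0" using elim by (intro ou_pos) auto
    ultimately show ?case by (simp add: divide_le_eq)
  qed
  ultimately show ?thesis by (rule Lim_null_comparison[rotated])
qed

section \<open>The limit law\<close>

definition rank_gf :: "real \<Rightarrow> nat \<Rightarrow> nat \<Rightarrow> complex" where
  "rank_gf \<alpha> k m = fps_nth (odd_gf (iexp \<alpha>) k * odd_gf (iexp (- \<alpha>)) k) m"

lemma norm_rank_gf_le: "cmod (rank_gf \<alpha> k m) \<le> pairs k m"
  unfolding rank_gf_def pairs_def power2_eq_square by (intro majorant_mult majorant_odd_gf) auto

text \<open>By contradiction: counterexamples for K = i + 1 form a sequence along which m/n tends to
  1 and k / sqrt m to infinity, so the limit theorem for a fixed peak applies to it and excludes
  them.\<close>

lemma rank_gf_uniform: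
  assumes \<eta>: "0 < \<eta>"
  shows "\<exists>K\<ge>1. \<forall>n k. real n \<ge> K \<longrightarrow> K * sqrt n \<le> real (2 * k + 1) \<longrightarrow> real (2 * k + 1) * K \<le> real n \<longrightarrow>
    cmod (rank_gf (\<tau> / sqrt (3 * real n / 2)) (k + 1) (n - (2 * k + 1)) - of_real (1 / cosh \<tau>)
        * of_real (pairs (k + 1) (n - (2 * k + 1))))
      \<le> \<eta> * pairs (k + 1) (n - (2 * k + 1))"
proof (rule ccontr)
  assume neg: "\<not> ?thesis"
  define bad where "bad = (\<lambda>n k. \<not> cmod (rank_gf (\<tau> / sqrt (3 * real n / 2)) (k + 1) (n - (2 * k + 1))
      - of_real (1 / cosh \<tau>) * of_real (pairs (k + 1) (n - (2 * k + 1))))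
      \<le> \<eta> * pairs (k + 1) (n - (2 * k + 1)))"
  have "\<forall>K\<ge>1. \<exists>n k. real n \<ge> K \<and> K * sqrt n \<le> real (2 * k + 1) \<and> real (2 * k + 1) * K \<le> real n \<and> bad n k"
    using neg unfolding bad_def by blast
  then have "\<forall>i::nat. \<exists>n k. real n \<ge> real i + 1 \<and> (real i + 1) * sqrt n
      \<le> real (2 * k + 1) \<and> real (2 * k + 1) * (real i + 1) \<le> real n \<and> bad n k"
    by simp
  then obtain n k where nk: "\<And>i. real (n i) \<ge> real i + 1" "\<And>i. (real i + 1) * sqrt (n i) \<le> real (2 * k i + 1)"
      "\<And>i. real (2 * k i + 1) * (real i + 1) \<le> real (n i)" "\<And>i. bad (n i) (k i)"
    by metis
  define m where "m = (\<lambda>i. n i - (2 * k i + 1))"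
  have n0: "real (n i) > 0" for i using nk(1)[of i] by linarith
  have kn: "real (2 * k i + 1) \<le> real (n i) / (real i + 1)" for i
    using nk(3)[of i] by (simp add: pos_le_divide_eq)
  have kn': "2 * k i + 1 \<le> n i" for i
  proof -
    have "real (2 * k i + 1) * 1 \<le> real (2 * k i + 1) * (real i + 1)" by (intro mult_left_mono) auto
    also have "\<dots> \<le> real (n i)" by (rule nk(3))
    finally show ?thesis by (simp only: mult_1_right of_nat_le_iff)
  qed
  have m: "real (m i) = real (n i) - real (2 * k i + 1)" for i
    unfolding m_def using kn'[of i] by (rule of_nat_diff)
  have mn: "real (m i) / real (n i) \<ge> 1 - 1 / (real i + 1)" for i
  proof -
    have "real (m i) \<ge> real (n i) * (1 - 1 / (real i + 1))" using kn[of i] by (simp add: m right_diff_distrib)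
    then show ?thesis using n0[of i] by (simp add: pos_le_divide_eq mult.commute)
  qed
  have mn1: "real (m i) / real (n i) \<le> 1" for i using n0[of i] by (simp add: m divide_le_eq)
  have low: "(\<lambda>i. 1 - 1 / (real i + 1)) \<longlonglongrightarrow> 1" by real_asymp
  have ratio: "(\<lambda>i. real (m i) / real (n i)) \<longlonglongrightarrow> 1"
    by (rule tendsto_sandwich[OF _ _ low tendsto_const]) (use mn mn1 in auto)
  have W: "filterlim (\<lambda>i. (k i + 1, m i)) wide sequentially"
  proof (rule filterlim_wide)
    have "filterlim (\<lambda>i::nat. (real i + 1) * (1 - 1 / (real i + 1))) at_top sequentially" by real_asymp
    then have "filterlim (\<lambda>i. real (m i)) at_top sequentially"
    proof (rule filterlim_at_top_mono)
      have "(real i + 1) * (1 - 1 / (real i + 1)) \<le> real (m i)" for i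
      proof -
        have "(real i + 1) * (1 - 1 / (real i + 1)) \<le> real (n i) * (1 - 1 / (real i + 1))"
          using nk(1)[of i] by (intro mult_right_mono) auto
        also have "\<dots> \<le> real (m i)" using kn[of i] by (simp add: m right_diff_distrib)
        finally show ?thesis .
      qed
      then show "eventually (\<lambda>i. (real i + 1) * (1 - 1 / (real i + 1)) \<le> real (m i)) sequentially" by simp
    qed
    then show mt: "filterlim m at_top sequentially" by (rule filterlim_nat_if_real)
    have "filterlim (\<lambda>i::nat. (real i + 1) / 2) at_top sequentially" by real_asymp
    then show "filterlim (\<lambda>i. real (k i + 1) / sqrt (real (m i))) at_top sequentially"
    proof (rule filterlim_at_top_mono)
      have "eventually (\<lambda>i. m i \<ge> 1) sequentially" using mt by (auto simp: filterlim_at_top)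
      then show "eventually (\<lambda>i. (real i + 1) / 2 \<le> real (k i + 1) / sqrt (real (m i))) sequentially"
      proof eventually_elim
        case (elim i)
        have "(real i + 1) / 2 * sqrt (m i) \<le> (real i + 1) / 2 * sqrt (n i)"
          by (intro mult_left_mono) (auto simp: m)
        also have "\<dots> \<le> real (k i + 1)" using nk(2)[of i] by simp
        finally show ?case using elim by (simp add: pos_le_divide_eq)
      qed
    qed
  qed
  \<comment> \<open>The normalization is designed for this value: lam = pi / sqrt 6 gives pi
    \<theta> / (2 lam) = \<tau>, hence the limit 1 / cosh \<tau>.\<close>
  define \<theta> where "\<theta> = \<tau> / sqrt (3 / 2)"
  have "(\<lambda>i. \<theta> * sqrt (real (m i) / real (n i))) \<longlonglongrightarrow> \<theta> * sqrt 1"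
    by (intro tendsto_intros ratio)
  moreover have "\<theta> * sqrt (real (m i) / real (n i)) = \<tau> / sqrt (3 * real (n i) / 2) * sqrt (m i)" for i
  proof -
    have "sqrt (3 * real (n i) / 2) = sqrt (3 / 2) * sqrt (n i)" by (simp flip: real_sqrt_mult)
    then show ?thesis by (simp add: \<theta>_def real_sqrt_divide)
  qed
  ultimately have \<alpha>: "(\<lambda>i. \<tau> / sqrt (3 * real (n i) / 2) * sqrt (m i)) \<longlonglongrightarrow> \<theta>" by simp
  have "pi * (\<theta> / lam) / 2 = \<tau>"
  proof -
    have "sqrt (3 / 2) * 2 = sqrt 6"
    proof -
      have "sqrt (3 / 2) * 2 = sqrt (3 / 2) * sqrt 4" by simp
      also have "\<dots> = sqrt (3 / 2 * 4)" by (simp only: real_sqrt_mult)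
      finally show ?thesis by simp
    qed
    moreover have "pi * (\<theta> / lam) / 2 = \<tau> * sqrt 6 / (sqrt (3 / 2) * 2)" by (simp add: \<theta>_def lam_def)
    ultimately show ?thesis by simp
  qed
  with twisted_ratio_tendsto[OF W \<alpha>]
  have "(\<lambda>i. rank_gf (\<tau> / sqrt (3 * real (n i) / 2)) (k i + 1) (m i) / of_real (pairs (k i + 1) (m i)))
      \<longlonglongrightarrow> of_real (1 / cosh \<tau>)"
    by (simp only: rank_gf_def)
  then have "eventually (\<lambda>i. dist (rank_gf (\<tau> / sqrt (3 * real (n i) / 2)) (k i + 1) (m i) / of_real (pairs (k i
      + 1) (m i))) (of_real (1 / cosh \<tau>)) < \<eta>) sequentially"
    using \<eta> by (rule tendstoD)
  then obtain i where i: "dist (rank_gf (\<tau> / sqrt (3 * real (n i) / 2)) (k i + 1) (m i) / of_real (pairs (k i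
      + 1) (m i))) (of_real (1 / cosh \<tau>)) < \<eta>"
    by (auto simp: eventually_sequentially)
  define g where "g = pairs (k i + 1) (m i)"
  define w where "w = rank_gf (\<tau> / sqrt (3 * real (n i) / 2)) (k i + 1) (m i)"
  define c where "c = complex_of_real (1 / cosh \<tau>)"
  have g: "g > 0" unfolding g_def by (rule pairs_pos) simp
  have "w - c * of_real g = (w / of_real g - c) * of_real g" using g by (simp add: left_diff_distrib)
  then have "cmod (w - c * of_real g) = cmod (w / of_real g - c) * g" using g
      by (simp only: norm_mult norm_of_real abs_of_pos)
  also have "\<dots> \<le> \<eta> * g" using i g by (intro mult_right_mono) (auto simp: dist_norm w_def g_def c_def)
  finally have "\<not> bad (n i) (k i)" by (simp only: bad_def w_def c_def g_def m_def not_not)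
  with nk(4) show False by blast
qed

text \<open>Peaks between K sqrt n and n/K are covered by the uniform estimate with e/4. On the two
  remaining sets the trivial bound 2p is used, and each carries a share below e/8 of
  \<open>ou n\<close>; in total e/4 + 2 (e/8 + e/8) < e.\<close>

lemma rank_char_sum_tendsto:
  "(\<lambda>n. (\<Sum>k<(n + 1) div 2. rank_gf (\<tau> / sqrt (3 * real n / 2)) (k + 1) (n - (2 * k + 1)))
      / of_real (real (ou n)))
     \<longlonglongrightarrow> of_real (1 / cosh \<tau>)"
proof (rule tendstoI)
  fix e :: real assume e: "e > 0"
  obtain K where K: "K \<ge> 1" "\<And>n k. real n \<ge> K \<Longrightarrow> K * sqrt n \<le> real (2 * k + 1) \<Longrightarrow> real (2 * k + 1) * K \<le> real n \<Longrightarrow>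
    cmod (rank_gf (\<tau> / sqrt (3 * real n / 2)) (k + 1) (n - (2 * k + 1)) - of_real (1 / cosh \<tau>)
        * of_real (pairs (k + 1) (n - (2 * k + 1))))
      \<le> e / 4 * pairs (k + 1) (n - (2 * k + 1))"
    using rank_gf_uniform[of "e / 4" \<tau>] e by auto
  have E1: "eventually (\<lambda>n. (\<Sum>k | k < (n + 1) div 2 \<and> real (2 * k + 1) < K * sqrt n. pairs (k + 1) (n - (2 * k
      + 1))) / real (ou n) < e / 8) sequentially"
    by (rule order_tendstoD(2)[OF small_peak_negligible]) (use K e in auto)
  have E2: "eventually (\<lambda>n. (\<Sum>k | k < (n + 1) div 2 \<and> real (2 * k + 1) > 1 / K * n. pairs (k + 1) (n - (2 * k
      + 1))) / real (ou n) < e / 8) sequentially"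
    by (rule order_tendstoD(2)[OF large_peak_negligible]) (use K e in auto)
  have E3: "eventually (\<lambda>n. real n \<ge> K) sequentially"
    using filterlim_real_sequentially by (rule filterlim_at_top_eventually)
  show "eventually (\<lambda>n. dist ((\<Sum>k<(n + 1) div 2. rank_gf (\<tau> / sqrt (3 * real n / 2)) (k + 1) (n - (2 * k + 1)))
      / of_real (real (ou n))) (of_real (1 / cosh \<tau>)) < e) sequentially"
    using E1 E2 E3
  proof eventually_elim
    case (elim n)
    have n1: "1 \<le> n" using elim(3) K(1) by linarith
    define p where "p = (\<lambda>k. pairs (k + 1) (n - (2 * k + 1)))"
    define w where "w = (\<lambda>k. rank_gf (\<tau> / sqrt (3 * real n / 2)) (k + 1) (n - (2 * k + 1)))"
    define c where "c = complex_of_real (1 / cosh \<tau>)"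
    define o' where "o' = real (ou n)"
    define A where "A = {..<(n + 1) div 2}"
    define S1 where "S1 = {k. k < (n + 1) div 2 \<and> real (2 * k + 1) < K * sqrt n}"
    define S2 where "S2 = {k. k < (n + 1) div 2 \<and> real (2 * k + 1) > 1 / K * n}"
    have o: "o' > 0" unfolding o'_def by (rule ou_pos[OF n1])
    have p0: "p k \<ge> 0" for k by (simp add: p_def pairs_nonneg)
    have op: "o' = (\<Sum>k\<in>A. p k)" by (simp add: o'_def ou_eq A_def p_def)
    have fin: "finite A" "finite S1" "finite S2" by (auto simp: A_def S1_def S2_def)
    have cle: "cmod c \<le> 1" using cosh_real_ge_1[of \<tau>] by (simp add: c_def norm_divide)
    have wp: "cmod (w k) \<le> p k" for k unfolding w_def p_def by (rule norm_rank_gf_le)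
    have bd: "cmod (w k - c * of_real (p k)) \<le> e / 4 * p k + 2 * ((if k \<in> S1 then p k else 0)
        + (if k \<in> S2 then p k else 0))" if k: "k \<in> A" for k
    proof (cases "k \<in> S1 \<or> k \<in> S2")
      case True
      have "cmod (w k - c * of_real (p k)) \<le> cmod (w k) + cmod c * p k"
        using norm_triangle_ineq4[of "w k" "c * of_real (p k)"] p0[of k] by (simp add: norm_mult)
      also have "\<dots> \<le> p k + 1 * p k" using wp cle p0 by (intro add_mono mult_right_mono)
      also have "\<dots> \<le> e / 4 * p k + 2 * ((if k \<in> S1 then p k else 0) + (if k \<in> S2 then p k else 0))"
        using True e p0[of k] by auto
      finally show ?thesis .
    next
      case False
      have "K * sqrt n \<le> real (2 * k + 1)" using False k by (auto simp: S1_def A_def)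
      moreover have "real (2 * k + 1) \<le> 1 / K * n" using False k by (auto simp: S2_def A_def)
      then have "real (2 * k + 1) * K \<le> real n" using K(1) by (simp add: pos_le_divide_eq)
      ultimately have "cmod (w k - c * of_real (p k)) \<le> e / 4 * p k"
        unfolding w_def c_def p_def by (intro K(2) elim(3))
      then show ?thesis using False by simp
    qed
    have "(\<Sum>k\<in>A. w k) - c * of_real o' = (\<Sum>k\<in>A. w k - c * of_real (p k))"
      by (simp add: op sum_subtractf sum_distrib_left)
    also have "cmod \<dots> \<le> (\<Sum>k\<in>A. e / 4 * p k + 2 * ((if k \<in> S1 then p k else 0) + (if k \<in> S2 then p k else 0)))"
      using bd by (rule sum_norm_le)
    also have "\<dots> = e / 4 * o' + 2 * ((\<Sum>k\<in>S1. p k) + (\<Sum>k\<in>S2. p k))"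
    proof -
      have "A \<inter> S1 = S1" "A \<inter> S2 = S2" by (auto simp: A_def S1_def S2_def)
      then have "(\<Sum>k\<in>A. if k \<in> S1 then p k else 0) = (\<Sum>k\<in>S1. p k)" "(\<Sum>k\<in>A. if k \<in> S2 then p k else 0)
          = (\<Sum>k\<in>S2. p k)"
        using sum.inter_restrict[OF fin(1), of p S1] sum.inter_restrict[OF fin(1), of p S2] by simp_all
      then show ?thesis by (simp only: sum.distrib sum_distrib_left[symmetric] op)
    qed
    also have "\<dots> < e / 4 * o' + 2 * (e / 8 * o' + e / 8 * o')"
    proof -
      have "(\<Sum>k\<in>S1. p k) < e / 8 * o'" "(\<Sum>k\<in>S2. p k) < e / 8 * o'"
        using elim(1,2) o unfolding S1_def S2_def p_def o'_def by (simp_all add: pos_divide_less_eq)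
      then show ?thesis by (intro add_strict_left_mono mult_strict_left_mono add_strict_mono) simp_all
    qed
    also have "\<dots> \<le> e * o'" using e o by simp
    finally have main: "cmod ((\<Sum>k\<in>A. w k) - c * of_real o') < e * o'" .
    have "(\<Sum>k\<in>A. w k) / of_real o' - c = ((\<Sum>k\<in>A. w k) - c * of_real o') / of_real o'" using o
        by (simp add: field_simps)
    then have "cmod ((\<Sum>k\<in>A. w k) / of_real o' - c) < e" using main o
        by (simp add: norm_divide pos_divide_less_eq)
    then show ?case by (simp only: dist_norm A_def w_def o'_def c_def)
  qed
qed

lemma char_normalized_rank:
  assumes n: "1 \<le> n"
  shows "char (normalized_rank_distr n) \<tau> =
    (\<Sum>k<(n + 1) div 2. rank_gf (\<tau> / sqrt (3 * real n / 2)) (k + 1) (n - (2 * k + 1))) / of_real (real (ou n))"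
proof -
  define \<alpha> where "\<alpha> = \<tau> / sqrt (3 * real n / 2)"
  have OU: "finite (OU n)" "OU n \<noteq> {}" using n by (auto simp: finite_OU OU_nonempty)
  have "char (normalized_rank_distr n) \<tau>
      = integral\<^sup>L (measure_pmf (pmf_of_set (OU n))) (\<lambda>\<sigma>. iexp (\<tau> * normalized_rank n \<sigma>))"
    unfolding char_def normalized_rank_distr_def by (subst integral_distr) auto
  also have "\<dots> = (\<Sum>\<sigma>\<in>OU n. pmf (pmf_of_set (OU n)) \<sigma> *\<^sub>R iexp (\<tau> * normalized_rank n \<sigma>))"
    by (rule integral_measure_pmf) (use OU in auto)
  also have "\<dots> = (\<Sum>\<sigma>\<in>OU n. iexp (\<tau> * normalized_rank n \<sigma>)) / of_real (real (ou n))"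
    using OU by (simp add: ou_def scaleR_conv_of_real sum_divide_distrib)
  also have "(\<Sum>\<sigma>\<in>OU n. iexp (\<tau> * normalized_rank n \<sigma>))
      = (\<Sum>(as, c, bs)\<in>OU n. iexp \<alpha> ^ length as * iexp (- \<alpha>) ^ length bs)"
  proof (intro sum.cong refl)
    fix \<sigma> assume "\<sigma> \<in> OU n"
    obtain as c bs where \<sigma>: "\<sigma> = (as, c, bs)" by (cases \<sigma>)
    have eq: "\<tau> * normalized_rank n \<sigma> = real (length as) * \<alpha> + real (length bs) * (- \<alpha>)"
      by (simp add: normalized_rank_def \<sigma> \<alpha>_def diff_divide_distrib algebra_simps)
    have "\<i> * complex_of_real (\<tau> * normalized_rank n \<sigma>)
        = of_nat (length as) * (\<i> * of_real \<alpha>) + of_nat (length bs) * (\<i> * of_real (- \<alpha>))"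
      unfolding eq by (simp add: algebra_simps)
    then show "iexp (\<tau> * normalized_rank n \<sigma>)
        = (case \<sigma> of (as, c, bs) \<Rightarrow> iexp \<alpha> ^ length as * iexp (- \<alpha>) ^ length bs)"
      by (simp only: \<sigma> case_prod_conv exp_add exp_of_nat_mult)
  qed
  finally show ?thesis unfolding OU_rank_gf rank_gf_def \<alpha>_def .
qed

lemma real_distribution_normalized_rank: "real_distribution (normalized_rank_distr n)"
proof -
  have "prob_space (normalized_rank_distr n)"
    unfolding normalized_rank_distr_def by (rule measure_pmf.prob_space_distr) simp
  then show ?thesis
    by (simp add: real_distribution_def real_distribution_axioms_def normalized_rank_distr_def)
qed

theorem theorem1p4:
  shows "weak_conv_m normalized_rank_distr hyp_secant_distr \<and>
    (\<forall>x::real. (\<lambda>n. 1 / real (ou n) *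
        real (card {\<sigma> \<in> OU n. real_of_int (seq_rank \<sigma>) / sqrt (3 * real n / 2) \<le> x}))
      \<longlonglongrightarrow> 2 / pi * arctan (exp (pi * x / 2)))"
proof -
  have conv: "weak_conv_m normalized_rank_distr hyp_secant_distr"
  proof (rule levy_continuity)
    fix \<tau>
    have "eventually (\<lambda>n. (\<Sum>k<(n + 1) div 2. rank_gf (\<tau> / sqrt (3 * real n / 2)) (k + 1) (n - (2 * k + 1)))
        / of_real (real (ou n))
        = char (normalized_rank_distr n) \<tau>) sequentially"
      using eventually_ge_at_top[of 1] by eventually_elim (simp only: char_normalized_rank)
    with rank_char_sum_tendsto[of \<tau>] show "(\<lambda>n. char (normalized_rank_distr n) \<tau>) \<longlonglongrightarrow> char hyp_secant_distr \<tau>"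
      unfolding char_hyp_secant by (rule Lim_transform_eventually)
  qed (rule real_distribution_normalized_rank real_distribution_hyp_secant)+
  moreover have "(\<lambda>n. 1 / real (ou n) * real (card {\<sigma> \<in> OU n. real_of_int (seq_rank \<sigma>) / sqrt (3 * real n / 2)
      \<le> x}))
      \<longlonglongrightarrow> 2 / pi * arctan (exp (pi * x / 2))" for x
  proof -
    \<comment> \<open>The limit cdf is continuous everywhere, so weak convergence gives convergence
      of the cdfs at every x.\<close>
    have "isCont hyp_secant_cdf x"
      unfolding hyp_secant_cdf_def by (intro continuous_intros) simp
    then have "(\<lambda>n. cdf (normalized_rank_distr n) x) \<longlonglongrightarrow> hyp_secant_cdf x"
      using conv by (simp add: weak_conv_m_def weak_conv_def cdf_hyp_secant)
    moreover have "eventually (\<lambda>n. cdf (normalized_rank_distr n) x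
        = 1 / real (ou n) * real (card {\<sigma> \<in> OU n. real_of_int (seq_rank \<sigma>) / sqrt (3 * real n / 2)
            \<le> x})) sequentially"
      using eventually_ge_at_top[of 1]
    proof eventually_elim
      case (elim n)
      have OU: "finite (OU n)" "OU n \<noteq> {}" using elim by (auto simp: finite_OU OU_nonempty)
      have "cdf (normalized_rank_distr n) x = measure (measure_pmf (pmf_of_set (OU n))) {\<sigma>. normalized_rank n \<sigma>
          \<le> x}"
        unfolding cdf_def normalized_rank_distr_def by (subst measure_distr) (auto simp: vimage_def)
      also have "\<dots> = real (card (OU n \<inter> {\<sigma>. normalized_rank n \<sigma> \<le> x})) / real (card (OU n))"
        using OU by (rule measure_pmf_of_set[rotated])
      also have "OU n \<inter> {\<sigma>. normalized_rank n \<sigma> \<le> x}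
          = {\<sigma> \<in> OU n. real_of_int (seq_rank \<sigma>) / sqrt (3 * real n / 2) \<le> x}"
        by (auto simp: normalized_rank_def)
      finally show ?case by (simp add: ou_def)
    qed
    ultimately show ?thesis unfolding hyp_secant_cdf_def by (rule Lim_transform_eventually)
  qed
  ultimately show ?thesis by blast
qed

end
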